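(* Let $\nu\in\mathcal{P}_2(\mathbb{R}^2)$. Then $$\min_{\gamma\in\Gamma(\nu)}\int c(x,y)\,d\gamma=\max_{G\in\mathfrak{M}}\int\phi_G\,d\nu,$$ where the minimum and maximum are attained. A measure $\gamma\in\Gamma(\nu)$ and a set $G\in\mathfrak{M}$ are respectively a minimizer and a maximizer if and only if $$c(x,y)=\phi_G(y),\qquad (x,y)\in\operatorname{supp}\gamma.$$ In this case $G$ contains the support of the $x$-marginal of $\gamma$. Moreover, if $\widetilde G\in\mathfrak{M}$ is any other maximizer, then $\phi_G(y)=\phi_{\widetilde G}(y)$ for all $y\in\operatorname{supp}\nu$ and $G\cap\operatorname{supp}\nu=\widetilde G\cap\operatorname{supp}\nu$. In particular, $\phi_G$ and $G$ are unique if $\operatorname{supp}\nu=\mathbb{R}^2$.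
   Context: $c(x,y)=(x_1-y_1)(x_2-y_2)$ for $x,y\in\mathbb{R}^2$. $\mathcal{P}_2(\mathbb{R}^d)$: Borel probability measures on $\mathbb{R}^d$ with finite second moment. $\Gamma(\nu)$: the set of $\gamma\in\mathcal{P}_2(\mathbb{R}^2\times\mathbb{R}^2)$ (points written $(x,y)$) with $y$-marginal $\nu$ and $\gamma(y|x)=x$, i.e. the conditional expectation of $y$ given $x$ under $\gamma$ equals $x$, $\gamma$-a.s. $\operatorname{supp}$ is the support. A set $G\subset\mathbb{R}^2$ is monotone if $c(r,s)\ge0$ for all $r,s\in G$, maximal monotone if it is not a proper subset of a monotone set; $\mathfrak{M}$ is the family of maximal monotone sets. $\phi_G(y)=\inf_{x\in G}c(x,y)$, which takes values in $[-\infty,0]$. *)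

theory Defs
  imports "HOL-Analysis.Analysis" "HOL-Probability.Conditional_Expectation"
begin

type_synonym pt = "real \<times> real"

definition c :: "pt \<Rightarrow> pt \<Rightarrow> real" where
  "c x y = (fst x - fst y) * (snd x - snd y)"

definition P2 :: "('a::euclidean_space) measure set" where
  "P2 = {M. prob_space M \<and> sets M = sets borel \<and> integrable M (\<lambda>z. (norm z)\<^sup>2)}"

definition msupp :: "('a::topological_space) measure \<Rightarrow> 'a set" where
  "msupp M = {z. \<forall>U. open U \<and> z \<in> U \<longrightarrow> emeasure M U > 0}"

definition Gamma :: "pt measure \<Rightarrow> (pt \<times> pt) measure set" where
  "Gamma \<nu> = {\<gamma>. \<gamma> \<in> P2 \<and> distr \<gamma> borel snd = \<nu> \<and>
     (AE z in \<gamma>. real_cond_exp \<gamma> (vimage_algebra (space \<gamma>) fst borel) (\<lambda>z. fst (snd z)) z = fst (fst z)) \<and>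
     (AE z in \<gamma>. real_cond_exp \<gamma> (vimage_algebra (space \<gamma>) fst borel) (\<lambda>z. snd (snd z)) z = snd (fst z))}"

definition monotone_set :: "pt set \<Rightarrow> bool" where
  "monotone_set G \<longleftrightarrow> (\<forall>r\<in>G. \<forall>s\<in>G. c r s \<ge> 0)"

definition MaxMono :: "pt set set" where
  "MaxMono = {G. monotone_set G \<and> (\<forall>H. monotone_set H \<and> G \<subseteq> H \<longrightarrow> H = G)}"

definition phi :: "pt set \<Rightarrow> pt \<Rightarrow> ereal" where
  "phi G y = (INF x\<in>G. ereal (c x y))"

text \<open>Integral of an extended-real valued function (positive part minus negative part);
  for phi_G (which is <= 0) this is minus the integral of -phi_G.\<close>
definition ereal_integral :: "'a measure \<Rightarrow> ('a \<Rightarrow> ereal) \<Rightarrow> ereal" where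
  "ereal_integral M f =
     enn2ereal (\<integral>\<^sup>+ y. e2ennreal (f y) \<partial>M) - enn2ereal (\<integral>\<^sup>+ y. e2ennreal (- f y) \<partial>M)"

definition primal :: "(pt \<times> pt) measure \<Rightarrow> real" where
  "primal \<gamma> = (\<integral> z. c (fst z) (snd z) \<partial>\<gamma>)"

definition dual :: "pt measure \<Rightarrow> pt set \<Rightarrow> ereal" where
  "dual \<nu> G = ereal_integral \<nu> (phi G)"

definition is_minimizer :: "pt measure \<Rightarrow> (pt \<times> pt) measure \<Rightarrow> bool" where
  "is_minimizer \<nu> \<gamma> \<longleftrightarrow> \<gamma> \<in> Gamma \<nu> \<and> (\<forall>\<gamma>'\<in>Gamma \<nu>. primal \<gamma> \<le> primal \<gamma>')"

definition is_maximizer :: "pt measure \<Rightarrow> pt set \<Rightarrow> bool" where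
  "is_maximizer \<nu> G \<longleftrightarrow> G \<in> MaxMono \<and> (\<forall>G'\<in>MaxMono. dual \<nu> G' \<le> dual \<nu> G)"

end

theory Submission
  imports Defs "HOL-Probability.Probability"
begin

text \<open>
  In the coordinates \<open>u = x\<^sub>1 + x\<^sub>2\<close>, \<open>v = x\<^sub>1 - x\<^sub>2\<close> we have \<open>4 c = du\<^sup>2 - dv\<^sup>2\<close>, so the maximal monotone sets are
  exactly the graphs \<open>v = f u\<close> of 1-Lipschitz functions on the line. For a martingale coupling, replacing
  \<open>x\<close> by the point of \<open>G\<close> with the same \<open>u\<close> changes the expected cost by \<open>- E (v - f u)\<^sup>2 / 4\<close>; this gives
  weak duality together with its equality case.

  A minimizer exists because couplings with a fixed second marginal are tight, and because the cost
  is, up to a constant, the integral of a nonnegative function. Collecting a small fraction of the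
  mass near two points \<open>(x, y)\<close>, \<open>(x', y')\<close> of its support into one new atom yields
  \<open>q c(x, y) + (1 - q) c(x', y') \<le> q (1 - q) c(y, y')\<close> for all \<open>q\<close> in \<open>[0, 1]\<close>. These inequalities say that the strips
  \<open>{g. c(g, y) \<ge> c(x, y)}\<close>, bounded by 1-Lipschitz graphs, meet pairwise on every line \<open>u = const\<close>, hence all meet;
  the upper envelope of their lower boundaries is a maximal monotone \<open>G\<close> with \<open>c(x, y) \<le> phi G y\<close> on the support,
  and there is no duality gap.
\<close>

section \<open>Weak compactness of measures on Euclidean spaces\<close>

text \<open>Compactness is used only on the primal side: a maximizer is read off the support of a
  minimizer. Since \<open>phi G y\<close> may be -\<infinity>, dual values are handled as integrals
  of the nonnegative function \<open>- phi G\<close>. The freedom in q is essential. With a = sqrt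
  (- 4 c(x, y)) and b = sqrt (- 4 c(x', y')), the sharpest choice q = b / (a + b) turns the
  two-point inequality into dv^2 \<le> (a + b)^2 + du^2, where du and dv are the coordinate
  differences of y and y'. By Minkowski's inequality this makes the two strips meet on every line u
  = const. Moving the remaining mass is cheap because its displacement is a function of x alone: the
  first-order change of the cost is this function times y - x, and that has mean zero. Uniqueness is
  where compactness fails. Points of the support of \<nu> need not carry contact points, contact
  points over y_n tending to y may run off to infinity, and \<open>phi G\<close> is only upper
  semicontinuous. The way out is that the same contact points serve both maximizers, combined with
  the product form of the cost.\<close>

definition triangle_wave :: "real \<Rightarrow> real" where
  "triangle_wave t = arccos (cos (pi * t)) / pi"

lemma triangle_wave_id: "0 \<le> t \<Longrightarrow> t \<le> 1 \<Longrightarrow> triangle_wave t = t"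
  unfolding triangle_wave_def by (subst arccos_cos) auto

lemma triangle_wave_periodic: "triangle_wave (2 * real n + t) = triangle_wave t"
proof -
  have "cos (pi * (2 * real n + t)) = cos (pi * t)"
    using cos_npi[of "2 * n"] sin_npi[of "2 * n"]
    by (simp add: distrib_left cos_add mult_ac)
  then show ?thesis unfolding triangle_wave_def by simp
qed

lemma continuous_on_triangle_wave: "continuous_on UNIV triangle_wave"
  unfolding triangle_wave_def by (intro continuous_intros continuous_on_arccos) auto

text \<open>The wave \<open>triangle_wave\<close> is the distance to the nearest even integer.
  Clipped, it is 0 within 1/3 of an even integer and 1 within 1/3 of an odd one, so on [0, 1] it
  tells a leading ternary digit 0 from a leading digit 2.\<close>

definition clipped_wave :: "real \<Rightarrow> real" where
  "clipped_wave t = max 0 (min 1 (3 * triangle_wave t - 1))"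

lemma clipped_wave_bounds: "0 \<le> clipped_wave t" "clipped_wave t \<le> 1"
  unfolding clipped_wave_def by auto

lemma continuous_on_clipped_wave: "continuous_on UNIV clipped_wave"
  unfolding clipped_wave_def
  by (intro continuous_intros continuous_on_triangle_wave)

text \<open>The coordinate functions of Schoenberg's space-filling curve in dimension \<open>d\<close>: at the ternary
  expansion \<open>\<Sum>j. 2 * b j / 3 ^ Suc j\<close> the \<open>i\<close>-th coordinate has the binary digits \<open>b (d * n + i)\<close>.\<close>

definition schoenberg :: "nat \<Rightarrow> nat \<Rightarrow> real \<Rightarrow> real" where
  "schoenberg d i t = (\<Sum>n. clipped_wave (3 ^ (d * n + i) * t) / 2 ^ Suc n)"

lemma continuous_on_schoenberg: "continuous_on UNIV (schoenberg d i)"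
proof -
  have "uniform_limit UNIV (\<lambda>N t. \<Sum>n<N. clipped_wave (3 ^ (d * n + i) * t) / 2 ^ Suc n)
      (schoenberg d i) sequentially"
    unfolding schoenberg_def
  proof (rule Weierstrass_m_test)
    show "summable (\<lambda>n. (1/2::real) ^ Suc n)"
      by (simp add: summable_geometric)
    show "norm (clipped_wave (3 ^ (d * n + i) * t) / 2 ^ Suc n) \<le> (1/2) ^ Suc n" for n t
      using clipped_wave_bounds[of "3 ^ (d * n + i) * t"]
      by (simp add: power_one_over divide_simps)
  qed
  then show ?thesis
    by (rule uniform_limit_theorem[rotated])
      (auto intro!: always_eventually continuous_intros
         continuous_on_compose2[OF continuous_on_clipped_wave])
qed

text \<open>The digits are differences of consecutive dyadic floors, so the partial sums telescope
  to \<open>\<lfloor>2 ^ N * x\<rfloor> / 2 ^ N\<close>. The telescoping starts from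
  \<open>\<lfloor>x\<rfloor> = 0\<close>, which excludes x = 1; there all digits are 1.\<close>

lemma binary_expansion:
  assumes "0 \<le> x" "x \<le> (1::real)"
  shows "\<exists>a::nat \<Rightarrow> nat. (\<forall>n. a n = 0 \<or> a n = 1) \<and> (\<lambda>n. real (a n) / 2 ^ Suc n) sums x"
proof (cases "x = 1")
  case True
  then show ?thesis using power_half_series
    by (intro exI[of _ "\<lambda>_. 1"]) (simp add: power_one_over)
next
  case False
  with assms have x: "x < 1" by simp
  define a where "a n = nat (\<lfloor>2 ^ Suc n * x\<rfloor> - 2 * \<lfloor>2 ^ n * x\<rfloor>)" for n
  have a01: "\<lfloor>2 ^ Suc n * x\<rfloor> - 2 * \<lfloor>2 ^ n * x\<rfloor> \<in> {0, 1}" for n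
    by (simp add: mult.assoc) linarith
  have ra: "real (a n) = real_of_int \<lfloor>2 ^ Suc n * x\<rfloor> - 2 * real_of_int \<lfloor>2 ^ n * x\<rfloor>" for n
    using a01[of n] unfolding a_def by auto
  have part: "(\<Sum>n<N. real (a n) / 2 ^ Suc n) = real_of_int \<lfloor>2 ^ N * x\<rfloor> / 2 ^ N" for N
  proof (induction N)
    case 0
    then show ?case using assms x by (simp add: floor_eq_iff)
  next
    case (Suc N)
    then show ?case by (simp add: ra field_simps)
  qed
  have "(\<lambda>N. real_of_int \<lfloor>2 ^ N * x\<rfloor> / 2 ^ N) \<longlonglongrightarrow> x"
  proof (rule tendsto_sandwich)
    show "\<forall>\<^sub>F N in sequentially. x - (1/2)^N \<le> real_of_int \<lfloor>2 ^ N * x\<rfloor> / 2 ^ N"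
    proof (intro always_eventually allI)
      fix N
      have "2 ^ N * x - 1 \<le> real_of_int \<lfloor>2 ^ N * x\<rfloor>" by linarith
      then have "(2 ^ N * x - 1) / 2 ^ N \<le> real_of_int \<lfloor>2 ^ N * x\<rfloor> / 2 ^ N"
        by (rule divide_right_mono) simp
      then show "x - (1/2)^N \<le> real_of_int \<lfloor>2 ^ N * x\<rfloor> / 2 ^ N"
        by (simp add: diff_divide_distrib power_one_over)
    qed
    show "\<forall>\<^sub>F N in sequentially. real_of_int \<lfloor>2 ^ N * x\<rfloor> / 2 ^ N \<le> x"
      by (intro always_eventually allI) (simp add: divide_le_eq mult.commute)
    have "(\<lambda>N. x - (1/2::real)^N) \<longlonglongrightarrow> x - 0"
      by (intro tendsto_intros LIMSEQ_realpow_zero) auto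
    then show "(\<lambda>N. x - (1/2::real)^N) \<longlonglongrightarrow> x" by simp
  qed simp
  then have "(\<lambda>n. real (a n) / 2 ^ Suc n) sums x"
    unfolding sums_def part .
  moreover have "a n = 0 \<or> a n = 1" for n using a01[of n] unfolding a_def by auto
  ultimately show ?thesis by blast
qed

text \<open>Multiplication by 3^k shifts the ternary point. As all digits are 0 or 2, the integer
  part that appears is even and the period 2 removes it, together with the offset 2 N. What is left
  lies in [0, 1/3] or [2/3, 1] according to the digit \<open>b k\<close>.\<close>

lemma clipped_wave_ternary:
  fixes b :: "nat \<Rightarrow> nat"
  assumes b: "\<And>n. b n = 0 \<or> b n = 1"
  defines "r \<equiv> \<Sum>j. 2 * real (b j) / 3 ^ Suc j"
  shows "0 \<le> r" "r \<le> 1" "clipped_wave (3 ^ k * (2 * real N + r)) = real (b k)"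
proof -
  have geo: "(\<lambda>n. 2 * (1/3) ^ Suc n) sums (1::real)"
    using sums_mult[OF geometric_sums[of "1/3::real"], of "2/3"] by simp
  have tail: "summable (\<lambda>j. 2 * real (b (j + m)) / 3 ^ Suc j)"
    "0 \<le> (\<Sum>j. 2 * real (b (j + m)) / 3 ^ Suc j)" "(\<Sum>j. 2 * real (b (j + m)) / 3 ^ Suc j) \<le> 1" for m
  proof -
    have le: "2 * real (b (j + m)) / 3 ^ Suc j \<le> 2 * (1/3) ^ Suc j" for j
      using b[of "j + m"] by (auto simp: power_one_over)
    show s: "summable (\<lambda>j. 2 * real (b (j + m)) / 3 ^ Suc j)"
      by (rule summable_comparison_test'[OF sums_summable[OF geo]]) (use le in auto)
    show "0 \<le> (\<Sum>j. 2 * real (b (j + m)) / 3 ^ Suc j)"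
      by (rule suminf_nonneg[OF s]) simp
    show "(\<Sum>j. 2 * real (b (j + m)) / 3 ^ Suc j) \<le> 1"
      using suminf_le[OF le s sums_summable[OF geo]] sums_unique[OF geo] by simp
  qed
  show "0 \<le> r" "r \<le> 1" using tail[of 0] unfolding r_def by simp_all
  define q where "q = (\<Sum>j. 2 * real (b (j + k)) / 3 ^ Suc j)"
  define B where "B = 3 ^ k * N + (\<Sum>j<k. b j * 3 ^ (k - Suc j))"
  have "r = (\<Sum>j. 2 * real (b (j + k)) / 3 ^ Suc (j + k)) + (\<Sum>j<k. 2 * real (b j) / 3 ^ Suc j)"
    unfolding r_def using tail(1)[of 0] by (intro suminf_split_initial_segment) simp
  also have "(\<Sum>j. 2 * real (b (j + k)) / 3 ^ Suc (j + k)) = q / 3 ^ k"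
    unfolding q_def
    by (subst suminf_divide[OF tail(1), symmetric]) (simp add: power_add mult.assoc)
  finally have "3 ^ k * r = q + 2 * (\<Sum>j<k. 3 ^ k * (real (b j) / 3 ^ Suc j))"
    by (simp add: distrib_left sum_distrib_left mult.assoc mult.left_commute)
  also have "(\<Sum>j<k. 3 ^ k * (real (b j) / 3 ^ Suc j)) = (\<Sum>j<k. real (b j * 3 ^ (k - Suc j)))"
    by (intro sum.cong refl) (simp add: power_diff[of "3::real"] del: power_Suc)
  finally have "3 ^ k * (2 * real N + r) = 2 * real B + q"
    unfolding B_def by (simp add: distrib_left mult.left_commute)
  then have 1: "clipped_wave (3 ^ k * (2 * real N + r)) = clipped_wave q"
    unfolding clipped_wave_def by (simp add: triangle_wave_periodic)
  have "q = (\<Sum>j. 2 * real (b (Suc j + k)) / 3 ^ Suc (Suc j)) + 2 * real (b k) / 3"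
    unfolding q_def using suminf_split_head[OF tail(1)[of k]] by simp
  also have "(\<Sum>j. 2 * real (b (Suc j + k)) / 3 ^ Suc (Suc j))
      = (\<Sum>j. 2 * real (b (j + Suc k)) / 3 ^ Suc j) / 3"
    by (subst suminf_divide[OF tail(1), symmetric]) (simp add: mult.assoc)
  finally have q: "q = (\<Sum>j. 2 * real (b (j + Suc k)) / 3 ^ Suc j) / 3 + 2 * real (b k) / 3" .
  have "triangle_wave q = q"
    by (rule triangle_wave_id) (use tail(2,3)[of k] in \<open>auto simp: q_def\<close>)
  then show "clipped_wave (3 ^ k * (2 * real N + r)) = real (b k)"
    using q tail(2,3)[of "Suc k"] b[of k] unfolding 1 unfolding clipped_wave_def
    by (auto simp del: power_Suc add_Suc_right)
qed

text \<open>Interleaving the binary digits of the d coordinates gives the ternary digits of the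
  parameter. A parameter exists in every interval [2 N, 2 N + 1], so each N has its own copy of the
  curve, to be scaled independently.\<close>

lemma schoenberg_surj:
  assumes x: "\<And>i. i < d \<Longrightarrow> 0 \<le> x i \<and> x i \<le> (1::real)"
  shows "\<exists>t\<in>{2 * real N .. 2 * real N + 1}. \<forall>i<d. schoenberg d i t = x i"
proof -
  have "\<exists>a::nat \<Rightarrow> nat. (\<forall>n. a n = 0 \<or> a n = 1) \<and> (i < d \<longrightarrow> (\<lambda>n. real (a n) / 2 ^ Suc n) sums x i)" for i
    using binary_expansion[of "x i"] x[of i] by (cases "i < d") auto
  then obtain a :: "nat \<Rightarrow> nat \<Rightarrow> nat" where a: "\<And>i n. a i n = 0 \<or> a i n = 1"
    "\<And>i. i < d \<Longrightarrow> (\<lambda>n. real (a i n) / 2 ^ Suc n) sums x i" by metis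
  define b where "b k = a (k mod d) (k div d)" for k
  define r where "r = (\<Sum>j. 2 * real (b j) / 3 ^ Suc j)"
  have b01: "b k = 0 \<or> b k = 1" for k unfolding b_def using a(1) by blast
  note t = clipped_wave_ternary[of b, folded r_def, OF b01]
  have "schoenberg d i (2 * real N + r) = x i" if "i < d" for i
  proof -
    have "b (d * n + i) = a i n" for n
      unfolding b_def using that by simp
    then show ?thesis
      unfolding schoenberg_def t(3) using sums_unique[OF a(2)[OF that]] by simp
  qed
  then show ?thesis using t(1,2) by (intro bexI[of _ "2 * real N + r"]) auto
qed


theorem peano_curve_with_section:
  "\<exists>(h :: real \<Rightarrow> 'a::euclidean_space) s. continuous_on UNIV h \<and> s \<in> borel_measurable borel \<and>
     (\<forall>z. h (s z) = z) \<and> (\<forall>r. \<exists>T. \<forall>z. norm z \<le> r \<longrightarrow> 0 \<le> s z \<and> s z \<le> T)"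
proof -
  define d where "d = DIM('a)"
  obtain e :: "'a \<Rightarrow> nat" where e: "bij_betw e Basis {0..<d}"
    using ex_bij_betw_finite_nat[OF finite_Basis] unfolding d_def by auto
  have ed: "e b < d" if "b \<in> Basis" for b using bij_betwE[OF e] that by auto
  \<comment> \<open>The amplitude is the constant N on [2 N, 2 N + 1] and rises continuously to N +
    1 on the next unit interval. The N-th copy of the unit cube is thereby stretched to the cube of
    half-side N around the origin, and the curve covers the whole space.\<close>
  define \<rho> where "\<rho> t = (t - triangle_wave t) / 2" for t
  define h :: "real \<Rightarrow> 'a" where
    "h t = (\<Sum>b\<in>Basis. (\<rho> t * (2 * schoenberg d (e b) t - 1)) *\<^sub>R b)" for t
  have h: "continuous_on UNIV h"
    unfolding h_def \<rho>_def
    by (intro continuous_intros continuous_on_schoenberg continuous_on_triangle_wave) auto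
  have surj: "\<exists>t\<in>{0..2 * real N + 1}. h t = z" if z: "norm z \<le> real N" for z N
  proof -
    define x where "x i = (z \<bullet> inv_into Basis e i / real N + 1) / 2" for i
    have zb: "\<bar>z \<bullet> b\<bar> \<le> real N" if "b \<in> Basis" for b
      using Basis_le_norm[OF that, of z] z by simp
    have "0 \<le> x i \<and> x i \<le> 1" if "i < d" for i
    proof (cases "N = 0")
      case False
      have "inv_into Basis e i \<in> Basis"
        using that e by (metis atLeastLessThan_iff bij_betw_def inv_into_into zero_le)
      from zb[OF this] show ?thesis
        using False unfolding x_def by (auto simp: field_simps abs_le_iff)
    qed (simp add: x_def)
    then obtain t where t: "t \<in> {2 * real N .. 2 * real N + 1}" "\<forall>i<d. schoenberg d i t = x i"
      using schoenberg_surj[of d x N] by blast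
    have "triangle_wave t = t - 2 * real N"
      using triangle_wave_periodic[of N "t - 2 * real N"] triangle_wave_id[of "t - 2 * real N"] t(1) by simp
    then have \<rho>: "\<rho> t = real N" unfolding \<rho>_def by simp
    have "h t = (\<Sum>b\<in>Basis. (z \<bullet> b) *\<^sub>R b)"
      unfolding h_def
    proof (intro sum.cong refl arg_cong2[where f = scaleR])
      fix b :: 'a assume b: "b \<in> Basis"
      have "inv_into Basis e (e b) = b" using e b by (simp add: bij_betw_def)
      then have "schoenberg d (e b) t = (z \<bullet> b / real N + 1) / 2"
        using t(2) ed[OF b] unfolding x_def by simp
      then show "\<rho> t * (2 * schoenberg d (e b) t - 1) = z \<bullet> b"
        using zb[OF b] unfolding \<rho> by (cases "N = 0") (simp_all add: field_simps)
    qed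
    then have "h t = z" by (simp add: euclidean_representation)
    with t(1) show ?thesis by auto
  qed
  text \<open>The least preimage is Borel: its sublevel sets are images of compact intervals.\<close>
  define s where "s z = Inf {t. 0 \<le> t \<and> h t = z}" for z
  have cl: "closed {t. 0 \<le> t \<and> h t = z}" for z
    by (intro closed_Collect_conj closed_Collect_le closed_Collect_eq continuous_intros h)
  have ne: "{t. 0 \<le> t \<and> h t = z} \<noteq> {}" for z
  proof -
    obtain N where "norm z \<le> real N" using real_arch_simple by blast
    from surj[OF this] show ?thesis by auto
  qed
  have bdd: "bdd_below {t. 0 \<le> t \<and> h t = z}" for z by (rule bdd_belowI[of _ 0]) auto
  have s: "0 \<le> s z \<and> h (s z) = z" for z
    using closed_contains_Inf[OF ne bdd cl] unfolding s_def by blast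
  have s_le: "s z \<le> t" if "0 \<le> t" "h t = z" for z t
    unfolding s_def using that by (intro cInf_lower[OF _ bdd]) auto
  have "s \<in> borel_measurable borel"
    unfolding borel_measurable_iff_le
  proof
    fix a
    have "{w \<in> space borel. s w \<le> a} = h ` {0..a}"
    proof (intro equalityI subsetI)
      fix w assume "w \<in> {w \<in> space borel. s w \<le> a}"
      then show "w \<in> h ` {0..a}" using s[of w] by (intro image_eqI[of _ _ "s w"]) auto
    next
      fix w assume "w \<in> h ` {0..a}"
      then show "w \<in> {w \<in> space borel. s w \<le> a}" using s_le by fastforce
    qed
    moreover have "compact (h ` {0..a})"
      by (intro compact_continuous_image continuous_on_subset[OF h]) auto
    ultimately show "{w \<in> space borel. s w \<le> a} \<in> sets borel"
      by (simp add: borel_compact)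
  qed
  \<comment> \<open>Local boundedness of the section is what transports tightness to the
    line.\<close>
  moreover have "\<exists>T. \<forall>z. norm z \<le> r \<longrightarrow> 0 \<le> s z \<and> s z \<le> T" for r
  proof -
    obtain N where "r \<le> real N" using real_arch_simple by blast
    then have "s z \<le> 2 * real N + 1" if "norm z \<le> r" for z
      using surj[of z N] that s_le by fastforce
    then show ?thesis using s by blast
  qed
  ultimately show ?thesis using h s by (intro exI[of _ h] exI[of _ s]) blast
qed

section \<open>Weak convergence, tightness and measure-determining test functions\<close>

definition weakly_converges :: "(nat \<Rightarrow> 'a::topological_space measure) \<Rightarrow> 'a measure \<Rightarrow> bool" where
  "weakly_converges \<mu> M \<longleftrightarrow> (\<forall>(F :: 'a \<Rightarrow> real) B. continuous_on UNIV F \<and> (\<forall>z. \<bar>F z\<bar> \<le> B) \<longrightarrow>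
     (\<lambda>n. \<integral>z. F z \<partial>\<mu> n) \<longlonglongrightarrow> (\<integral>z. F z \<partial>M))"

lemma weakly_convergesD:
  fixes F :: "'a::topological_space \<Rightarrow> real"
  assumes "weakly_converges \<mu> M" "continuous_on UNIV F" "\<And>z. \<bar>F z\<bar> \<le> B"
  shows "(\<lambda>n. \<integral>z. F z \<partial>\<mu> n) \<longlonglongrightarrow> (\<integral>z. F z \<partial>M)"
  using assms unfolding weakly_converges_def by blast

text \<open>Prokhorov's theorem: a Borel section of a space-filling curve codes the measures on the real
  line, where Helly's selection theorem applies.\<close>

theorem tight_imp_weakly_convergent_subsequence:
  fixes \<mu> :: "nat \<Rightarrow> 'a::euclidean_space measure"
  assumes prob: "\<And>n. prob_space (\<mu> n)" and sets: "\<And>n. sets (\<mu> n) = sets borel"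
    and tight: "\<And>\<epsilon>. \<epsilon> > 0 \<Longrightarrow> \<exists>r. \<forall>n. measure (\<mu> n) {z. norm z > r} < \<epsilon>"
  shows "\<exists>r M. strict_mono (r :: nat \<Rightarrow> nat) \<and> prob_space M \<and> sets M = sets borel \<and>
     weakly_converges (\<lambda>n. \<mu> (r n)) M"
proof -
  obtain h :: "real \<Rightarrow> 'a" and s where h: "continuous_on UNIV h" and s[measurable]: "s \<in> borel_measurable borel"
    and hs: "\<And>z. h (s z) = z" and bnd: "\<And>r. \<exists>T. \<forall>z. norm z \<le> r \<longrightarrow> 0 \<le> s z \<and> s z \<le> T"
    using peano_curve_with_section by metis
  have hm[measurable]: "h \<in> borel_measurable borel" by (rule borel_measurable_continuous_onI[OF h])
  note [measurable_cong] = sets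
  have sp: "space (\<mu> n) = UNIV" for n using sets_eq_imp_space_eq[OF sets] by simp
  interpret P: prob_space "\<mu> n" for n by (rule prob)
  define \<Lambda> where "\<Lambda> n = distr (\<mu> n) borel s" for n
  have rd: "real_distribution (\<Lambda> n)" for n
    unfolding \<Lambda>_def real_distribution_def real_distribution_axioms_def
    by (auto intro!: P.prob_space_distr)
  have "tight \<Lambda>"
    unfolding tight_def
  proof (intro conjI allI impI rd)
    fix \<epsilon> :: real assume "\<epsilon> > 0"
    then obtain r where r: "\<And>n. measure (\<mu> n) {z. norm z > r} < \<epsilon>" using tight by blast
    obtain T where T: "\<And>z. norm z \<le> r \<Longrightarrow> 0 \<le> s z \<and> s z \<le> T" using bnd by blast
    show "\<exists>a b. a < b \<and> (\<forall>n. measure (\<Lambda> n) {a<..b} > 1 - \<epsilon>)"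
    \<comment> \<open>Codes of the ball of radius r lie in [0, T]. The left end -1 keeps the code 0
      inside the half-open interval, and \<open>max 0 T\<close> keeps the interval nonempty even if
      the ball is empty.\<close>
    proof (rule exI[of _ "-1"], rule exI[of _ "max 0 T"], intro conjI allI)
      fix n
      have m: "{z. norm z > r} \<in> sets (\<mu> n)" by measurable
      have "1 - \<epsilon> < 1 - measure (\<mu> n) {z. norm z > r}" using r[of n] by simp
      also have "\<dots> = measure (\<mu> n) (space (\<mu> n) - {z. norm z > r})" by (rule P.prob_compl[OF m, symmetric])
      also have "\<dots> \<le> measure (\<mu> n) (s -` {-1<..max 0 T} \<inter> space (\<mu> n))"
      proof (rule P.finite_measure_mono)
        show "space (\<mu> n) - {z. norm z > r} \<subseteq> s -` {-1<..max 0 T} \<inter> space (\<mu> n)"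
        proof
          fix z assume "z \<in> space (\<mu> n) - {z. norm z > r}"
          then show "z \<in> s -` {-1<..max 0 T} \<inter> space (\<mu> n)" using T[of z] by (simp add: sp)
        qed
      qed measurable
      also have "\<dots> = measure (\<Lambda> n) {-1<..max 0 T}"
        unfolding \<Lambda>_def by (simp add: measure_distr)
      finally show "1 - \<epsilon> < measure (\<Lambda> n) {-1<..max 0 T}" .
    qed auto
  qed
  from tight_imp_convergent_subsubsequence[OF this strict_mono_id]
  obtain r M where r: "strict_mono (r :: nat \<Rightarrow> nat)" and M: "real_distribution M"
    and wc: "weak_conv_m (\<Lambda> \<circ> r) M" by (metis comp_id)
  interpret M: real_distribution M by (rule M)
  \<comment> \<open>The limit is carried back by the curve. As \<open>h (s z) = z\<close>, integrals
    of F become integrals of the bounded continuous function F o h against the laws of the codes, so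
    the discontinuities of s do no harm.\<close>
  let ?N = "distr M borel h"
  have "(\<lambda>n. \<integral>z. F z \<partial>\<mu> (r n)) \<longlonglongrightarrow> (\<integral>z. F z \<partial>?N)"
    if F: "continuous_on UNIV F" "\<And>z. \<bar>F z\<bar> \<le> B" for F :: "'a \<Rightarrow> real" and B
  proof -
    have [measurable]: "F \<in> borel_measurable borel" by (rule borel_measurable_continuous_onI[OF F(1)])
    have "continuous_on UNIV (\<lambda>t. F (h t))" by (rule continuous_on_compose2[OF F(1) h]) auto
    then have "(\<lambda>n. \<integral>t. F (h t) \<partial>(\<Lambda> \<circ> r) n) \<longlonglongrightarrow> (\<integral>t. F (h t) \<partial>M)"
      using F(2) by (intro weak_conv_imp_integral_bdd_continuous_conv[OF _ M wc, of _ B])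
        (auto simp: rd continuous_on_eq_continuous_at)
    moreover have "(\<integral>t. F (h t) \<partial>(\<Lambda> \<circ> r) n) = (\<integral>z. F z \<partial>\<mu> (r n))" for n
      unfolding \<Lambda>_def o_def by (subst integral_distr) (simp_all add: hs)
    moreover have "(\<integral>t. F (h t) \<partial>M) = (\<integral>z. F z \<partial>?N)"
      by (subst integral_distr) simp_all
    ultimately show ?thesis by simp
  qed
  moreover have "prob_space ?N" by (rule M.prob_space_distr) simp
  ultimately show ?thesis using r
    by (intro exI[of _ r] exI[of _ ?N]) (auto simp: weakly_converges_def)
qed

text \<open>Closed sets form a generator stable under intersection, and the indicator of a closed
  set is the pointwise limit of the functions \<open>max 0 (1 - n * infdist z C)\<close>.\<close>

lemma finite_borel_measure_eqI:
  fixes M N :: "'a::euclidean_space measure"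
  assumes M: "finite_measure M" "sets M = sets borel" and N: "finite_measure N" "sets N = sets borel"
    and eq: "\<And>F :: 'a \<Rightarrow> real. continuous_on UNIV F \<Longrightarrow> (\<And>z. 0 \<le> F z) \<Longrightarrow> (\<And>z. F z \<le> 1) \<Longrightarrow>
      (\<integral>z. F z \<partial>M) = (\<integral>z. F z \<partial>N)"
  shows "M = N"
proof -
  interpret M: finite_measure M by (rule M)
  interpret N: finite_measure N by (rule N)
  note [measurable_cong] = M(2) N(2)
  have sp: "space M = UNIV" "space N = UNIV" using sets_eq_imp_space_eq[OF M(2)] sets_eq_imp_space_eq[OF N(2)] by simp_all
  have closed_eq: "emeasure M C = emeasure N C" if C: "closed C" for C
  \<comment> \<open>The empty set is split off because \<open>infdist\<close> to it is 0 by
    convention.\<close>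
  proof (cases "C = {}")
    case False
    define F where "F n z = max 0 (1 - real n * infdist z C)" for n z
    have Fc: "continuous_on UNIV (F n)" for n unfolding F_def by (intro continuous_intros)
    have [measurable]: "F n \<in> borel_measurable borel" for n
      by (rule borel_measurable_continuous_onI[OF Fc])
    have F01: "0 \<le> F n z" "F n z \<le> 1" for n z unfolding F_def by (auto simp: infdist_nonneg)
    have [measurable]: "C \<in> sets borel" using C by simp
    have lim: "(\<lambda>n. F n z) \<longlonglongrightarrow> indicator C z" for z
    proof (cases "z \<in> C")
      case True
      then show ?thesis by (simp add: F_def)
    next
      case False
      then have "infdist z C > 0"
        using in_closed_iff_infdist_zero[OF C \<open>C \<noteq> {}\<close>] infdist_nonneg[of z C] by force
      then obtain m where "1 < real m * infdist z C" using reals_Archimedean3 by blast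
      then have "F n z = 0" if "n \<ge> m" for n
        using that mult_right_mono[of "real m" "real n" "infdist z C"] infdist_nonneg[of z C]
        unfolding F_def by auto
      then have "eventually (\<lambda>n. F n z = 0) sequentially" by (auto simp: eventually_at_top_linorder)
      then show ?thesis using False by (simp add: tendsto_eventually)
    qed
    have "(\<lambda>n. \<integral>z. F n z \<partial>M) \<longlonglongrightarrow> (\<integral>z. indicator C z \<partial>M)"
      by (rule integral_dominated_convergence[where w = "\<lambda>_. 1"]) (use F01 lim in auto)
    moreover have "(\<lambda>n. \<integral>z. F n z \<partial>N) \<longlonglongrightarrow> (\<integral>z. indicator C z \<partial>N)"
      by (rule integral_dominated_convergence[where w = "\<lambda>_. 1"]) (use F01 lim in auto)
    moreover have "(\<integral>z. F n z \<partial>M) = (\<integral>z. F n z \<partial>N)" for n by (rule eq[OF Fc F01])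
    ultimately have "measure M C = measure N C"
      using LIMSEQ_unique by (simp add: sp) blast
    then show ?thesis by (simp add: M.emeasure_eq_measure N.emeasure_eq_measure)
  qed simp
  show ?thesis
  proof (rule measure_eqI_generator_eq[where E = "Collect closed" and \<Omega> = UNIV and A = "\<lambda>_. UNIV"])
    show "Int_stable (Collect closed)" by (auto simp: Int_stable_def)
    show "sets M = sigma_sets UNIV (Collect closed)" "sets N = sigma_sets UNIV (Collect closed)"
      unfolding M(2) N(2) borel_eq_closed by (simp_all add: sets_measure_of)
  qed (auto simp: closed_eq)
qed

section \<open>Martingale couplings\<close>

lemma c_sym: "c x y = c y x"
  by (simp add: c_def algebra_simps)

lemma c_self [simp]: "c x x = 0"
  by (simp add: c_def)

lemma continuous_on_c [continuous_intros]:
  "continuous_on S f \<Longrightarrow> continuous_on S g \<Longrightarrow> continuous_on S (\<lambda>z. c (f z) (g z))"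
  unfolding c_def by (intro continuous_intros)

lemma borel_measurable_c [measurable]:
  assumes [measurable]: "f \<in> borel_measurable M" "g \<in> borel_measurable M"
  shows "(\<lambda>z. c (f z) (g z)) \<in> borel_measurable M"
proof -
  have "(\<lambda>(x, y). c x y) \<in> borel_measurable borel"
    by (intro borel_measurable_continuous_onI) (simp add: split_beta continuous_intros)
  then have "(\<lambda>(x, y). c x y) \<in> borel_measurable (borel \<Otimes>\<^sub>M borel)" by (simp add: borel_prod)
  then show ?thesis using assms by measurable
qed

definition pu :: "pt \<Rightarrow> real" where "pu x = fst x + snd x"
definition pv :: "pt \<Rightarrow> real" where "pv x = fst x - snd x"

lemma c_eq_squares: "c x y = ((pu x - pu y)\<^sup>2 - (pv x - pv y)\<^sup>2) / 4"
  by (simp add: c_def pu_def pv_def power2_eq_square field_simps)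

lemma continuous_on_pu [continuous_intros]: "continuous_on S f \<Longrightarrow> continuous_on S (\<lambda>z. pu (f z))"
  and continuous_on_pv [continuous_intros]: "continuous_on S f \<Longrightarrow> continuous_on S (\<lambda>z. pv (f z))"
  unfolding pu_def pv_def by (intro continuous_intros; assumption)+

lemma borel_measurable_pu [measurable]: "pu \<in> borel_measurable borel"
  and borel_measurable_pv [measurable]: "pv \<in> borel_measurable borel"
  by (intro borel_measurable_continuous_onI continuous_intros)+

lemma abs_fst_le_norm: "\<bar>fst (x :: pt)\<bar> \<le> norm x"
  and abs_snd_le_norm: "\<bar>snd (x :: pt)\<bar> \<le> norm x"
  using norm_fst_le[of "fst x" "snd x"] norm_snd_le[of "snd x" "fst x"] by (simp_all)

lemma norm_fst_le': "norm (fst z) \<le> norm z" and norm_snd_le': "norm (snd z) \<le> norm z"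
  using norm_fst_le[of "fst z" "snd z"] norm_snd_le[of "snd z" "fst z"] by simp_all

lemma P2_prob: "M \<in> P2 \<Longrightarrow> prob_space M" and P2_sets: "M \<in> P2 \<Longrightarrow> sets M = sets borel"
  and P2_space: "M \<in> P2 \<Longrightarrow> space M = UNIV"
  and P2_integrable_norm: "M \<in> P2 \<Longrightarrow> integrable M (\<lambda>z. (norm z)\<^sup>2)"
  by (auto simp: P2_def dest: sets_eq_imp_space_eq)

lemma P2_integrable:
  fixes f :: "'a::euclidean_space \<Rightarrow> real"
  assumes M: "M \<in> P2" and [measurable]: "f \<in> borel_measurable borel"
    and f: "\<And>z. \<bar>f z\<bar> \<le> C * (1 + (norm z)\<^sup>2)"
  shows "integrable M f"
proof -
  interpret prob_space M by (rule P2_prob[OF M])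
  note [measurable_cong] = P2_sets[OF M]
  have "integrable M (\<lambda>z. C * (1 + (norm z)\<^sup>2))"
    using P2_integrable_norm[OF M] by simp
  then show ?thesis
    by (rule Bochner_Integration.integrable_bound) (use f in \<open>auto intro!: AE_I2 order_trans[OF f abs_ge_self]\<close>)
qed

lemma P2_integrable_mult:
  fixes f g :: "'a::euclidean_space \<Rightarrow> real"
  assumes M: "M \<in> P2" and [measurable]: "f \<in> borel_measurable borel" "g \<in> borel_measurable borel"
    and f: "\<And>z. \<bar>f z\<bar> \<le> C * (1 + norm z)" and g: "\<And>z. \<bar>g z\<bar> \<le> D * (1 + norm z)"
  shows "integrable M (\<lambda>z. f z * g z)"
proof (rule P2_integrable[OF M])
  fix z :: 'a
  have C: "0 \<le> C * (1 + norm z)" "0 \<le> D * (1 + norm z)" using f[of z] g[of z] by linarith+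
  then have "0 \<le> C" "0 \<le> D" by (metis add_pos_nonneg mult_le_cancel_right2 norm_ge_zero zero_le_mult_iff zero_less_one not_less)+
  have "\<bar>f z * g z\<bar> \<le> (C * (1 + norm z)) * (D * (1 + norm z))"
    unfolding abs_mult using f g C by (intro mult_mono) auto
  also have "\<dots> = C * D * (1 + norm z)\<^sup>2" by (simp add: power2_eq_square)
  also have "\<dots> \<le> C * D * (2 * (1 + (norm z)\<^sup>2))"
    using \<open>0 \<le> C\<close> \<open>0 \<le> D\<close> sum_squares_ge_zero[of "1 - norm z" 0]
    by (intro mult_left_mono) (simp_all add: power2_eq_square algebra_simps)
  finally show "\<bar>f z * g z\<bar> \<le> (2 * C * D) * (1 + (norm z)\<^sup>2)" by (simp add: mult_ac)
qed measurable

lemma P2_integrable_linear: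
  fixes f :: "'a::euclidean_space \<Rightarrow> real"
  assumes M: "M \<in> P2" and [measurable]: "f \<in> borel_measurable borel"
    and f: "\<And>z. \<bar>f z\<bar> \<le> C * (1 + norm z)"
  shows "integrable M f"
  using P2_integrable_mult[OF M, of "\<lambda>_. 1" f 1 C] f by simp

lemma measurable_proj [measurable]:
  "(\<lambda>z::pt \<times> pt. fst z) \<in> borel_measurable borel" "(\<lambda>z::pt \<times> pt. snd z) \<in> borel_measurable borel"
  "(fst :: pt \<Rightarrow> real) \<in> borel_measurable borel" "(snd :: pt \<Rightarrow> real) \<in> borel_measurable borel"
  by (intro borel_measurable_continuous_onI continuous_intros)+

lemma fst_subalgebra:
  fixes \<gamma> :: "(pt \<times> pt) measure"
  assumes \<gamma>: "prob_space \<gamma>" "sets \<gamma> = sets borel"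
  defines "F \<equiv> vimage_algebra (space \<gamma>) fst (borel :: pt measure)"
  shows "finite_measure_subalgebra \<gamma> F" "space F = UNIV" "sets F = {fst -` A | A. A \<in> sets borel}"
    "h \<in> borel_measurable borel \<Longrightarrow> (\<lambda>z. h (fst z)) \<in> borel_measurable F"
proof -
  interpret prob_space \<gamma> by (rule \<gamma>)
  have sp: "space \<gamma> = UNIV" using sets_eq_imp_space_eq[OF \<gamma>(2)] by simp
  have fstm: "fst \<in> measurable \<gamma> (borel :: pt measure)"
    using measurable_proj(1) by (simp add: measurable_cong_sets[OF \<gamma>(2) refl])
  show F: "sets F = {fst -` A | A. A \<in> sets borel}"
    unfolding F_def by (subst sets_vimage_algebra2) (auto simp: sp)
  show "space F = UNIV" unfolding F_def by (simp add: sp)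
  have "subalgebra \<gamma> F"
    unfolding subalgebra_def F
    using measurable_sets[OF fstm] by (auto simp: F_def sp)
  then show "finite_measure_subalgebra \<gamma> F"
    by (simp add: finite_measure_axioms finite_measure_subalgebra.intro finite_measure_subalgebra_axioms_def)
  have "fst \<in> measurable F (borel :: pt measure)"
    unfolding F_def by (rule measurable_vimage_algebra1) simp
  then show "(\<lambda>z. h (fst z)) \<in> borel_measurable F" if "h \<in> borel_measurable borel"
    using measurable_compose that by blast
qed

text \<open>The conditional expectation becomes a family of integral identities: the increment is
  orthogonal to all indicators of x. This form can be checked for constructed measures and survives
  weak limits.\<close>

lemma real_cond_exp_fst_iff:
  fixes \<gamma> :: "(pt \<times> pt) measure" and f :: "pt \<Rightarrow> real"
  assumes \<gamma>: "prob_space \<gamma>" "sets \<gamma> = sets borel"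
    and int: "integrable \<gamma> (\<lambda>z. f (snd z))" "integrable \<gamma> (\<lambda>z. f (fst z))"
    and [measurable]: "f \<in> borel_measurable borel"
  shows "(AE z in \<gamma>. real_cond_exp \<gamma> (vimage_algebra (space \<gamma>) fst borel) (\<lambda>z. f (snd z)) z = f (fst z))
    \<longleftrightarrow> (\<forall>A\<in>sets borel. (\<integral>z. indicator A (fst z) * (f (snd z) - f (fst z)) \<partial>\<gamma>) = 0)"
proof -
  interpret prob_space \<gamma> by (rule \<gamma>)
  note [measurable_cong] = \<gamma>(2)
  have sp: "space \<gamma> = UNIV" using sets_eq_imp_space_eq[OF \<gamma>(2)] by simp
  define F where "F = vimage_algebra (space \<gamma>) fst (borel :: pt measure)"
  have fstm: "fst \<in> measurable \<gamma> (borel :: pt measure)"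
    by (subst measurable_cong_sets[OF \<gamma>(2) refl]) (rule borel_measurable_continuous_onI, intro continuous_intros)
  have F: "sets F = {fst -` A | A. A \<in> sets borel}" unfolding F_def by (rule fst_subalgebra(3)[OF \<gamma>])
  interpret finite_measure_subalgebra \<gamma> F unfolding F_def by (rule fst_subalgebra(1)[OF \<gamma>])
  have meas: "(\<lambda>z. f (fst z)) \<in> borel_measurable F"
    unfolding F_def by (rule fst_subalgebra(4)[OF \<gamma>]) measurable
  have indI: "indicator (fst -` A) z = (indicator A (fst z) :: real)" for A :: "pt set" and z :: "pt \<times> pt"
    by (simp add: indicator_def)
  have intA: "integrable \<gamma> (\<lambda>z. indicator A (fst z) * g z)" if "A \<in> sets borel" "integrable \<gamma> g"
    for A and g :: "pt \<times> pt \<Rightarrow> real"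
  proof -
    have "fst -` A \<in> sets \<gamma>" using measurable_sets[OF fstm that(1)] by (simp add: sp)
    from integrable_mult_indicator[OF this that(2)] show ?thesis by (simp add: indI)
  qed
  have diff: "(\<integral>z. indicator A (fst z) * (f (snd z) - f (fst z)) \<partial>\<gamma>)
      = (\<integral>z\<in>fst -` A. f (snd z) \<partial>\<gamma>) - (\<integral>z\<in>fst -` A. f (fst z) \<partial>\<gamma>)" if "A \<in> sets borel" for A
    unfolding set_lebesgue_integral_def
    using intA[OF that int(1)] intA[OF that int(2)]
    by (simp add: indI right_diff_distrib)
  show ?thesis unfolding F_def[symmetric]
  proof
    assume ae: "AE z in \<gamma>. real_cond_exp \<gamma> F (\<lambda>z. f (snd z)) z = f (fst z)"
    show "\<forall>A\<in>sets borel. (\<integral>z. indicator A (fst z) * (f (snd z) - f (fst z)) \<partial>\<gamma>) = 0"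
    proof
      fix A :: "pt set" assume A: "A \<in> sets borel"
      have "fst -` A \<in> sets F" using A F by auto
      from real_cond_exp_intA[OF int(1) this]
      have "(\<integral>z\<in>fst -` A. f (snd z) \<partial>\<gamma>) = (\<integral>z\<in>fst -` A. real_cond_exp \<gamma> F (\<lambda>z. f (snd z)) z \<partial>\<gamma>)" .
      also have "\<dots> = (\<integral>z\<in>fst -` A. f (fst z) \<partial>\<gamma>)"
        unfolding set_lebesgue_integral_def
      proof (rule integral_cong_AE)
        have [measurable]: "fst -` A \<in> sets \<gamma>" using measurable_sets[OF fstm A] by (simp add: sp)
        show "(\<lambda>x. indicat_real (fst -` A) x *\<^sub>R real_cond_exp \<gamma> F (\<lambda>z. f (snd z)) x) \<in> borel_measurable \<gamma>"
          by measurable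
        show "(\<lambda>x. indicat_real (fst -` A) x *\<^sub>R f (fst x)) \<in> borel_measurable \<gamma>"
          using int(2) by measurable
      qed (use ae in auto)
      finally show "(\<integral>z. indicator A (fst z) * (f (snd z) - f (fst z)) \<partial>\<gamma>) = 0" using diff[OF A] by simp
    qed
  next
    assume z: "\<forall>A\<in>sets borel. (\<integral>z. indicator A (fst z) * (f (snd z) - f (fst z)) \<partial>\<gamma>) = 0"
    show "AE z in \<gamma>. real_cond_exp \<gamma> F (\<lambda>z. f (snd z)) z = f (fst z)"
      by (rule real_cond_exp_charact[OF _ int meas]) (use z diff in \<open>force simp: F\<close>)
  qed
qed

lemma P2_integrable_coord:
  assumes \<gamma>: "\<gamma> \<in> (P2 :: (pt \<times> pt) measure set)"
  shows "integrable \<gamma> (\<lambda>z. fst (fst z))" "integrable \<gamma> (\<lambda>z. snd (fst z))"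
    "integrable \<gamma> (\<lambda>z. fst (snd z))" "integrable \<gamma> (\<lambda>z. snd (snd z))"
  by (rule P2_integrable_linear[OF \<gamma>, of _ 1]; simp;
      (smt (verit) abs_fst_le_norm abs_snd_le_norm norm_fst_le' norm_snd_le' norm_ge_zero))+

lemma Gamma_iff:
  "\<gamma> \<in> Gamma \<nu> \<longleftrightarrow> \<gamma> \<in> P2 \<and> distr \<gamma> borel snd = \<nu> \<and>
    (\<forall>A\<in>sets borel. (\<integral>z. indicator A (fst z) * (fst (snd z) - fst (fst z)) \<partial>\<gamma>) = 0) \<and>
    (\<forall>A\<in>sets borel. (\<integral>z. indicator A (fst z) * (snd (snd z) - snd (fst z)) \<partial>\<gamma>) = 0)"
proof (cases "\<gamma> \<in> P2")
  case True
  note iff = real_cond_exp_fst_iff[OF P2_prob[OF True] P2_sets[OF True]]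
  show ?thesis
    using iff[of fst] iff[of snd] P2_integrable_coord[OF True] True
    by (simp add: Gamma_def)
qed (simp add: Gamma_def)

lemma GammaD:
  assumes "\<gamma> \<in> Gamma \<nu>"
  shows "\<gamma> \<in> P2" "distr \<gamma> borel snd = \<nu>"
  using assms by (auto simp: Gamma_iff)

text \<open>The passage from indicators to test functions h of linear growth is made by pulling h(x)
  out of the conditional expectation. Linear growth is what the squared displacement argument needs,
  since \<open>x\<close> itself and \<open>pv x - f (pu x)\<close> occur as test functions.\<close>

lemma martingale_orthogonal1:
  fixes \<gamma> :: "(pt \<times> pt) measure" and f h :: "pt \<Rightarrow> real"
  assumes \<gamma>: "\<gamma> \<in> P2"
    and [measurable]: "f \<in> borel_measurable borel" "h \<in> borel_measurable borel"
    and f: "\<And>x. \<bar>f x\<bar> \<le> C * (1 + norm x)" and h: "\<And>x. \<bar>h x\<bar> \<le> D * (1 + norm x)"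
    and z: "\<And>A. A \<in> sets borel \<Longrightarrow> (\<integral>z. indicator A (fst z) * (f (snd z) - f (fst z)) \<partial>\<gamma>) = 0"
  shows "(\<integral>z. h (fst z) * (f (snd z) - f (fst z)) \<partial>\<gamma>) = 0"
proof -
  interpret prob_space \<gamma> by (rule P2_prob[OF \<gamma>])
  note [measurable_cong] = P2_sets[OF \<gamma>]
  have pos: "0 \<le> C" "0 \<le> D" using f[of 0] h[of 0] by auto
  have f': "\<bar>f (snd z)\<bar> \<le> C * (1 + norm z)" "\<bar>f (fst z)\<bar> \<le> C * (1 + norm z)"
    and h': "\<bar>h (fst z)\<bar> \<le> D * (1 + norm z)" for z :: "pt \<times> pt"
    using f[of "snd z"] f[of "fst z"] h[of "fst z"] pos norm_fst_le'[of z] norm_snd_le'[of z]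
    by (meson add_left_mono mult_left_mono order_trans)+
  define F where "F = vimage_algebra (space \<gamma>) fst (borel :: pt measure)"
  interpret finite_measure_subalgebra \<gamma> F unfolding F_def by (rule fst_subalgebra(1)[OF P2_prob[OF \<gamma>] P2_sets[OF \<gamma>]])
  have hm: "(\<lambda>z. h (fst z)) \<in> borel_measurable F"
    unfolding F_def by (rule fst_subalgebra(4)[OF P2_prob[OF \<gamma>] P2_sets[OF \<gamma>]]) measurable
  have int: "integrable \<gamma> (\<lambda>z. h (fst z) * f (snd z))" "integrable \<gamma> (\<lambda>z. h (fst z) * f (fst z))"
    using P2_integrable_mult[OF \<gamma> _ _ h' f'(1)] P2_integrable_mult[OF \<gamma> _ _ h' f'(2)] by simp_all
  have if': "integrable \<gamma> (\<lambda>z. f (snd z))" "integrable \<gamma> (\<lambda>z. f (fst z))"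
    using P2_integrable_linear[OF \<gamma> _ f'(1)] P2_integrable_linear[OF \<gamma> _ f'(2)] by simp_all
  have ae: "AE z in \<gamma>. real_cond_exp \<gamma> F (\<lambda>z. f (snd z)) z = f (fst z)"
    using real_cond_exp_fst_iff[OF P2_prob[OF \<gamma>] P2_sets[OF \<gamma>] if'] z unfolding F_def by auto
  have "(\<integral>z. h (fst z) * f (snd z) \<partial>\<gamma>) = (\<integral>z. h (fst z) * real_cond_exp \<gamma> F (\<lambda>z. f (snd z)) z \<partial>\<gamma>)"
    by (rule real_cond_exp_intg(2)[OF int(1) hm, symmetric]) measurable
  also have "\<dots> = (\<integral>z. h (fst z) * f (fst z) \<partial>\<gamma>)"
    by (intro integral_cong_AE) (use ae in auto)
  finally show ?thesis using int by (simp add: right_diff_distrib)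
qed

lemma martingale_orthogonal:
  assumes \<gamma>: "\<gamma> \<in> Gamma \<nu>" and [measurable]: "h \<in> borel_measurable borel"
    and h: "\<And>x. \<bar>h x\<bar> \<le> D * (1 + norm x)"
  shows "(\<integral>z. h (fst z) * (fst (snd z) - fst (fst z)) \<partial>\<gamma>) = 0"
    "(\<integral>z. h (fst z) * (snd (snd z) - snd (fst z)) \<partial>\<gamma>) = 0"
    "(\<integral>z. h (fst z) * (pv (snd z) - pv (fst z)) \<partial>\<gamma>) = 0"
    "(\<integral>z. h (fst z) * (pu (snd z) - pu (fst z)) \<partial>\<gamma>) = 0"
    "integrable \<gamma> (\<lambda>z. h (fst z) * (fst (snd z) - fst (fst z)))"
    "integrable \<gamma> (\<lambda>z. h (fst z) * (snd (snd z) - snd (fst z)))"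
    "integrable \<gamma> (\<lambda>z. h (fst z) * (pv (snd z) - pv (fst z)))"
    "integrable \<gamma> (\<lambda>z. h (fst z) * (pu (snd z) - pu (fst z)))"
proof -
  have P2: "\<gamma> \<in> P2" by (rule GammaD[OF \<gamma>])
  have D: "0 \<le> D" using h[of 0] by simp
  have h': "\<bar>h (fst z)\<bar> \<le> D * (1 + norm z)" for z :: "pt \<times> pt"
    using h[of "fst z"] D norm_fst_le'[of z] by (meson add_left_mono mult_left_mono order_trans)
  show 1: "(\<integral>z. h (fst z) * (fst (snd z) - fst (fst z)) \<partial>\<gamma>) = 0"
  proof (rule martingale_orthogonal1[OF P2 _ _ _ h])
    show "\<bar>fst x\<bar> \<le> 1 * (1 + norm x)" for x :: pt using abs_fst_le_norm[of x] by simp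
  qed (use \<gamma> in \<open>auto simp: Gamma_iff\<close>)
  show 2: "(\<integral>z. h (fst z) * (snd (snd z) - snd (fst z)) \<partial>\<gamma>) = 0"
  proof (rule martingale_orthogonal1[OF P2 _ _ _ h])
    show "\<bar>snd x\<bar> \<le> 1 * (1 + norm x)" for x :: pt using abs_snd_le_norm[of x] by simp
  qed (use \<gamma> in \<open>auto simp: Gamma_iff\<close>)
  have b: "\<bar>fst (snd z) - fst (fst z)\<bar> \<le> 2 * (1 + norm z)" "\<bar>snd (snd z) - snd (fst z)\<bar> \<le> 2 * (1 + norm z)"
    for z :: "pt \<times> pt"
    by (smt (verit) abs_fst_le_norm abs_snd_le_norm norm_fst_le' norm_snd_le' norm_ge_zero)+
  show i1: "integrable \<gamma> (\<lambda>z. h (fst z) * (fst (snd z) - fst (fst z)))"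
    by (rule P2_integrable_mult[OF P2 _ _ h' b(1)]) measurable
  show i2: "integrable \<gamma> (\<lambda>z. h (fst z) * (snd (snd z) - snd (fst z)))"
    by (rule P2_integrable_mult[OF P2 _ _ h' b(2)]) measurable
  have eqs: "(\<lambda>z. h (fst z) * (pv (snd z) - pv (fst z))) =
     (\<lambda>z. h (fst z) * (fst (snd z) - fst (fst z)) - h (fst z) * (snd (snd z) - snd (fst z)))"
    "(\<lambda>z. h (fst z) * (pu (snd z) - pu (fst z))) =
     (\<lambda>z. h (fst z) * (fst (snd z) - fst (fst z)) + h (fst z) * (snd (snd z) - snd (fst z)))"
    by (auto simp: pu_def pv_def algebra_simps)
  show "(\<integral>z. h (fst z) * (pv (snd z) - pv (fst z)) \<partial>\<gamma>) = 0"
    "(\<integral>z. h (fst z) * (pu (snd z) - pu (fst z)) \<partial>\<gamma>) = 0"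
    unfolding eqs using i1 i2 1 2 by simp_all
  show "integrable \<gamma> (\<lambda>z. h (fst z) * (pv (snd z) - pv (fst z)))"
    "integrable \<gamma> (\<lambda>z. h (fst z) * (pu (snd z) - pu (fst z)))"
    unfolding eqs using i1 i2 by simp_all
qed

lemma P2_integrable_c:
  assumes \<gamma>: "\<gamma> \<in> P2" shows "integrable \<gamma> (\<lambda>z. c (fst z) (snd z))"
  unfolding c_def
  by (rule P2_integrable_mult[OF \<gamma>, of _ _ 2 2]; simp;
      (smt (verit) abs_fst_le_norm abs_snd_le_norm norm_fst_le' norm_snd_le' norm_ge_zero))

section \<open>Maximal monotone sets and weak duality\<close>

lemma MaxMonoD: "G \<in> MaxMono \<Longrightarrow> monotone_set G"
  by (simp add: MaxMono_def)

lemma MaxMono_memI: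
  assumes G: "G \<in> MaxMono" and x: "\<And>g. g \<in> G \<Longrightarrow> 0 \<le> c g x"
  shows "x \<in> G"
proof -
  have "monotone_set (insert x G)"
    using MaxMonoD[OF G] x unfolding monotone_set_def by (auto simp: c_sym[of x])
  then have "insert x G = G" using G unfolding MaxMono_def by blast
  then show ?thesis by blast
qed

lemma monotone_set_iff_lipschitz:
  "monotone_set G \<longleftrightarrow> (\<forall>r\<in>G. \<forall>s\<in>G. \<bar>pv r - pv s\<bar> \<le> \<bar>pu r - pu s\<bar>)"
  unfolding monotone_set_def c_eq_squares by (simp add: abs_le_square_iff)

definition pt_of_uv :: "real \<Rightarrow> real \<Rightarrow> pt" where
  "pt_of_uv u v = ((u + v) / 2, (u - v) / 2)"

lemma pu_pt_of_uv [simp]: "pu (pt_of_uv u v) = u" and pv_pt_of_uv [simp]: "pv (pt_of_uv u v) = v"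
  by (simp_all add: pt_of_uv_def pu_def pv_def field_simps)

lemma pt_eqI_uv: "pu x = pu y \<Longrightarrow> pv x = pv y \<Longrightarrow> x = y"
  by (simp add: pu_def pv_def prod_eq_iff)

lemma MaxMono_graph:
  assumes G: "G \<in> MaxMono"
  obtains f :: "real \<Rightarrow> real" where "\<And>s t. \<bar>f s - f t\<bar> \<le> \<bar>s - t\<bar>" "\<And>x. x \<in> G \<longleftrightarrow> pv x = f (pu x)"
proof -
  have mono: "\<bar>pv r - pv s\<bar> \<le> \<bar>pu r - pu s\<bar>" if "r \<in> G" "s \<in> G" for r s
    using MaxMonoD[OF G] that by (simp add: monotone_set_iff_lipschitz)
  have ne: "G \<noteq> {}" using MaxMono_memI[OF G, of 0] by auto
  have ex: "\<exists>x\<in>G. pu x = u" for u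
  proof -
    obtain g0 where g0: "g0 \<in> G" using ne by blast
    \<comment> \<open>This is McShane's formula for extending a 1-Lipschitz function. The new point
      is compatible with all of G, so maximality puts it into G.\<close>
    define v where "v = (INF g\<in>G. pv g + \<bar>u - pu g\<bar>)"
    have bdd: "bdd_below ((\<lambda>g. pv g + \<bar>u - pu g\<bar>) ` G)"
      by (rule bdd_belowI2[of _ "pv g0 - \<bar>u - pu g0\<bar>"]) (use mono g0 in \<open>smt (verit)\<close>)
    have up: "v \<le> pv g + \<bar>u - pu g\<bar>" if "g \<in> G" for g
      unfolding v_def by (rule cINF_lower[OF bdd that])
    have lo: "pv g - \<bar>u - pu g\<bar> \<le> v" if "g \<in> G" for g
      unfolding v_def using ne by (rule cINF_greatest) (use mono that in \<open>smt (verit)\<close>)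
    have "pt_of_uv u v \<in> G"
    proof (rule MaxMono_memI[OF G])
      fix g assume "g \<in> G"
      then have "\<bar>pv g - v\<bar> \<le> \<bar>pu g - u\<bar>" using up[of g] lo[of g] by linarith
      then show "0 \<le> c g (pt_of_uv u v)" unfolding c_eq_squares by (simp add: abs_le_square_iff)
    qed
    then show ?thesis by (rule bexI[rotated]) simp
  qed
  then obtain \<sigma> where \<sigma>: "\<And>u. \<sigma> u \<in> G" "\<And>u. pu (\<sigma> u) = u" by metis
  show ?thesis
  proof
    show "\<bar>pv (\<sigma> s) - pv (\<sigma> t)\<bar> \<le> \<bar>s - t\<bar>" for s t using mono[OF \<sigma>(1) \<sigma>(1), of s t] \<sigma>(2) by simp
    show "x \<in> G \<longleftrightarrow> pv x = pv (\<sigma> (pu x))" for x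
      using mono[OF _ \<sigma>(1), of x "pu x"] \<sigma>(2) \<sigma>(1)[of "pu x"] pt_eqI_uv[of x "\<sigma> (pu x)"] by auto
  qed
qed

text \<open>The graph has a point over every u, and a monotone set contains at most one point over
  each u.\<close>

lemma graph_MaxMono:
  fixes f :: "real \<Rightarrow> real"
  assumes f: "\<And>s t. \<bar>f s - f t\<bar> \<le> \<bar>s - t\<bar>"
  shows "{x. pv x = f (pu x)} \<in> MaxMono"
  unfolding MaxMono_def
proof (intro CollectI conjI allI impI)
  show "monotone_set {x. pv x = f (pu x)}" using f by (simp add: monotone_set_iff_lipschitz)
  fix H assume H: "monotone_set H \<and> {x. pv x = f (pu x)} \<subseteq> H"
  have "pv x = f (pu x)" if "x \<in> H" for x
  proof -
    have "pt_of_uv (pu x) (f (pu x)) \<in> H" using H by auto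
    then have "\<bar>pv x - f (pu x)\<bar> \<le> \<bar>pu x - pu x\<bar>"
      using H that unfolding monotone_set_iff_lipschitz by fastforce
    then show ?thesis by simp
  qed
  then show "H = {x. pv x = f (pu x)}" using H by blast
qed

lemma closed_MaxMono:
  assumes G: "G \<in> MaxMono" shows "closed G"
proof -
  have "G = (\<Inter>g\<in>G. {x. 0 \<le> c g x})"
    using MaxMono_memI[OF G] MaxMonoD[OF G] unfolding monotone_set_def by blast
  moreover have "closed {x. 0 \<le> c g x}" for g
    by (intro closed_Collect_le continuous_intros)
  ultimately show ?thesis by (metis closed_INT)
qed

lemma phi_le: "g \<in> G \<Longrightarrow> phi G y \<le> ereal (c g y)"
  unfolding phi_def by (rule INF_lower)

text \<open>The competitor is the point of G with the same \<open>pu\<close> as y, whose cost is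
  minus a square.\<close>

lemma phi_nonpos:
  assumes G: "G \<in> MaxMono" shows "phi G y \<le> 0"
proof -
  obtain f where f: "\<And>x. x \<in> G \<longleftrightarrow> pv x = f (pu x)" using MaxMono_graph[OF G] by metis
  have "phi G y \<le> ereal (c (pt_of_uv (pu y) (f (pu y))) y)" by (rule phi_le) (simp add: f)
  also have "\<dots> \<le> 0" by (simp add: c_eq_squares)
  finally show ?thesis .
qed

text \<open>This is how equality of potentials on the support of \<nu> becomes equality of the sets
  there. If \<open>phi G y = 0\<close>, then y is in monotone relation to all of G and belongs to it
  by maximality.\<close>

lemma phi_eq_0_iff:
  assumes G: "G \<in> MaxMono" shows "phi G y = 0 \<longleftrightarrow> y \<in> G"
proof
  assume "phi G y = 0"
  then show "y \<in> G" using phi_le[of _ G y] by (intro MaxMono_memI[OF G]) auto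
next
  assume "y \<in> G"
  then have "0 \<le> phi G y"
    using MaxMonoD[OF G] unfolding phi_def monotone_set_def by (intro INF_greatest) auto
  then show "phi G y = 0" using phi_nonpos[OF G, of y] by simp
qed

text \<open>The infimum runs over an uncountable set, but each sublevel set
  \<open>phi G y < a\<close> is a union of open sets.\<close>

lemma borel_measurable_phi [measurable]: "phi G \<in> borel_measurable borel"
proof (rule borel_measurableI_less)
  fix a
  have "{y. phi G y < a} = (\<Union>g\<in>G. {y. ereal (c g y) < a})"
    unfolding phi_def by (auto simp: INF_less_iff)
  moreover have "open {y. ereal (c g y) < a}" for g
    by (cases a) (auto intro!: open_Collect_less continuous_intros)
  ultimately show "{y \<in> space borel. phi G y < a} \<in> sets borel"
    by (simp only: space_borel UNIV_I simp_thms) (intro borel_open open_UN; blast)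
qed

section \<open>Weak duality and its equality case, under a single measure\<close>

lemma dual_Gamma:
  assumes \<gamma>: "\<gamma> \<in> Gamma \<nu>" and G: "G \<in> MaxMono"
  shows "dual \<nu> G = - enn2ereal (\<integral>\<^sup>+ z. e2ennreal (- phi G (snd z)) \<partial>\<gamma>)"
proof -
  note [measurable_cong] = P2_sets[OF GammaD(1)[OF \<gamma>]]
  have "e2ennreal (phi G y) = 0" for y using phi_nonpos[OF G] by (rule e2ennreal_neg)
  then have "dual \<nu> G = - enn2ereal (\<integral>\<^sup>+ y. e2ennreal (- phi G y) \<partial>\<nu>)"
    unfolding dual_def ereal_integral_def by (simp add: zero_ennreal.rep_eq)
  also have "(\<integral>\<^sup>+ y. e2ennreal (- phi G y) \<partial>\<nu>) = (\<integral>\<^sup>+ z. e2ennreal (- phi G (snd z)) \<partial>\<gamma>)"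
    unfolding GammaD(2)[OF \<gamma>, symmetric] by (subst nn_integral_distr) auto
  finally show ?thesis .
qed

text \<open>Here \<open>a\<close> is minus the cost between \<open>y\<close> and the point of \<open>G\<close> that has the same \<open>pu\<close>-coordinate
  as \<open>x\<close>, and \<open>D\<close> measures the distance of \<open>x\<close> from \<open>G\<close>.\<close>

lemma dual_slack:
  assumes \<gamma>: "\<gamma> \<in> Gamma \<nu>" and G: "G \<in> MaxMono"
  obtains a D :: "pt \<times> pt \<Rightarrow> real" where "integrable \<gamma> a" "integrable \<gamma> D" "\<And>z. 0 \<le> D z"
    "(\<integral>z. a z \<partial>\<gamma>) = (\<integral>z. D z \<partial>\<gamma>) - primal \<gamma>" "\<And>z. ereal (a z) \<le> - phi G (snd z)"
    "\<And>z. D z = 0 \<Longrightarrow> fst z \<in> G \<and> a z = - c (fst z) (snd z)"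
proof -
  have P2: "\<gamma> \<in> P2" by (rule GammaD[OF \<gamma>])
  obtain f where lip: "\<And>s t. \<bar>f s - f t\<bar> \<le> \<bar>s - t\<bar>" and f: "\<And>x. x \<in> G \<longleftrightarrow> pv x = f (pu x)"
    using MaxMono_graph[OF G] by metis
  have "continuous_on UNIV f"
    by (intro lipschitz_on_continuous_on[of 1] lipschitz_onI) (use lip in \<open>auto simp: dist_real_def\<close>)
  then have [measurable]: "f \<in> borel_measurable borel" by (rule borel_measurable_continuous_onI)
  define h where "h x = pv x - f (pu x)" for x
  define D where "D z = (h (fst z))\<^sup>2 / 4" for z :: "pt \<times> pt"
  define a where "a z = - c (pt_of_uv (pu (fst z)) (f (pu (fst z)))) (snd z)" for z :: "pt \<times> pt"
  have [measurable]: "h \<in> borel_measurable borel" unfolding h_def by measurable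
  have h: "\<bar>h x\<bar> \<le> (4 + \<bar>f 0\<bar>) * (1 + norm x)" for x
  proof -
    have "\<bar>h x\<bar> \<le> \<bar>pv x\<bar> + \<bar>f 0\<bar> + \<bar>pu x\<bar>" using lip[of "pu x" 0] unfolding h_def by linarith
    also have "\<dots> \<le> 4 * norm x + \<bar>f 0\<bar> * 1"
      using abs_fst_le_norm[of x] abs_snd_le_norm[of x] unfolding pu_def pv_def by linarith
    also have "\<dots> \<le> (4 + \<bar>f 0\<bar>) * (1 + norm x)"
      by (simp add: algebra_simps)
    finally show ?thesis .
  qed
  have h': "\<bar>h (fst z)\<bar> \<le> (4 + \<bar>f 0\<bar>) * (1 + norm z)" for z :: "pt \<times> pt"
    by (rule order_trans[OF h]) (use norm_fst_le'[of z] in \<open>auto intro!: mult_left_mono\<close>)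
  have iD: "integrable \<gamma> D"
    unfolding D_def power2_eq_square
    by (intro integrable_divide P2_integrable_mult[OF P2 _ _ h' h']) measurable
  \<comment> \<open>Expanding the square of \<open>f (pu x) - pv y\<close> about \<open>pv x\<close>
    leaves a cross term that is a function of x times the increment of \<open>pv\<close>; it
    integrates to zero.\<close>
  have a: "a z = D z - c (fst z) (snd z) + h (fst z) * (pv (snd z) - pv (fst z)) / 2" for z
    unfolding a_def D_def c_eq_squares h_def
    by (simp add: power2_eq_square field_simps)
  note orth = martingale_orthogonal(3,7)[OF \<gamma> _ h]
  have ia: "integrable \<gamma> a" unfolding a
    using iD P2_integrable_c[OF P2] orth(2) by simp
  show ?thesis
  proof (rule that[OF ia iD])
    show "(\<integral>z. a z \<partial>\<gamma>) = (\<integral>z. D z \<partial>\<gamma>) - primal \<gamma>"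
      unfolding a primal_def using iD P2_integrable_c[OF P2] orth by simp
    show "ereal (a z) \<le> - phi G (snd z)" for z
    proof -
      have "phi G (snd z) \<le> ereal (- a z)" unfolding a_def by (simp, rule phi_le) (simp add: f)
      then show ?thesis by (metis ereal_minus_le_minus uminus_ereal.simps(1) minus_minus)
    qed
    show "fst z \<in> G \<and> a z = - c (fst z) (snd z)" if "D z = 0" for z
    proof -
      have h0: "h (fst z) = 0" using that unfolding D_def by simp
      then have "fst z \<in> G" unfolding f h_def by simp
      then show ?thesis using a[of z] that h0 by simp
    qed
  qed (simp add: D_def)
qed

lemma weak_duality:
  assumes \<gamma>: "\<gamma> \<in> Gamma \<nu>" and G: "G \<in> MaxMono"
  shows "dual \<nu> G \<le> ereal (primal \<gamma>)"
proof -
  note [measurable_cong] = P2_sets[OF GammaD(1)[OF \<gamma>]]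
  obtain a D :: "pt \<times> pt \<Rightarrow> real" where ia: "integrable \<gamma> a" and iD: "integrable \<gamma> D" and D: "\<And>z. 0 \<le> D z"
    and aD: "(\<integral>z. a z \<partial>\<gamma>) = (\<integral>z. D z \<partial>\<gamma>) - primal \<gamma>" and le: "\<And>z. ereal (a z) \<le> - phi G (snd z)"
    using dual_slack[OF \<gamma> G] by metis
  let ?N = "\<integral>\<^sup>+ z. e2ennreal (- phi G (snd z)) \<partial>\<gamma>"
  have "- primal \<gamma> \<le> (\<integral>z. a z \<partial>\<gamma>)" using aD D by simp
  \<comment> \<open>The function a may change sign and \<open>- phi G\<close> may fail to be
    integrable. Since \<open>- phi G\<close> is nonnegative, it also dominates
    \<open>max 0 a\<close>, and the comparison takes place among nonnegative integrals.\<close>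
  also have "\<dots> \<le> (\<integral>z. max 0 (a z) \<partial>\<gamma>)" by (intro integral_mono ia integrable_max) auto
  finally have "ereal (- primal \<gamma>) \<le> ereal (\<integral>z. max 0 (a z) \<partial>\<gamma>)" by simp
  also have "\<dots> = enn2ereal (ennreal (\<integral>z. max 0 (a z) \<partial>\<gamma>))"
    by (subst enn2ereal_ennreal) auto
  also have "ennreal (\<integral>z. max 0 (a z) \<partial>\<gamma>) = (\<integral>\<^sup>+ z. ennreal (max 0 (a z)) \<partial>\<gamma>)"
    by (rule nn_integral_eq_integral[symmetric]) (use ia in auto)
  also have "\<dots> \<le> ?N"
  proof (rule nn_integral_mono)
    fix z
    have "ennreal (max 0 (a z)) = e2ennreal (ereal (max 0 (a z)))" by (rule e2ennreal_ereal[symmetric])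
    also have "\<dots> \<le> e2ennreal (- phi G (snd z))"
      using le[of z] phi_nonpos[OF G, of "snd z"]
      by (intro e2ennreal_mono, cases "phi G (snd z)") (auto simp: max_def)
    finally show "ennreal (max 0 (a z)) \<le> e2ennreal (- phi G (snd z))" .
  qed
  finally have "ereal (- primal \<gamma>) \<le> enn2ereal ?N" by (simp add: less_eq_ennreal.rep_eq)
  then show ?thesis unfolding dual_Gamma[OF \<gamma> G]
    by (metis ereal_minus_le_minus uminus_ereal.simps(1) minus_minus)
qed

lemma dual_eq_primalI:
  assumes \<gamma>: "\<gamma> \<in> Gamma \<nu>" and G: "G \<in> MaxMono"
    and ae: "AE z in \<gamma>. ereal (c (fst z) (snd z)) = phi G (snd z)"
  shows "dual \<nu> G = ereal (primal \<gamma>)"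
proof -
  note P2 = GammaD(1)[OF \<gamma>]
  note [measurable_cong] = P2_sets[OF P2]
  have ae': "AE z in \<gamma>. 0 \<le> - c (fst z) (snd z)"
    using ae
  proof eventually_elim
    case (elim z)
    then show ?case using phi_nonpos[OF G, of "snd z"] by (simp flip: elim)
  qed
  have "(\<integral>\<^sup>+ z. e2ennreal (- phi G (snd z)) \<partial>\<gamma>) = (\<integral>\<^sup>+ z. ennreal (- c (fst z) (snd z)) \<partial>\<gamma>)"
    by (intro nn_integral_cong_AE) (use ae in \<open>auto simp flip: e2ennreal_ereal uminus_ereal.simps(1)\<close>)
  also have "\<dots> = ennreal (\<integral>z. - c (fst z) (snd z) \<partial>\<gamma>)"
    by (intro nn_integral_eq_integral ae') (use P2_integrable_c[OF P2] in simp)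
  finally have "dual \<nu> G = - enn2ereal (ennreal (- primal \<gamma>))"
    unfolding dual_Gamma[OF \<gamma> G] primal_def by simp
  moreover have "0 \<le> (\<integral>z. - c (fst z) (snd z) \<partial>\<gamma>)" by (rule integral_nonneg_AE[OF ae'])
  ultimately show ?thesis by (simp add: primal_def)
qed

text \<open>With \<psi> the real version of \<open>- phi G\<close>, the slack \<psi> - a is
  nonnegative and its integral equals minus the integral of the nonnegative D. Hence both vanish
  almost everywhere: D = 0 places x in G and gives a = - c, and \<psi> = a is the contact
  relation.\<close>

lemma dual_eq_primalD:
  assumes \<gamma>: "\<gamma> \<in> Gamma \<nu>" and G: "G \<in> MaxMono" and eq: "dual \<nu> G = ereal (primal \<gamma>)"
  shows "AE z in \<gamma>. fst z \<in> G \<and> ereal (c (fst z) (snd z)) = phi G (snd z)"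
proof -
  note [measurable_cong] = P2_sets[OF GammaD(1)[OF \<gamma>]]
  obtain a D :: "pt \<times> pt \<Rightarrow> real" where ia: "integrable \<gamma> a" and iD: "integrable \<gamma> D" and D: "\<And>z. 0 \<le> D z"
    and aD: "(\<integral>z. a z \<partial>\<gamma>) = (\<integral>z. D z \<partial>\<gamma>) - primal \<gamma>" and le: "\<And>z. ereal (a z) \<le> - phi G (snd z)"
    and D0: "\<And>z. D z = 0 \<Longrightarrow> fst z \<in> G \<and> a z = - c (fst z) (snd z)"
    using dual_slack[OF \<gamma> G] by metis
  let ?N = "\<integral>\<^sup>+ z. e2ennreal (- phi G (snd z)) \<partial>\<gamma>"
  have N: "enn2ereal ?N = ereal (- primal \<gamma>)"
    using eq unfolding dual_Gamma[OF \<gamma> G]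
    by (metis ereal_uminus_uminus uminus_ereal.simps(1))
  then have p: "0 \<le> - primal \<gamma>" using enn2ereal_nonneg[of ?N] by simp
  have N': "?N = ennreal (- primal \<gamma>)"
    using N p by (metis enn2ereal_ennreal enn2ereal_inject)
  \<comment> \<open>The dual value equals a real number, so \<open>phi G\<close> is finite almost
    everywhere and can be replaced by a real function.\<close>
  have "AE z in \<gamma>. e2ennreal (- phi G (snd z)) \<noteq> \<infinity>"
    by (rule nn_integral_PInf_AE) (auto simp: N')
  then have fin: "AE z in \<gamma>. ereal (real_of_ereal (- phi G (snd z))) = - phi G (snd z)"
  proof eventually_elim
    case (elim z)
    then show ?case using phi_nonpos[OF G, of "snd z"] le[of z]
      by (cases "phi G (snd z)") auto
  qed
  define \<psi> where "\<psi> z = real_of_ereal (- phi G (snd z))" for z :: "pt \<times> pt"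
  have \<psi>0: "0 \<le> \<psi> z" for z unfolding \<psi>_def using phi_nonpos[OF G, of "snd z"]
    by (cases "phi G (snd z)") auto
  have [measurable]: "\<psi> \<in> borel_measurable \<gamma>" unfolding \<psi>_def by measurable
  have "(\<integral>\<^sup>+ z. ennreal (\<psi> z) \<partial>\<gamma>) = ?N"
    by (intro nn_integral_cong_AE) (use fin in \<open>auto simp: \<psi>_def simp flip: e2ennreal_ereal\<close>)
  then have n\<psi>: "(\<integral>\<^sup>+ z. ennreal (\<psi> z) \<partial>\<gamma>) = ennreal (- primal \<gamma>)" using N' by simp
  have i\<psi>: "integrable \<gamma> \<psi>" by (rule integrableI_nonneg) (use \<psi>0 n\<psi> in auto)
  have e\<psi>: "(\<integral>z. \<psi> z \<partial>\<gamma>) = - primal \<gamma>"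
    using integral_eq_nn_integral[of \<psi> \<gamma>] \<psi>0 n\<psi> p by simp
  have ge: "AE z in \<gamma>. 0 \<le> \<psi> z - a z" using fin
  proof eventually_elim
    case (elim z)
    then show ?case using le[of z] unfolding \<psi>_def by (metis diff_ge_0_iff_ge ereal_less_eq(3))
  qed
  have "(\<integral>z. \<psi> z - a z \<partial>\<gamma>) = - (\<integral>z. D z \<partial>\<gamma>)" using i\<psi> ia e\<psi> aD by simp
  moreover have "0 \<le> (\<integral>z. \<psi> z - a z \<partial>\<gamma>)" by (rule integral_nonneg_AE[OF ge])
  moreover have "0 \<le> (\<integral>z. D z \<partial>\<gamma>)" by (rule integral_nonneg_AE) (simp add: D)
  ultimately have 0: "(\<integral>z. \<psi> z - a z \<partial>\<gamma>) = 0" "(\<integral>z. D z \<partial>\<gamma>) = 0" by auto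
  have "AE z in \<gamma>. \<psi> z - a z = 0"
    using integral_nonneg_eq_0_iff_AE[of \<gamma> "\<lambda>z. \<psi> z - a z"] 0 ge i\<psi> ia by simp
  moreover have "AE z in \<gamma>. D z = 0"
    using integral_nonneg_eq_0_iff_AE[of \<gamma> D] 0 D iD by simp
  ultimately show ?thesis using fin
  proof eventually_elim
    case (elim z)
    have "ereal (- c (fst z) (snd z)) = - phi G (snd z)" using elim D0[of z] unfolding \<psi>_def by simp
    then show ?case using D0[of z] elim(2) by (metis ereal_uminus_eq_iff uminus_ereal.simps(1))
  qed
qed

section \<open>Supports, and closedness of the contact relation\<close>

lemma AE_msupp:
  fixes M :: "'a::second_countable_topology measure"
  assumes M: "sets M = sets borel"
  shows "AE z in M. z \<in> msupp M"
proof -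
  obtain \<B> :: "'a set set" where \<B>: "countable \<B>" "topological_basis \<B>"
    using ex_countable_basis by blast
  define \<N> where "\<N> = {U \<in> \<B>. emeasure M U = 0}"
  have "U \<in> null_sets M" if "U \<in> \<N>" for U
    using that \<B>(2) M by (auto simp: \<N>_def null_sets_def topological_basis_open)
  then have "(\<Union>U\<in>\<N>. U) \<in> null_sets M"
    using \<B>(1) by (intro null_sets_UN') (auto simp: \<N>_def)
  then have "AE z in M. z \<notin> (\<Union>U\<in>\<N>. U)" by (rule AE_not_in)
  then show ?thesis
  proof eventually_elim
    case (elim z)
    show ?case unfolding msupp_def
    proof (intro CollectI allI impI)
      fix U assume U: "open U \<and> z \<in> U"
      then obtain B where B: "B \<in> \<B>" "z \<in> B" "B \<subseteq> U"
        using topological_basisE[OF \<B>(2)] by metis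
      then have "emeasure M B \<noteq> 0" using elim unfolding \<N>_def by auto
      moreover have "emeasure M B \<le> emeasure M U"
        using B U M by (intro emeasure_mono) auto
      ultimately show "emeasure M U > 0" by (metis leD not_gr_zero)
    qed
  qed
qed

lemma msupp_subset_closed:
  assumes M: "sets M = sets borel" and S: "closed S" and ae: "AE z in M. z \<in> S"
  shows "msupp M \<subseteq> S"
proof
  fix z assume z: "z \<in> msupp M"
  show "z \<in> S"
  proof (rule ccontr)
    assume "z \<notin> S"
    then have "emeasure M (- S) > 0" using z S unfolding msupp_def by auto
    moreover have "emeasure M (- S) = 0"
      using ae S M sets_eq_imp_space_eq[OF M] by (subst (asm) AE_iff_measurable[of "- S"]) (auto)
    ultimately show False by simp
  qed
qed

text \<open>Equality with \<open>phi G\<close> is not visibly closed, as \<open>phi G\<close> is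
  only semicontinuous. Together with \<open>fst z \<in> G\<close> it amounts to
  \<open>c (fst z) (snd z) \<le> c g (snd z)\<close> for every g in G, an intersection of closed
  conditions, and therefore extends from almost all points to the support.\<close>

lemma msupp_contact:
  assumes \<gamma>: "sets \<gamma> = sets borel" and G: "G \<in> MaxMono"
    and ae: "AE z in \<gamma>. fst z \<in> G \<and> ereal (c (fst z) (snd z)) = phi G (snd z)"
    and z: "z \<in> msupp \<gamma>"
  shows "fst z \<in> G" "ereal (c (fst z) (snd z)) = phi G (snd z)"
proof -
  define S where "S = {z. fst z \<in> G} \<inter> (\<Inter>g\<in>G. {z. c (fst z) (snd z) \<le> c g (snd z)})"
  have "closed {z. c (fst z) (snd z) \<le> c g (snd z)}" for g
    by (intro closed_Collect_le continuous_intros)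
  moreover have "closed {z :: pt \<times> pt. fst z \<in> G}"
    using closed_vimage_fst[OF closed_MaxMono[OF G]] by (simp add: vimage_def)
  ultimately have "closed S" unfolding S_def by (intro closed_Int closed_INT) auto
  moreover have "AE z in \<gamma>. z \<in> S" using ae
  proof eventually_elim
    case (elim z)
    have "c (fst z) (snd z) \<le> c g (snd z)" if "g \<in> G" for g
      using phi_le[OF that, of "snd z"] elim by (metis ereal_less_eq(3))
    with elim show ?case unfolding S_def by auto
  qed
  ultimately have "msupp \<gamma> \<subseteq> S" by (rule msupp_subset_closed[OF \<gamma>])
  with z have "z \<in> S" by blast
  then show 1: "fst z \<in> G" unfolding S_def by simp
  have "ereal (c (fst z) (snd z)) \<le> phi G (snd z)"
    unfolding phi_def using \<open>z \<in> S\<close> by (intro INF_greatest) (simp add: S_def)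
  then show "ereal (c (fst z) (snd z)) = phi G (snd z)" using phi_le[OF 1, of "snd z"] by (rule antisym)
qed

lemma msupp_distr_fst_subset:
  assumes \<gamma>: "\<gamma> \<in> Gamma \<nu>" and G: "G \<in> MaxMono" and ae: "AE z in \<gamma>. fst z \<in> G"
  shows "msupp (distr \<gamma> borel fst) \<subseteq> G"
proof (rule msupp_subset_closed[OF _ closed_MaxMono[OF G]])
  note [measurable_cong] = P2_sets[OF GammaD(1)[OF \<gamma>]]
  have "G \<in> sets borel" using closed_MaxMono[OF G] by (rule borel_closed)
  then have 1: "{x \<in> space borel. x \<in> G} \<in> sets borel" by simp
  have 2: "fst \<in> measurable \<gamma> (borel :: pt measure)" by measurable
  show "AE x in distr \<gamma> borel fst. x \<in> G"
    unfolding AE_distr_iff[OF 2 1] by (rule ae)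
qed (rule sets_distr)

section \<open>Existence of a minimizer\<close>

lemma norm_pt_squared: "(norm (x :: pt))\<^sup>2 = (fst x)\<^sup>2 + (snd x)\<^sup>2"
  by (simp add: norm_prod_def)

lemma norm_pair_squared: "(norm z)\<^sup>2 = (norm (fst z))\<^sup>2 + (norm (snd z))\<^sup>2"
  by (simp add: norm_prod_def)

lemma abs_pu_le: "\<bar>pu x\<bar> \<le> 2 * norm x" and abs_pv_le: "\<bar>pv x\<bar> \<le> 2 * norm x"
  using abs_fst_le_norm[of x] abs_snd_le_norm[of x] unfolding pu_def pv_def by linarith+

lemma Gamma_integral_snd:
  fixes f :: "pt \<Rightarrow> real"
  assumes \<gamma>: "\<gamma> \<in> Gamma \<nu>" and [measurable]: "f \<in> borel_measurable borel"
  shows "(\<integral>z. f (snd z) \<partial>\<gamma>) = (\<integral>y. f y \<partial>\<nu>)"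
proof -
  note [measurable_cong] = P2_sets[OF GammaD(1)[OF \<gamma>]]
  show ?thesis unfolding GammaD(2)[OF \<gamma>, symmetric] by (subst integral_distr) auto
qed

text \<open>Here q is the inner product of x and y - x, which has mean zero. Expanding |y|^2 about x
  gives |x|^2 + 2 q \<le> |y|^2, a pointwise form of Jensen's inequality.\<close>

lemma Gamma_second_moment:
  assumes \<gamma>: "\<gamma> \<in> Gamma \<nu>"
  shows "(\<integral>z. (norm z)\<^sup>2 \<partial>\<gamma>) \<le> 2 * (\<integral>y. (norm y)\<^sup>2 \<partial>\<nu>)"
proof -
  note P2 = GammaD(1)[OF \<gamma>]
  define q where "q z = fst (fst z) * (fst (snd z) - fst (fst z)) + snd (fst z) * (snd (snd z) - snd (fst z))"
    for z :: "pt \<times> pt"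
  have f1: "\<bar>fst x\<bar> \<le> 1 * (1 + norm x)" and s1: "\<bar>snd x\<bar> \<le> 1 * (1 + norm x)" for x :: pt
    using abs_fst_le_norm[of x] abs_snd_le_norm[of x] by simp_all
  have o: "integrable \<gamma> q" "(\<integral>z. q z \<partial>\<gamma>) = 0"
    unfolding q_def using martingale_orthogonal(1,5)[OF \<gamma> _ f1] martingale_orthogonal(2,6)[OF \<gamma> _ s1] by simp_all
  have iy: "integrable \<gamma> (\<lambda>z. (norm (snd z))\<^sup>2)"
    by (rule P2_integrable[OF P2, of _ 1]) (auto intro!: add_increasing power_mono norm_snd_le')
  have "(\<integral>z. (norm z)\<^sup>2 \<partial>\<gamma>) \<le> (\<integral>z. 2 * (norm (snd z))\<^sup>2 - 2 * q z \<partial>\<gamma>)"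
  proof (rule integral_mono)
    show "(norm z)\<^sup>2 \<le> 2 * (norm (snd z))\<^sup>2 - 2 * q z" for z :: "pt \<times> pt"
      using zero_le_power2[of "fst (snd z) - fst (fst z)"] zero_le_power2[of "snd (snd z) - snd (fst z)"]
      unfolding norm_pair_squared[of z] norm_pt_squared q_def by (simp add: power2_eq_square algebra_simps)
    show "integrable \<gamma> (\<lambda>z. 2 * (norm (snd z))\<^sup>2 - 2 * q z)"
      by (intro Bochner_Integration.integrable_diff integrable_mult_right iy o(1))
  qed (rule P2_integrable_norm[OF P2])
  also have "\<dots> = 2 * (\<integral>z. (norm (snd z))\<^sup>2 \<partial>\<gamma>)" using iy o by simp
  finally show ?thesis using Gamma_integral_snd[OF \<gamma>, of "\<lambda>y. (norm y)\<^sup>2"] by simp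
qed

text \<open>On martingale couplings the cost is, up to a constant, the integral of a nonnegative function,
  which makes it lower semicontinuous.\<close>

lemma primal_eq_nonneg:
  assumes \<gamma>: "\<gamma> \<in> Gamma \<nu>"
  shows "integrable \<gamma> (\<lambda>z. ((pu (snd z) - pu (fst z))\<^sup>2 + (pv (fst z))\<^sup>2) / 4)"
    "primal \<gamma> = (\<integral>z. ((pu (snd z) - pu (fst z))\<^sup>2 + (pv (fst z))\<^sup>2) / 4 \<partial>\<gamma>) - (\<integral>y. (pv y)\<^sup>2 \<partial>\<nu>) / 4"
proof -
  note P2 = GammaD(1)[OF \<gamma>]
  have b: "\<bar>pu (snd z) - pu (fst z)\<bar> \<le> 4 * (1 + norm z)" "\<bar>pv (fst z)\<bar> \<le> 2 * (1 + norm z)"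
    "\<bar>pv (snd z)\<bar> \<le> 2 * (1 + norm z)" for z :: "pt \<times> pt"
    using abs_pu_le[of "fst z"] abs_pu_le[of "snd z"] abs_pv_le[of "fst z"] abs_pv_le[of "snd z"]
      norm_fst_le'[of z] norm_snd_le'[of z] by (simp_all add: abs_le_iff)
  let ?F = "\<lambda>z :: pt \<times> pt. ((pu (snd z) - pu (fst z))\<^sup>2 + (pv (fst z))\<^sup>2) / 4"
  have pv: "\<bar>pv x\<bar> \<le> 2 * (1 + norm x)" for x using abs_pv_le[of x] by simp
  show F: "integrable \<gamma> ?F"
    unfolding power2_eq_square
    by (intro integrable_divide Bochner_Integration.integrable_add P2_integrable_mult[OF P2 _ _ b(1) b(1)]
        P2_integrable_mult[OF P2 _ _ b(2) b(2)]) measurable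
  have v: "integrable \<gamma> (\<lambda>z. (pv (snd z))\<^sup>2)"
    unfolding power2_eq_square by (intro P2_integrable_mult[OF P2 _ _ b(3) b(3)]) measurable
  \<comment> \<open>The negative square is removed by the martingale identity E (v' - v)^2 = E v'^2
    - E v^2, where v and v' are the \<open>pv\<close>-coordinates of x and y; E v'^2 depends only on
    \<nu>.\<close>
  have c: "c (fst z) (snd z) = ?F z - (pv (snd z))\<^sup>2 / 4 + pv (fst z) * (pv (snd z) - pv (fst z)) / 2" for z
    unfolding c_eq_squares by (simp add: power2_eq_square field_simps)
  show "primal \<gamma> = (\<integral>z. ?F z \<partial>\<gamma>) - (\<integral>y. (pv y)\<^sup>2 \<partial>\<nu>) / 4"
    unfolding primal_def c
    using F v martingale_orthogonal(3,7)[OF \<gamma> _ pv] Gamma_integral_snd[OF \<gamma>, of "\<lambda>y. (pv y)\<^sup>2"] by simp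
qed

text \<open>For fixed N the truncation \<open>min F N\<close> is bounded and continuous, so its
  integrals converge. Fatou's lemma in N removes the truncation afterwards. The bound K may vary
  with n because it will be fed with a minimizing sequence of costs.\<close>

lemma integral_fatou_weak:
  fixes \<gamma> :: "nat \<Rightarrow> 'a::euclidean_space measure" and F :: "'a \<Rightarrow> real"
  assumes prob: "\<And>n. prob_space (\<gamma> n)" "\<And>n. sets (\<gamma> n) = sets borel" and M: "prob_space M" "sets M = sets borel"
    and wc: "weakly_converges \<gamma> M"
    and F: "continuous_on UNIV F" "\<And>z. 0 \<le> F z" and int: "\<And>n. integrable (\<gamma> n) F"
    and k: "\<And>n. (\<integral>z. F z \<partial>\<gamma> n) \<le> K n" "K \<longlonglongrightarrow> k"
  shows "integrable M F" "(\<integral>z. F z \<partial>M) \<le> k"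
proof -
  interpret M: prob_space M by (rule M)
  interpret P: prob_space "\<gamma> n" for n by (rule prob)
  note [measurable_cong] = M(2) prob(2)
  have [measurable]: "F \<in> borel_measurable borel" by (rule borel_measurable_continuous_onI[OF F(1)])
  have "0 \<le> K n" for n
    by (rule order_trans[OF _ k(1)], rule integral_nonneg_AE) (simp add: F(2))
  then have k0: "0 \<le> k" using LIMSEQ_le_const[OF k(2)] by blast
  have trunc: "(\<integral>z. min (F z) (real N) \<partial>M) \<le> k" for N
  proof (rule LIMSEQ_le[OF _ k(2)])
    show "(\<lambda>n. \<integral>z. min (F z) (real N) \<partial>\<gamma> n) \<longlonglongrightarrow> (\<integral>z. min (F z) (real N) \<partial>M)"
    proof (rule weakly_convergesD[OF wc])
      show "continuous_on UNIV (\<lambda>z. min (F z) (real N))" by (intro continuous_intros F(1))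
      show "\<bar>min (F z) (real N)\<bar> \<le> real N" for z using F(2)[of z] by simp
    qed
    have "(\<integral>z. min (F z) (real N) \<partial>\<gamma> n) \<le> K n" for n
    proof -
      have "(\<integral>z. min (F z) (real N) \<partial>\<gamma> n) \<le> (\<integral>z. F z \<partial>\<gamma> n)"
        by (intro integral_mono int integrable_min) auto
      with k(1)[of n] show ?thesis by simp
    qed
    then show "\<exists>N'. \<forall>n\<ge>N'. (\<integral>z. min (F z) (real N) \<partial>\<gamma> n) \<le> K n" by blast
  qed
  have "(\<integral>\<^sup>+z. ennreal (F z) \<partial>M) = (\<integral>\<^sup>+z. liminf (\<lambda>N. ennreal (min (F z) (real N))) \<partial>M)"
  proof (rule nn_integral_cong)
    fix z
    obtain N0 where N0: "F z \<le> real N0" using real_arch_simple by blast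
    have "eventually (\<lambda>N. ennreal (min (F z) (real N)) = ennreal (F z)) sequentially"
      using eventually_ge_at_top[of N0]
    proof eventually_elim
      case (elim N)
      then have "F z \<le> real N" using N0 by (meson of_nat_le_iff order_trans)
      then show ?case by (simp add: min_def)
    qed
    then have "(\<lambda>N. ennreal (min (F z) (real N))) \<longlonglongrightarrow> ennreal (F z)" by (rule tendsto_eventually)
    then show "ennreal (F z) = liminf (\<lambda>N. ennreal (min (F z) (real N)))"
      by (simp add: lim_imp_Liminf)
  qed
  also have "\<dots> \<le> liminf (\<lambda>N. \<integral>\<^sup>+z. ennreal (min (F z) (real N)) \<partial>M)"
    by (rule nn_integral_liminf) measurable
  also have "\<dots> \<le> liminf (\<lambda>N. ennreal k)"
  proof (intro Liminf_mono always_eventually allI)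
    fix N
    have "integrable M (\<lambda>z. min (F z) (real N))"
      by (rule M.integrable_const_bound[of _ "real N"]) (use F(2) in \<open>auto simp: min_def\<close>)
    then have "(\<integral>\<^sup>+z. ennreal (min (F z) (real N)) \<partial>M) = ennreal (\<integral>z. min (F z) (real N) \<partial>M)"
      by (rule nn_integral_eq_integral) (use F(2) in auto)
    also have "\<dots> \<le> ennreal k" using trunc by (rule ennreal_leI)
    finally show "(\<integral>\<^sup>+z. ennreal (min (F z) (real N)) \<partial>M) \<le> ennreal k" .
  qed
  finally have le: "(\<integral>\<^sup>+z. ennreal (F z) \<partial>M) \<le> ennreal k" by (simp add: Liminf_const)
  show "integrable M F"
    by (rule integrableI_nonneg) (use F(2) le in \<open>auto intro: le_less_trans\<close>)
  have "(\<integral>z. F z \<partial>M) = enn2real (\<integral>\<^sup>+z. ennreal (F z) \<partial>M)"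
    by (rule integral_eq_nn_integral) (use F(2) in auto)
  also have "\<dots> \<le> k" using le k0 by (simp add: enn2real_leI)
  finally show "(\<integral>z. F z \<partial>M) \<le> k" .
qed

text \<open>The weight D has no sign. The measures with densities given by its positive and negative
  parts, pushed forward by X, are finite and agree on continuous test functions, hence on all Borel
  sets.\<close>

lemma integral_indicator_mult_eq_0I:
  fixes X :: "'b \<Rightarrow> 'a::euclidean_space" and D :: "'b \<Rightarrow> real"
  assumes X[measurable]: "X \<in> borel_measurable M" and D: "integrable M D"
    and z: "\<And>F :: 'a \<Rightarrow> real. continuous_on UNIV F \<Longrightarrow> (\<And>x. 0 \<le> F x) \<Longrightarrow> (\<And>x. F x \<le> 1) \<Longrightarrow> (\<integral>z. F (X z) * D z \<partial>M) = 0"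
    and A[measurable]: "A \<in> sets borel"
  shows "(\<integral>z. indicator A (X z) * D z \<partial>M) = 0"
proof -
  have [measurable]: "D \<in> borel_measurable M" using D by simp
  define Dp where "Dp z = max 0 (D z)" for z
  define Dm where "Dm z = max 0 (- D z)" for z
  have [measurable]: "Dp \<in> borel_measurable M" "Dm \<in> borel_measurable M" unfolding Dp_def Dm_def by measurable
  have pm: "integrable M Dp" "integrable M Dm" "\<And>z. 0 \<le> Dp z" "\<And>z. 0 \<le> Dm z" "\<And>z. D z = Dp z - Dm z"
    unfolding Dp_def Dm_def using D by auto
  define N where "N E = distr (density M (\<lambda>z. ennreal (E z))) borel X" for E
  have I: "finite_measure (N E) \<and> (\<forall>F :: 'a \<Rightarrow> real. F \<in> borel_measurable borel \<longrightarrow> (\<forall>x. 0 \<le> F x) \<longrightarrow> (\<forall>x. F x \<le> 1) \<longrightarrow>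
        (\<integral>x. F x \<partial>N E) = (\<integral>z. F (X z) * E z \<partial>M) \<and> integrable M (\<lambda>z. F (X z) * E z))"
    if E: "integrable M E" "\<And>z. 0 \<le> E z" for E
  proof (intro conjI allI impI)
    have [measurable]: "E \<in> borel_measurable M" using E by simp
    have "emeasure (N E) (space (N E)) = (\<integral>\<^sup>+z. ennreal (E z) \<partial>M)"
      unfolding N_def by (auto simp: emeasure_distr emeasure_density intro!: nn_integral_cong)
    also have "\<dots> = ennreal (\<integral>z. E z \<partial>M)" by (rule nn_integral_eq_integral) (use E in auto)
    finally show "finite_measure (N E)" by (intro finite_measureI) simp
    fix F :: "'a \<Rightarrow> real" assume [measurable]: "F \<in> borel_measurable borel" and F: "\<forall>x. 0 \<le> F x" "\<forall>x. F x \<le> 1"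
    have "(\<integral>x. F x \<partial>N E) = (\<integral>z. F (X z) \<partial>density M (\<lambda>z. ennreal (E z)))"
      unfolding N_def by (rule integral_distr) measurable
    also have "\<dots> = (\<integral>z. E z *\<^sub>R F (X z) \<partial>M)"
      by (rule integral_density) (use E in auto)
    finally show "(\<integral>x. F x \<partial>N E) = (\<integral>z. F (X z) * E z \<partial>M)" by (simp add: mult.commute)
    show "integrable M (\<lambda>z. F (X z) * E z)"
      by (rule Bochner_Integration.integrable_bound[OF E(1)])
        (use E F in \<open>auto simp: abs_mult intro!: mult_left_le_one_le\<close>)
  qed
  note Ip = I[OF pm(1,3)] and Im = I[OF pm(2,4)]
  have diff: "(\<integral>z. F (X z) * D z \<partial>M) = (\<integral>x. F x \<partial>N Dp) - (\<integral>x. F x \<partial>N Dm)"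
    if "F \<in> borel_measurable borel" "\<And>x. 0 \<le> F x" "\<And>x. F x \<le> 1" for F :: "'a \<Rightarrow> real"
    using Ip Im that unfolding pm(5) by (simp add: right_diff_distrib)
  have "N Dp = N Dm"
  proof (rule finite_borel_measure_eqI)
    fix F :: "'a \<Rightarrow> real" assume F: "continuous_on UNIV F" "\<And>z. 0 \<le> F z" "\<And>z. F z \<le> 1"
    show "(\<integral>x. F x \<partial>N Dp) = (\<integral>x. F x \<partial>N Dm)"
      using diff[OF borel_measurable_continuous_onI[OF F(1)] F(2,3)] z[OF F] by simp
  qed (use Ip Im in \<open>auto simp: N_def\<close>)
  then show ?thesis using diff[of "indicator A"] by (simp add: indicator_def)
qed

lemma clamp_error: "\<bar>t - max (-K) (min K t)\<bar> \<le> t\<^sup>2 / K" if "K > 0" for t K :: real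
proof (cases "\<bar>t\<bar> \<le> K")
  case True
  then have "max (-K) (min K t) = t" by auto
  then show ?thesis using that by simp
next
  case False
  then have "\<bar>t - max (-K) (min K t)\<bar> \<le> \<bar>t\<bar>" using that by auto
  also have "\<bar>t\<bar> * K \<le> \<bar>t\<bar> * \<bar>t\<bar>" using False by (intro mult_left_mono) auto
  then have "\<bar>t\<bar> \<le> t\<^sup>2 / K" using that by (simp add: pos_le_divide_eq power2_eq_square)
  finally show ?thesis .
qed

text \<open>The increment is continuous but unbounded, beyond the reach of weak convergence. It is
  clamped at level K; by the common second moment bound the error is at most 4 m / K, uniformly in n
  and also in the limit.\<close>

lemma martingale_weak_limit:
  fixes \<gamma> :: "nat \<Rightarrow> (pt \<times> pt) measure" and f :: "pt \<Rightarrow> real"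
  assumes P2: "\<And>n. \<gamma> n \<in> P2" and M: "M \<in> P2"
    and wc: "weakly_converges \<gamma> M"
    and m: "\<And>n. (\<integral>z. (norm z)\<^sup>2 \<partial>\<gamma> n) \<le> m" "(\<integral>z. (norm z)\<^sup>2 \<partial>M) \<le> m"
    and f: "continuous_on UNIV f" "\<And>x. \<bar>f x\<bar> \<le> norm x"
    and mart: "\<And>n A. A \<in> sets borel \<Longrightarrow> (\<integral>z. indicator A (fst z) * (f (snd z) - f (fst z)) \<partial>\<gamma> n) = 0"
    and A: "A \<in> sets borel"
  shows "(\<integral>z. indicator A (fst z) * (f (snd z) - f (fst z)) \<partial>M) = 0"
proof (rule integral_indicator_mult_eq_0I[OF _ _ _ A])
  define D where "D z = f (snd z) - f (fst z)" for z
  have fm[measurable]: "f \<in> borel_measurable borel" by (rule borel_measurable_continuous_onI[OF f(1)])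
  have [measurable]: "D \<in> borel_measurable borel" unfolding D_def by measurable
  have f1: "\<bar>f x\<bar> \<le> 1 * (1 + norm x)" for x using f(2)[of x] by simp
  have D2: "\<bar>D z\<bar> \<le> 2 * norm z" for z :: "pt \<times> pt"
    using f(2)[of "fst z"] f(2)[of "snd z"] norm_fst_le'[of z] norm_snd_le'[of z] unfolding D_def by linarith
  then have D2': "\<bar>D z\<bar> \<le> 2 * (1 + norm z)" for z :: "pt \<times> pt" by (smt (verit) norm_ge_zero)
  have Dsq: "(D z)\<^sup>2 \<le> 4 * (norm z)\<^sup>2" for z
    using power_mono[OF D2[of z], of 2] by (simp add: power_mult_distrib)
  show "fst \<in> borel_measurable M"
    using measurable_proj(1) by (simp add: measurable_cong_sets[OF P2_sets[OF M] refl])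
  show "integrable M (\<lambda>z. f (snd z) - f (fst z))"
    using P2_integrable_linear[OF M _ D2'] by (simp add: D_def)
  fix F :: "pt \<Rightarrow> real" assume F: "continuous_on UNIV F" "\<And>x. 0 \<le> F x" "\<And>x. F x \<le> 1"
  have [measurable]: "F \<in> borel_measurable borel" by (rule borel_measurable_continuous_onI[OF F(1)])
  have Fb: "\<bar>F x\<bar> \<le> 1 * (1 + norm x)" for x using F(2,3)[of x] by (simp add: add_increasing2)
  define T where "T K z = max (-K) (min K (D z))" for K and z :: "pt \<times> pt"
  have [measurable]: "T K \<in> borel_measurable borel" for K unfolding T_def by measurable
  have Tle: "\<bar>T K z\<bar> \<le> K" if "K > 0" for K z unfolding T_def using that by auto
  have err: "\<bar>(\<integral>z. F (fst z) * D z \<partial>N) - (\<integral>z. F (fst z) * T K z \<partial>N)\<bar> \<le> 4 * m / K"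
    if K: "K > 0" and N: "N \<in> P2" "(\<integral>z. (norm z)\<^sup>2 \<partial>N) \<le> m" for K N
  proof -
    have F1: "\<bar>F (fst z)\<bar> \<le> 1 * (1 + norm z)" for z :: "pt \<times> pt"
      using F(2,3)[of "fst z"] by (simp add: add_increasing2)
    have TK: "\<bar>T K z\<bar> \<le> K * (1 + norm z)" for z
      using Tle[OF K, of z] K by (simp add: distrib_left add_increasing2)
    have i: "integrable N (\<lambda>z. F (fst z) * D z)" "integrable N (\<lambda>z. F (fst z) * T K z)"
      using P2_integrable_mult[OF N(1) _ _ F1 D2'] P2_integrable_mult[OF N(1) _ _ F1 TK] by simp_all
    have "\<bar>(\<integral>z. F (fst z) * D z \<partial>N) - (\<integral>z. F (fst z) * T K z \<partial>N)\<bar>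
      = \<bar>\<integral>z. F (fst z) * D z - F (fst z) * T K z \<partial>N\<bar>" using i by simp
    also have "\<dots> \<le> (\<integral>z. \<bar>F (fst z) * D z - F (fst z) * T K z\<bar> \<partial>N)" by (rule integral_abs_bound)
    also have "\<dots> \<le> (\<integral>z. 4 * (norm z)\<^sup>2 / K \<partial>N)"
    proof (rule integral_mono)
      fix z
      have "\<bar>F (fst z) * D z - F (fst z) * T K z\<bar> = F (fst z) * \<bar>D z - T K z\<bar>"
        using F(2) by (simp add: right_diff_distrib[symmetric] abs_mult)
      also have "\<dots> \<le> 1 * ((D z)\<^sup>2 / K)"
        unfolding T_def using F(2,3) K by (intro mult_mono clamp_error) auto
      also have "\<dots> \<le> 4 * (norm z)\<^sup>2 / K" using Dsq[of z] K by (simp add: divide_right_mono)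
      finally show "\<bar>F (fst z) * D z - F (fst z) * T K z\<bar> \<le> 4 * (norm z)\<^sup>2 / K" .
    qed (use i P2_integrable_norm[OF N(1)] in auto)
    also have "\<dots> = 4 * (\<integral>z. (norm z)\<^sup>2 \<partial>N) / K" by simp
    also have "\<dots> \<le> 4 * m / K" using N(2) K by (simp add: divide_right_mono)
    finally show ?thesis .
  qed
  have zero: "(\<integral>z. F (fst z) * D z \<partial>\<gamma> n) = 0" for n
    unfolding D_def by (rule martingale_orthogonal1[OF P2 fm _ f1 Fb mart]) auto
  have le: "\<bar>\<integral>z. F (fst z) * D z \<partial>M\<bar> \<le> 8 * m / K" if K: "K > 0" for K
  proof -
    have "(\<lambda>n. \<integral>z. F (fst z) * T K z \<partial>\<gamma> n) \<longlonglongrightarrow> (\<integral>z. F (fst z) * T K z \<partial>M)"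
    proof (rule weakly_convergesD[OF wc])
      show "continuous_on UNIV (\<lambda>z. F (fst z) * T K z)"
        unfolding T_def D_def
        by (intro continuous_intros continuous_on_compose2[OF F(1)] continuous_on_compose2[OF f(1)]) auto
      show "\<bar>F (fst z) * T K z\<bar> \<le> 1 * K" for z
        unfolding abs_mult using F(2,3) Tle[OF K] by (intro mult_mono) auto
    qed
    then have "(\<lambda>n. \<bar>\<integral>z. F (fst z) * T K z \<partial>\<gamma> n\<bar>) \<longlonglongrightarrow> \<bar>\<integral>z. F (fst z) * T K z \<partial>M\<bar>"
      by (rule tendsto_rabs)
    then have "\<bar>\<integral>z. F (fst z) * T K z \<partial>M\<bar> \<le> 4 * m / K"
    proof (rule LIMSEQ_le_const2, intro exI allI impI)
      show "\<bar>\<integral>z. F (fst z) * T K z \<partial>\<gamma> n\<bar> \<le> 4 * m / K" for n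
        using err[OF K P2 m(1), of n] zero[of n] by simp
    qed
    then have "\<bar>\<integral>z. F (fst z) * D z \<partial>M\<bar> \<le> 4 * m / K + 4 * m / K"
      using err[OF K M m(2)] by linarith
    then show ?thesis by (simp add: add_divide_distrib[symmetric])
  qed
  show "(\<integral>z. F (fst z) * (f (snd z) - f (fst z)) \<partial>M) = 0"
  proof (rule ccontr)
    assume "(\<integral>z. F (fst z) * (f (snd z) - f (fst z)) \<partial>M) \<noteq> 0"
    then have pos: "0 < \<bar>\<integral>z. F (fst z) * D z \<partial>M\<bar>" (is "0 < ?a") unfolding D_def by simp
    have m0: "0 \<le> m" using m(2) integral_nonneg_AE[of "\<lambda>z. (norm z)\<^sup>2" M] by (smt (verit) AE_I2 zero_le_power2)
    \<comment> \<open>The level K = (8 m + 1) / ?a makes the bound 8 m / K smaller than ?a; the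
      summand 1 keeps K positive when m = 0.\<close>
    have "?a \<le> 8 * m / ((8 * m + 1) / ?a)" using m0 pos by (intro le) simp
    then have "?a * (8 * m + 1) \<le> 8 * m * ?a" using m0 pos by (simp add: field_simps)
    then show False using pos by (simp add: algebra_simps)
  qed
qed

lemma Gamma_weak_limit:
  assumes \<gamma>: "\<And>n. \<gamma> n \<in> Gamma \<nu>" and M: "prob_space M" "sets M = sets borel"
    and wc: "weakly_converges \<gamma> M"
    and p: "(\<lambda>n. primal (\<gamma> n)) \<longlonglongrightarrow> p"
  shows "M \<in> Gamma \<nu>" "primal M \<le> p"
proof -
  note P2 = GammaD(1)[OF \<gamma>]
  interpret M: prob_space M by (rule M)
  note fatou = integral_fatou_weak[OF P2_prob[OF P2] P2_sets[OF P2] M wc]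
  note [measurable_cong] = P2_sets[OF P2] M(2)
  define m where "m = 2 * (\<integral>y. (norm y)\<^sup>2 \<partial>\<nu>)"
  have n: "integrable M (\<lambda>z. (norm z)\<^sup>2)" "(\<integral>z. (norm z)\<^sup>2 \<partial>M) \<le> m"
    using fatou[where F = "\<lambda>z. (norm z)\<^sup>2" and K = "\<lambda>_. m" and k = m] P2_integrable_norm[OF P2] Gamma_second_moment[OF \<gamma>]
    by (simp_all add: m_def continuous_intros)
  then have MP2: "M \<in> P2" unfolding P2_def using M by simp
  have "distr M borel snd = \<nu>"
  proof (rule finite_borel_measure_eqI)
    show "finite_measure (distr M borel snd :: pt measure)" by (rule M.finite_measure_distr) simp
    have \<nu>: "\<nu> = distr (\<gamma> 0) borel snd" using GammaD(2)[OF \<gamma>] by simp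
    interpret \<gamma>0: prob_space "\<gamma> 0" by (rule P2_prob[OF P2])
    show "finite_measure \<nu>" unfolding \<nu> by (rule \<gamma>0.finite_measure_distr) measurable
    show "sets \<nu> = sets borel" unfolding \<nu> by simp
    fix F :: "pt \<Rightarrow> real" assume F: "continuous_on UNIV F" "\<And>z. 0 \<le> F z" "\<And>z. F z \<le> 1"
    have [measurable]: "F \<in> borel_measurable borel" by (rule borel_measurable_continuous_onI[OF F(1)])
    have "(\<lambda>n. \<integral>z. F (snd z) \<partial>\<gamma> n) \<longlonglongrightarrow> (\<integral>z. F (snd z) \<partial>M)"
      by (rule weakly_convergesD[OF wc, of _ 1]) (use F in \<open>auto intro!: continuous_on_compose2[OF F(1)] continuous_intros\<close>)
    moreover have "(\<integral>z. F (snd z) \<partial>\<gamma> n) = (\<integral>y. F y \<partial>\<nu>)" for n by (rule Gamma_integral_snd[OF \<gamma>]) measurable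
    ultimately have "(\<integral>z. F (snd z) \<partial>M) = (\<integral>y. F y \<partial>\<nu>)" by (simp add: LIMSEQ_const_iff)
    then show "(\<integral>y. F y \<partial>distr M borel snd) = (\<integral>y. F y \<partial>\<nu>)" by (subst integral_distr) simp_all
  qed simp
  moreover have "\<forall>A\<in>sets borel. (\<integral>z. indicator A (fst z) * (fst (snd z) - fst (fst z)) \<partial>M) = 0"
    using martingale_weak_limit[OF P2 MP2 wc _ n(2), of fst] Gamma_second_moment[OF \<gamma>] \<gamma> abs_fst_le_norm
    by (simp add: m_def Gamma_iff continuous_intros)
  moreover have "\<forall>A\<in>sets borel. (\<integral>z. indicator A (fst z) * (snd (snd z) - snd (fst z)) \<partial>M) = 0"
    using martingale_weak_limit[OF P2 MP2 wc _ n(2), of snd] Gamma_second_moment[OF \<gamma>] \<gamma> abs_snd_le_norm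
    by (simp add: m_def Gamma_iff continuous_intros)
  ultimately show G: "M \<in> Gamma \<nu>" unfolding Gamma_iff using MP2 by blast
  let ?F = "\<lambda>z :: pt \<times> pt. ((pu (snd z) - pu (fst z))\<^sup>2 + (pv (fst z))\<^sup>2) / 4"
  have "(\<integral>z. ?F z \<partial>M) \<le> p + (\<integral>y. (pv y)\<^sup>2 \<partial>\<nu>) / 4"
  proof (rule fatou(2))
    show "(\<integral>z. ?F z \<partial>\<gamma> n) \<le> primal (\<gamma> n) + (\<integral>y. (pv y)\<^sup>2 \<partial>\<nu>) / 4" for n
      using primal_eq_nonneg(2)[OF \<gamma>[of n]] by simp
    show "(\<lambda>n. primal (\<gamma> n) + (\<integral>y. (pv y)\<^sup>2 \<partial>\<nu>) / 4) \<longlonglongrightarrow> p + (\<integral>y. (pv y)\<^sup>2 \<partial>\<nu>) / 4"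
      by (intro tendsto_intros p)
    show "continuous_on UNIV ?F" by (intro continuous_intros) auto
  qed (use primal_eq_nonneg(1)[OF \<gamma>] in auto)
  then show "primal M \<le> p" using primal_eq_nonneg(2)[OF G] by simp
qed

lemma Gamma_tight:
  assumes \<gamma>: "\<And>n. \<gamma> n \<in> Gamma \<nu>" and e: "e > 0"
  shows "\<exists>r. \<forall>n. measure (\<gamma> n) {z. norm z > r} < e"
proof -
  define m where "m = 2 * (\<integral>y. (norm y)\<^sup>2 \<partial>\<nu>)"
  have "0 \<le> (\<integral>y. (norm y)\<^sup>2 \<partial>\<nu>)" by (rule integral_nonneg_AE) simp
  then have m0: "0 \<le> m" unfolding m_def by simp
  \<comment> \<open>The radius for Chebyshev's inequality; m + 1 instead of m makes the final
    estimate strict.\<close>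
  define r where "r = sqrt ((m + 1) / e)"
  have r: "r > 0" "r\<^sup>2 = (m + 1) / e" unfolding r_def using m0 e by simp_all
  have "measure (\<gamma> n) {z. norm z > r} < e" for n
  proof -
    note P2 = GammaD(1)[OF \<gamma>[of n]]
    interpret prob_space "\<gamma> n" by (rule P2_prob[OF P2])
    note [measurable_cong] = P2_sets[OF P2]
    have sp: "space (\<gamma> n) = UNIV" by (rule P2_space[OF P2])
    have "r\<^sup>2 * measure (\<gamma> n) {z. norm z > r} = (\<integral>z. r\<^sup>2 * indicator {z. norm z > r} z \<partial>\<gamma> n)"
      by (simp add: sp)
    also have "\<dots> \<le> (\<integral>z. (norm z)\<^sup>2 \<partial>\<gamma> n)"
    proof (rule integral_mono)
      show "integrable (\<gamma> n) (\<lambda>z. r\<^sup>2 * indicator {z. norm z > r} z)"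
        by (rule integrable_const_bound[of _ "r\<^sup>2"]) (auto simp: indicator_def)
      show "r\<^sup>2 * indicator {z. norm z > r} z \<le> (norm z)\<^sup>2" for z
        using r(1) by (auto simp: indicator_def intro!: power_mono)
    qed (rule P2_integrable_norm[OF P2])
    also have "\<dots> < m + 1" using Gamma_second_moment[OF \<gamma>[of n]] unfolding m_def by simp
    finally have "(m + 1) * measure (\<gamma> n) {z. norm z > r} < (m + 1) * e"
      unfolding r(2) using e by (simp add: field_simps)
    then show ?thesis using m0 by (simp add: mult_less_cancel_left_pos)
  qed
  then show ?thesis by blast
qed

text \<open>The coupling x = y shows that there are competitors at all.\<close>

lemma Gamma_diagonal:
  assumes \<nu>: "\<nu> \<in> P2" shows "distr \<nu> borel (\<lambda>y. (y, y)) \<in> Gamma \<nu>"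
proof -
  interpret prob_space \<nu> by (rule P2_prob[OF \<nu>])
  note [measurable_cong] = P2_sets[OF \<nu>]
  have dm: "(\<lambda>y :: pt. (y, y)) \<in> borel_measurable borel"
    by (intro borel_measurable_continuous_onI continuous_intros)
  then have [measurable]: "(\<lambda>y :: pt. (y, y)) \<in> borel_measurable \<nu>" by measurable
  have "integrable \<nu> (\<lambda>y. (norm (y, y))\<^sup>2)"
    using integrable_mult_right[OF P2_integrable_norm[OF \<nu>], of 2] by (simp add: norm_pair_squared[of "(_, _)"])
  then have "integrable (distr \<nu> borel (\<lambda>y. (y, y))) (\<lambda>z. (norm z)\<^sup>2)"
    by (subst integrable_distr_eq) simp_all
  then have 1: "distr \<nu> borel (\<lambda>y. (y, y)) \<in> P2"
    unfolding P2_def by (simp add: prob_space_distr)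
  have "distr (distr \<nu> borel (\<lambda>y. (y, y))) borel snd = distr \<nu> borel (\<lambda>y. y)"
    by (subst distr_distr) (auto simp: o_def)
  also have "\<dots> = \<nu>" by (rule distr_id2) (simp add: P2_sets[OF \<nu>])
  finally have 2: "distr (distr \<nu> borel (\<lambda>y. (y, y))) borel snd = \<nu>" .
  have "(\<integral>z. indicator A (fst z) * (fst (snd z) - fst (fst z)) \<partial>distr \<nu> borel (\<lambda>y. (y, y))) = 0"
    "(\<integral>z. indicator A (fst z) * (snd (snd z) - snd (fst z)) \<partial>distr \<nu> borel (\<lambda>y. (y, y))) = 0"
    if [measurable]: "A \<in> sets borel" for A
    by (subst integral_distr; simp)+
  with 1 2 show ?thesis unfolding Gamma_iff by blast
qed

theorem minimizer_exists:
  assumes \<nu>: "\<nu> \<in> P2"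
  shows "\<exists>\<gamma>. is_minimizer \<nu> \<gamma>"
proof -
  define p where "p = (INF \<gamma>\<in>Gamma \<nu>. primal \<gamma>)"
  have ne: "Gamma \<nu> \<noteq> {}" using Gamma_diagonal[OF \<nu>] by blast
  have lb: "- (\<integral>y. (pv y)\<^sup>2 \<partial>\<nu>) / 4 \<le> primal \<gamma>" if "\<gamma> \<in> Gamma \<nu>" for \<gamma>
  proof -
    have "0 \<le> (\<integral>z. ((pu (snd z) - pu (fst z))\<^sup>2 + (pv (fst z))\<^sup>2) / 4 \<partial>\<gamma>)" by (rule integral_nonneg_AE) simp
    then show ?thesis unfolding primal_eq_nonneg(2)[OF that] by simp
  qed
  then have bdd: "bdd_below (primal ` Gamma \<nu>)" by (intro bdd_belowI2) auto
  have "\<exists>\<gamma>\<in>Gamma \<nu>. primal \<gamma> < p + 1 / real (Suc n)" for n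
    using cINF_less_iff[OF ne bdd, of "p + 1 / real (Suc n)"] unfolding p_def by simp
  then obtain \<gamma> where \<gamma>: "\<And>n. \<gamma> n \<in> Gamma \<nu>" "\<And>n. primal (\<gamma> n) < p + 1 / real (Suc n)" by metis
  have ple: "p \<le> primal \<gamma>'" if "\<gamma>' \<in> Gamma \<nu>" for \<gamma>'
    unfolding p_def by (rule cINF_lower[OF bdd that])
  have lim: "(\<lambda>n. primal (\<gamma> n)) \<longlonglongrightarrow> p"
  proof (rule tendsto_sandwich[of "\<lambda>_. p" _ _ "\<lambda>n. p + 1 / real (Suc n)"])
    have "(\<lambda>n. p + 1 / real (Suc n)) \<longlonglongrightarrow> p + 0"
      by (intro tendsto_intros LIMSEQ_Suc lim_1_over_n)
    then show "(\<lambda>n. p + 1 / real (Suc n)) \<longlonglongrightarrow> p" by simp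
    show "\<forall>\<^sub>F n in sequentially. p \<le> primal (\<gamma> n)"
      by (intro always_eventually allI ple \<gamma>(1))
    show "\<forall>\<^sub>F n in sequentially. primal (\<gamma> n) \<le> p + 1 / real (Suc n)"
      by (intro always_eventually allI less_imp_le \<gamma>(2))
  qed simp
  note P2 = GammaD(1)[OF \<gamma>(1)]
  obtain r M where r: "strict_mono (r :: nat \<Rightarrow> nat)" and M: "prob_space M" "sets M = sets borel"
    and wc: "weakly_converges (\<lambda>n. \<gamma> (r n)) M"
    using tight_imp_weakly_convergent_subsequence[of \<gamma>] P2_prob[OF P2] P2_sets[OF P2] Gamma_tight[of \<gamma> \<nu>] \<gamma>(1)
    by meson
  have "(\<lambda>n. primal (\<gamma> (r n))) \<longlonglongrightarrow> p" using LIMSEQ_subseq_LIMSEQ[OF lim r] by (simp add: o_def)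
  note lim = Gamma_weak_limit[OF \<gamma>(1) M wc this]
  show ?thesis unfolding is_minimizer_def using lim ple by force
qed

section \<open>First-order optimality\<close>

text \<open>The perturbation needs conditional expectations that are honest functions of x and are
  bounded everywhere, because they will enter denominators and displacements.\<close>

lemma conditional_on_fst:
  fixes \<gamma> :: "(pt \<times> pt) measure" and g :: "pt \<times> pt \<Rightarrow> real"
  assumes \<gamma>: "prob_space \<gamma>" "sets \<gamma> = sets borel" and [measurable]: "g \<in> borel_measurable borel"
    and g: "\<And>z. a \<le> g z" "\<And>z. g z \<le> b"
  obtains \<alpha> :: "pt \<Rightarrow> real" where "\<alpha> \<in> borel_measurable borel" "\<And>x. a \<le> \<alpha> x" "\<And>x. \<alpha> x \<le> b"
    "\<And>h C. h \<in> borel_measurable borel \<Longrightarrow> (\<And>x. \<bar>h x\<bar> \<le> C) \<Longrightarrow>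
      (\<integral>z. h (fst z) * g z \<partial>\<gamma>) = (\<integral>z. h (fst z) * \<alpha> (fst z) \<partial>\<gamma>)"
proof -
  interpret prob_space \<gamma> by (rule \<gamma>)
  note [measurable_cong] = \<gamma>(2)
  define F where "F = vimage_algebra (space \<gamma>) fst (borel :: pt measure)"
  have F: "sets F = {fst -` A | A. A \<in> sets borel}" unfolding F_def by (rule fst_subalgebra(3)[OF \<gamma>])
  have spF: "space F = UNIV" unfolding F_def by (rule fst_subalgebra(2)[OF \<gamma>])
  interpret finite_measure_subalgebra \<gamma> F unfolding F_def by (rule fst_subalgebra(1)[OF \<gamma>])
  have ig: "integrable \<gamma> g"
    by (rule integrable_const_bound[of _ "max \<bar>a\<bar> \<bar>b\<bar>"]) (use g in \<open>auto intro!: AE_I2, smt (verit)\<close>)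
  define E where "E = real_cond_exp \<gamma> F g"
  have Em: "E \<in> borel_measurable F" unfolding E_def by measurable
  \<comment> \<open>The level set of E through z is a cylinder over a set of first coordinates, so E
    is constant along each fibre; 0 is an arbitrary second coordinate.\<close>
  have E_fst: "E z = E (fst z, 0)" for z
  proof -
    have "E -` {E z} \<inter> space F \<in> sets F" by (rule measurable_sets[OF Em]) simp
    then obtain A where "E -` {E z} = fst -` A" using F spF by auto
    then show ?thesis by (metis (no_types, lifting) fst_conv insertI1 singletonD vimage_eq)
  qed
  have "(\<lambda>x :: pt. (x, 0 :: pt)) \<in> measurable borel F"
  proof (rule measurableI)
    fix S assume "S \<in> sets F"
    then obtain A where "A \<in> sets borel" "S = fst -` A" using F by auto
    then show "(\<lambda>x. (x, 0)) -` S \<inter> space borel \<in> sets borel" by (simp add: vimage_def)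
  qed (simp add: spF)
  from measurable_compose[OF this Em] have [measurable]: "(\<lambda>x. E (x, 0)) \<in> borel_measurable borel" .
  \<comment> \<open>The clamp changes E only on a null set and makes the bounds hold
    everywhere.\<close>
  define \<alpha> where "\<alpha> x = max a (min b (E (x, 0)))" for x
  have ae: "AE z in \<gamma>. E z = \<alpha> (fst z)"
  proof -
    have "AE z in \<gamma>. a \<le> E z" unfolding E_def by (rule real_cond_exp_ge_c[OF ig]) (simp add: g)
    moreover have "AE z in \<gamma>. E z \<le> b" unfolding E_def by (rule real_cond_exp_le_c[OF ig]) (simp add: g)
    ultimately show ?thesis
    proof eventually_elim
      case (elim z)
      then show ?case unfolding \<alpha>_def E_fst[symmetric] by simp
    qed
  qed
  show ?thesis
  proof
    show m: "\<alpha> \<in> borel_measurable borel" unfolding \<alpha>_def by measurable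
    show "a \<le> \<alpha> x" "\<alpha> x \<le> b" for x unfolding \<alpha>_def using order_trans[OF g(1) g(2)] by auto
    fix h :: "pt \<Rightarrow> real" and C assume [measurable]: "h \<in> borel_measurable borel" and h: "\<And>x. \<bar>h x\<bar> \<le> C"
    have hm: "(\<lambda>z. h (fst z)) \<in> borel_measurable F"
      unfolding F_def by (rule fst_subalgebra(4)[OF \<gamma>]) measurable
    have "integrable \<gamma> (\<lambda>z. h (fst z) * g z)"
    proof (rule Bochner_Integration.integrable_bound[OF integrable_mult_right[OF ig, of C]])
      have "\<bar>h (fst z)\<bar> * \<bar>g z\<bar> \<le> \<bar>C\<bar> * \<bar>g z\<bar>" for z
        using order_trans[OF h[of "fst z"] abs_ge_self] by (rule mult_right_mono) simp
      then show "AE z in \<gamma>. norm (h (fst z) * g z) \<le> norm (C * g z)" by (simp add: abs_mult)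
    qed measurable
    then have "(\<integral>z. h (fst z) * g z \<partial>\<gamma>) = (\<integral>z. h (fst z) * E z \<partial>\<gamma>)"
      unfolding E_def by (intro real_cond_exp_intg(2)[symmetric] hm) measurable
    also have "\<dots> = (\<integral>z. h (fst z) * \<alpha> (fst z) \<partial>\<gamma>)"
      by (rule integral_cong_AE) (use ae m Em in \<open>auto simp: E_def\<close>)
    finally show "(\<integral>z. h (fst z) * g z \<partial>\<gamma>) = (\<integral>z. h (fst z) * \<alpha> (fst z) \<partial>\<gamma>)" .
  qed
qed

text \<open>N is the law of the point that is S(z) with probability p(z) and T(z) otherwise; the
  coin is the boolean factor, weighted by p(z) and 1 - p(z).\<close>

lemma random_choice_measure:
  fixes M :: "'a measure" and S T :: "'a \<Rightarrow> 'b::topological_space"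
  assumes "prob_space M" and [measurable]: "p \<in> borel_measurable M" "S \<in> borel_measurable M" "T \<in> borel_measurable M"
    and p: "\<And>z. 0 \<le> p z" "\<And>z. p z \<le> (1::real)"
  obtains N :: "'b measure" where "prob_space N" "sets N = sets borel"
    "\<And>f :: 'b \<Rightarrow> real. f \<in> borel_measurable borel \<Longrightarrow> integrable M (\<lambda>z. p z * f (S z)) \<Longrightarrow>
        integrable M (\<lambda>z. (1 - p z) * f (T z)) \<Longrightarrow>
        integrable N f \<and> (\<integral>x. f x \<partial>N) = (\<integral>z. p z * f (S z) + (1 - p z) * f (T z) \<partial>M)"
proof -
  interpret M: prob_space M by fact
  let ?B = "count_space (UNIV :: bool set)"
  interpret B: sigma_finite_measure ?B by (rule sigma_finite_measure_count_space_finite) simp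
  interpret P: pair_sigma_finite M ?B ..
  define wt where "wt zb = (if snd zb then p (fst zb) else 1 - p (fst zb))" for zb :: "'a \<times> bool"
  define \<Phi> where "\<Phi> zb = (if snd zb then S (fst zb) else T (fst zb))" for zb :: "'a \<times> bool"
  have [measurable]: "wt \<in> borel_measurable (M \<Otimes>\<^sub>M ?B)" "\<Phi> \<in> borel_measurable (M \<Otimes>\<^sub>M ?B)"
    unfolding wt_def \<Phi>_def by measurable
  have wt0: "0 \<le> wt zb" for zb unfolding wt_def using p by auto
  define N where "N = distr (density (M \<Otimes>\<^sub>M ?B) (\<lambda>zb. ennreal (wt zb))) borel \<Phi>"
  show ?thesis
  proof
    show "sets N = sets borel" unfolding N_def by simp
    have "emeasure N (space N) = (\<integral>\<^sup>+zb. ennreal (wt zb) \<partial>(M \<Otimes>\<^sub>M ?B))"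
      unfolding N_def by (auto simp: emeasure_distr emeasure_density intro!: nn_integral_cong)
    also have "\<dots> = (\<integral>\<^sup>+z. (\<integral>\<^sup>+b. ennreal (wt (z, b)) \<partial>?B) \<partial>M)"
      by (rule B.nn_integral_fst[symmetric]) measurable
    also have "\<dots> = (\<integral>\<^sup>+z. 1 \<partial>M)"
    proof (rule nn_integral_cong)
      fix z
      have "(\<integral>\<^sup>+b. ennreal (wt (z, b)) \<partial>?B) = ennreal (p z) + ennreal (1 - p z)"
        by (simp add: nn_integral_count_space_finite UNIV_bool wt_def add.commute)
      also have "\<dots> = 1" using p by (simp flip: ennreal_plus)
      finally show "(\<integral>\<^sup>+b. ennreal (wt (z, b)) \<partial>?B) = 1" .
    qed
    also have "\<dots> = 1" by (simp add: M.emeasure_space_1)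
    finally show "prob_space N" by (rule prob_spaceI)
    fix f :: "'b \<Rightarrow> real"
    assume [measurable]: "f \<in> borel_measurable borel"
      and i: "integrable M (\<lambda>z. p z * f (S z))" "integrable M (\<lambda>z. (1 - p z) * f (T z))"
    define g where "g zb = wt zb * f (\<Phi> zb)" for zb
    have [measurable]: "g \<in> borel_measurable (M \<Otimes>\<^sub>M ?B)" unfolding g_def by measurable
    have sum: "(\<integral>b. h (z, b) \<partial>?B) = h (z, True) + h (z, False)" for h :: "'a \<times> bool \<Rightarrow> real" and z
      by (simp add: lebesgue_integral_count_space_finite UNIV_bool add.commute)
    have g2: "g (z, True) = p z * f (S z)" "g (z, False) = (1 - p z) * f (T z)" for z
      unfolding g_def wt_def \<Phi>_def by simp_all
    have ig: "integrable (M \<Otimes>\<^sub>M ?B) g"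
    proof (rule P.Fubini_integrable)
      show "integrable M (\<lambda>z. \<integral>b. norm (g (z, b)) \<partial>?B)"
        unfolding sum[of "\<lambda>zb. norm (g zb)"] g2
        by (intro Bochner_Integration.integrable_add integrable_norm i)
      show "AE z in M. integrable ?B (\<lambda>b. g (z, b))" by (simp add: integrable_count_space)
    qed measurable
    have "integrable N f \<longleftrightarrow> integrable (M \<Otimes>\<^sub>M ?B) g"
      unfolding N_def g_def
      by (subst integrable_distr_eq, simp, simp, subst integrable_density) (auto simp: wt0)
    moreover have "(\<integral>x. f x \<partial>N) = (\<integral>zb. g zb \<partial>(M \<Otimes>\<^sub>M ?B))"
      unfolding N_def g_def
      by (subst integral_distr, simp, simp, subst integral_density) (auto simp: wt0)
    moreover have "\<dots> = (\<integral>z. (\<integral>b. g (z, b) \<partial>?B) \<partial>M)" by (rule P.integral_fst'[symmetric, OF ig])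
    ultimately show "integrable N f \<and> (\<integral>x. f x \<partial>N) = (\<integral>z. p z * f (S z) + (1 - p z) * f (T z) \<partial>M)"
      using ig by (simp add: sum g2)
  qed
qed

text \<open>A fraction \<open>e * k\<close> of the mass is collected in the single new point \<open>w\<close>, its barycenter. The
  displacement of the remaining mass contributes to the cost only in second order.\<close>

lemma perturbed_coupling:
  fixes k :: "pt \<times> pt \<Rightarrow> real"
  assumes \<gamma>: "\<gamma> \<in> Gamma \<nu>" and km[measurable]: "k \<in> borel_measurable borel"
    and k: "\<And>z. 0 \<le> k z" "\<And>z. k z \<le> K" and R: "0 \<le> R" "\<And>z. k z \<noteq> 0 \<Longrightarrow> norm z \<le> R"
    and k1: "(\<integral>z. k z \<partial>\<gamma>) = 1"
    and w: "w = (\<integral>z. k z * fst (snd z) \<partial>\<gamma>, \<integral>z. k z * snd (snd z) \<partial>\<gamma>)"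
    and e: "0 \<le> e" "e * K \<le> 1 / 2"
  obtains \<gamma>' where "\<gamma>' \<in> Gamma \<nu>"
    "primal \<gamma>' \<le> primal \<gamma> + e * (\<integral>z. k z * (c w (snd z) - c (fst z) (snd z)) \<partial>\<gamma>) + e\<^sup>2 * (32 * K\<^sup>2 * R\<^sup>2)"
proof -
  note P2 = GammaD(1)[OF \<gamma>]
  interpret prob_space \<gamma> by (rule P2_prob[OF P2])
  note [measurable_cong] = P2_sets[OF P2]
  have K0: "0 \<le> K" using k[of 0] by linarith
  have ek: "0 \<le> e * k z" "e * k z \<le> 1 / 2" for z
    using e k[of z] mult_left_mono[OF k(2)[of z] e(1)] by auto
  define d1 where "d1 z = fst (snd z) - fst (fst z)" for z :: "pt \<times> pt"
  define d2 where "d2 z = snd (snd z) - snd (fst z)" for z :: "pt \<times> pt"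
  have [measurable]: "d1 \<in> borel_measurable borel" "d2 \<in> borel_measurable borel"
    unfolding d1_def d2_def by measurable
  have dn: "\<bar>d1 z\<bar> \<le> 2 * norm z" "\<bar>d2 z\<bar> \<le> 2 * norm z" for z
    using abs_fst_le_norm[of "fst z"] abs_fst_le_norm[of "snd z"] abs_snd_le_norm[of "fst z"] abs_snd_le_norm[of "snd z"]
      norm_fst_le'[of z] norm_snd_le'[of z] unfolding d1_def d2_def by linarith+
  have kd: "\<bar>k z * d1 z\<bar> \<le> 2 * K * R" "\<bar>k z * d2 z\<bar> \<le> 2 * K * R" for z
  proof -
    have "\<bar>k z * d z\<bar> \<le> 2 * K * R" if d: "\<bar>d z\<bar> \<le> 2 * norm z" for d :: "pt \<times> pt \<Rightarrow> real"
    proof (cases "k z = 0")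
      case False
      then have "\<bar>k z * d z\<bar> \<le> K * (2 * R)"
        unfolding abs_mult using k[of z] R(2)[of z] d K0 by (intro mult_mono) auto
      then show ?thesis by (simp add: mult_ac)
    qed (use K0 R in simp)
    then show "\<bar>k z * d1 z\<bar> \<le> 2 * K * R" "\<bar>k z * d2 z\<bar> \<le> 2 * K * R" using dn by auto
  qed
  \<comment> \<open>Given x, the expected removed mass is e times a0, and it takes with it e times
    a1 and e times a2 of the two increments. As the full increment has conditional mean zero, the
    rest has mass 1 - e a0 and increments - e a1 and - e a2; their quotients are the
    displacements.\<close>
  obtain a0 where a0[measurable]: "a0 \<in> borel_measurable borel" "\<And>x. 0 \<le> a0 x" "\<And>x. a0 x \<le> K"
    and a0_int: "\<And>h C. h \<in> borel_measurable borel \<Longrightarrow> (\<And>x. \<bar>h x\<bar> \<le> C) \<Longrightarrow>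
      (\<integral>z. h (fst z) * k z \<partial>\<gamma>) = (\<integral>z. h (fst z) * a0 (fst z) \<partial>\<gamma>)"
    using conditional_on_fst[OF P2_prob[OF P2] P2_sets[OF P2] km k] by blast
  have kd': "- (2 * K * R) \<le> k z * d1 z" "k z * d1 z \<le> 2 * K * R" "- (2 * K * R) \<le> k z * d2 z" "k z * d2 z \<le> 2 * K * R"
    for z using kd[of z] by (simp_all add: abs_le_iff)
  have "(\<lambda>z. k z * d1 z) \<in> borel_measurable borel" "(\<lambda>z. k z * d2 z) \<in> borel_measurable borel" by measurable
  note kdm = this
  obtain a1 where a1[measurable]: "a1 \<in> borel_measurable borel" "\<And>x. - (2 * K * R) \<le> a1 x" "\<And>x. a1 x \<le> 2 * K * R"
    and a1_int: "\<And>h C. h \<in> borel_measurable borel \<Longrightarrow> (\<And>x. \<bar>h x\<bar> \<le> C) \<Longrightarrow>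
      (\<integral>z. h (fst z) * (k z * d1 z) \<partial>\<gamma>) = (\<integral>z. h (fst z) * a1 (fst z) \<partial>\<gamma>)"
    using conditional_on_fst[OF P2_prob[OF P2] P2_sets[OF P2] kdm(1) kd'(1,2)] by blast
  obtain a2 where a2[measurable]: "a2 \<in> borel_measurable borel" "\<And>x. - (2 * K * R) \<le> a2 x" "\<And>x. a2 x \<le> 2 * K * R"
    and a2_int: "\<And>h C. h \<in> borel_measurable borel \<Longrightarrow> (\<And>x. \<bar>h x\<bar> \<le> C) \<Longrightarrow>
      (\<integral>z. h (fst z) * (k z * d2 z) \<partial>\<gamma>) = (\<integral>z. h (fst z) * a2 (fst z) \<partial>\<gamma>)"
    using conditional_on_fst[OF P2_prob[OF P2] P2_sets[OF P2] kdm(2) kd'(3,4)] by blast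
  have ea0: "0 \<le> e * a0 x" "e * a0 x \<le> 1 / 2" for x
    using e a0(2,3)[of x] mult_left_mono[OF a0(3)[of x] e(1)] by auto
  \<comment> \<open>The numerators are at most 2 K R e and the denominators at least 1/2.\<close>
  define \<Delta> where "\<Delta> = 4 * K * R * e"
  have \<Delta>0: "0 \<le> \<Delta>" unfolding \<Delta>_def using K0 R e by simp
  text \<open>The displacement that restores the martingale property of the mass left in place.\<close>
  define \<delta> where "\<delta> a x = - (e * a x) / (1 - e * a0 x)" for a and x :: pt
  have \<delta>: "\<bar>\<delta> a x\<bar> \<le> \<Delta>" "\<delta> a x * (1 - e * a0 x) = - (e * a x)"
    if "\<And>x. - (2 * K * R) \<le> a x" "\<And>x. a x \<le> 2 * K * R" for a x
  proof -
    have "\<bar>e * a x\<bar> \<le> e * (2 * K * R)" unfolding abs_mult using that[of x] e by (intro mult_mono) auto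
    also have "\<dots> = \<Delta> * (1 / 2)" unfolding \<Delta>_def by simp
    also have "\<dots> \<le> \<Delta> * (1 - e * a0 x)" using ea0[of x] \<Delta>0 by (intro mult_left_mono) auto
    finally show "\<bar>\<delta> a x\<bar> \<le> \<Delta>"
      unfolding \<delta>_def using ea0[of x] by (simp add: abs_divide pos_divide_le_eq)
    show "\<delta> a x * (1 - e * a0 x) = - (e * a x)" unfolding \<delta>_def using ea0[of x] by simp
  qed
  define \<delta>1 where "\<delta>1 = \<delta> a1" define \<delta>2 where "\<delta>2 = \<delta> a2"
  have [measurable]: "\<delta>1 \<in> borel_measurable borel" "\<delta>2 \<in> borel_measurable borel"
    unfolding \<delta>1_def \<delta>2_def \<delta>_def by measurable
  have \<delta>1: "\<bar>\<delta>1 x\<bar> \<le> \<Delta>" "\<delta>1 x * (1 - e * a0 x) = - (e * a1 x)"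
    and \<delta>2: "\<bar>\<delta>2 x\<bar> \<le> \<Delta>" "\<delta>2 x * (1 - e * a0 x) = - (e * a2 x)" for x
    unfolding \<delta>1_def \<delta>2_def by (rule \<delta>[OF a1(2,3)] \<delta>[OF a2(2,3)])+
  define x' where "x' x = (fst x + \<delta>1 x, snd x + \<delta>2 x)" for x
  have x'm[measurable]: "x' \<in> borel_measurable borel"
    unfolding x'_def by (subst borel_prod[symmetric]) measurable
  have Pm: "(\<lambda>z. (w, snd z)) \<in> borel_measurable \<gamma>" "(\<lambda>z. (x' (fst z), snd z)) \<in> borel_measurable \<gamma>"
    by (subst borel_prod[symmetric], measurable)+
  have pm: "(\<lambda>z. e * k z) \<in> borel_measurable \<gamma>" by measurable
  have ek1: "e * k z \<le> 1" for z using ek(2)[of z] by linarith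
  obtain N where N: "prob_space N" "sets N = sets borel"
    and N_int: "\<And>f :: pt \<times> pt \<Rightarrow> real. f \<in> borel_measurable borel \<Longrightarrow> integrable \<gamma> (\<lambda>z. e * k z * f (w, snd z)) \<Longrightarrow>
        integrable \<gamma> (\<lambda>z. (1 - e * k z) * f (x' (fst z), snd z)) \<Longrightarrow>
        integrable N f \<and> (\<integral>z. f z \<partial>N) = (\<integral>z. e * k z * f (w, snd z) + (1 - e * k z) * f (x' (fst z), snd z) \<partial>\<gamma>)"
    using random_choice_measure[OF P2_prob[OF P2] pm Pm ek(1) ek1] by blast
  define W where "W = norm w + 2 * \<Delta> + 1"
  have W: "norm w \<le> W" "2 * \<Delta> \<le> W" "1 \<le> W" unfolding W_def using \<Delta>0 by simp_all
  have x'n: "norm (x' x) \<le> norm x + 2 * \<Delta>" for x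
  proof -
    have "norm (x' x) = norm (x + (\<delta>1 x, \<delta>2 x))" unfolding x'_def by (metis plus_prod_def fst_conv snd_conv)
    also have "\<dots> \<le> norm x + norm (\<delta>1 x, \<delta>2 x)" by (rule norm_triangle_ineq)
    also have "norm (\<delta>1 x, \<delta>2 x) \<le> \<bar>\<delta>1 x\<bar> + \<bar>\<delta>2 x\<bar>" using norm_Pair_le[of "\<delta>1 x" "\<delta>2 x"] by simp
    also have "\<dots> \<le> 2 * \<Delta>" using \<delta>1(1)[of x] \<delta>2(1)[of x] by linarith
    finally show ?thesis by simp
  qed
  have quad: "integrable \<gamma> (\<lambda>z. e * k z * f (w, snd z))" "integrable \<gamma> (\<lambda>z. (1 - e * k z) * f (x' (fst z), snd z))"
    if fm[measurable]: "f \<in> borel_measurable borel" and f: "\<And>z. \<bar>f z\<bar> \<le> C * (1 + (norm z)\<^sup>2)" for f :: "pt \<times> pt \<Rightarrow> real" and C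
  proof -
    have C0: "0 \<le> C" using f[of 0] by simp
    have q: "\<bar>p * f (a, snd z)\<bar> \<le> (4 * W\<^sup>2 * C) * (1 + (norm z)\<^sup>2)"
      if "\<bar>p\<bar> \<le> 1" "norm a \<le> norm (fst z) + W" for p a and z :: "pt \<times> pt"
    proof -
      have "(norm a)\<^sup>2 \<le> (norm (fst z) + W)\<^sup>2" using that(2) by (intro power_mono) auto
      also have "\<dots> \<le> 2 * (norm (fst z))\<^sup>2 + 2 * W\<^sup>2"
        using zero_le_power2[of "norm (fst z) - W"] by (simp add: power2_eq_square algebra_simps)
      finally have "(norm (a, snd z))\<^sup>2 \<le> 2 * (norm z)\<^sup>2 + 2 * W\<^sup>2"
        unfolding norm_pair_squared[of z] norm_pair_squared[of "(a, snd z)"] fst_conv snd_conv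
        using zero_le_power2[of "norm (snd z)"] by (smt (verit))
      moreover have W2: "1 \<le> W\<^sup>2" using W(3) by simp
      moreover have "(norm z)\<^sup>2 \<le> W\<^sup>2 * (norm z)\<^sup>2" using mult_right_mono[OF W2, of "(norm z)\<^sup>2"] by simp
      ultimately have "1 + (norm (a, snd z))\<^sup>2 \<le> 4 * W\<^sup>2 + 4 * (W\<^sup>2 * (norm z)\<^sup>2)"
        using zero_le_power2[of "norm z"] by linarith
      then have "1 + (norm (a, snd z))\<^sup>2 \<le> 4 * W\<^sup>2 * (1 + (norm z)\<^sup>2)"
        by (simp add: distrib_left)
      then have "C * (1 + (norm (a, snd z))\<^sup>2) \<le> C * (4 * W\<^sup>2 * (1 + (norm z)\<^sup>2))" using C0 by (rule mult_left_mono)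
      with f[of "(a, snd z)"] have "\<bar>f (a, snd z)\<bar> \<le> (4 * W\<^sup>2 * C) * (1 + (norm z)\<^sup>2)" by (simp add: mult_ac)
      moreover have "\<bar>p * f (a, snd z)\<bar> \<le> \<bar>f (a, snd z)\<bar>"
        unfolding abs_mult using that(1) by (simp add: mult_left_le_one_le)
      ultimately show ?thesis by linarith
    qed
    have [measurable]: "(\<lambda>z :: pt \<times> pt. (w, snd z)) \<in> borel_measurable borel"
      "(\<lambda>z :: pt \<times> pt. (x' (fst z), snd z)) \<in> borel_measurable borel"
      using Pm by (simp_all add: measurable_cong_sets[OF P2_sets[OF P2] refl])
    show "integrable \<gamma> (\<lambda>z. e * k z * f (w, snd z))"
    proof (rule P2_integrable[OF P2 _ q])
      show "\<bar>e * k z\<bar> \<le> 1" for z using ek[of z] by simp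
      show "norm w \<le> norm (fst z) + W" for z :: "pt \<times> pt" using W(1) by (simp add: add_increasing)
    qed measurable
    show "integrable \<gamma> (\<lambda>z. (1 - e * k z) * f (x' (fst z), snd z))"
    proof (rule P2_integrable[OF P2 _ q])
      show "\<bar>1 - e * k z\<bar> \<le> 1" for z using ek[of z] by simp
      show "norm (x' (fst z)) \<le> norm (fst z) + W" for z :: "pt \<times> pt" using W(2) x'n[of "fst z"] by linarith
    qed measurable
  qed
  have N_quad: "integrable N f"
    "(\<integral>z. f z \<partial>N) = (\<integral>z. e * k z * f (w, snd z) \<partial>\<gamma>) + (\<integral>z. (1 - e * k z) * f (x' (fst z), snd z) \<partial>\<gamma>)"
    if "f \<in> borel_measurable borel" "\<And>z. \<bar>f z\<bar> \<le> C * (1 + (norm z)\<^sup>2)" for f :: "pt \<times> pt \<Rightarrow> real" and C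
    using N_int[OF that(1) quad[OF that]] quad[OF that] by simp_all
  have NP2: "N \<in> P2" unfolding P2_def using N N_quad(1)[of "\<lambda>z. (norm z)\<^sup>2" 1] by simp
  have Nsnd: "distr N borel snd = \<nu>"
  proof (rule finite_borel_measure_eqI)
    interpret N: prob_space N by (rule N)
    have [measurable]: "snd \<in> measurable N (borel :: pt measure)"
      using measurable_proj(2) by (simp add: measurable_cong_sets[OF N(2) refl])
    show "finite_measure (distr N borel snd :: pt measure)" by (rule N.finite_measure_distr) simp
    have \<nu>: "\<nu> = distr \<gamma> borel snd" using GammaD(2)[OF \<gamma>] by simp
    show "finite_measure \<nu>" unfolding \<nu> by (rule finite_measure_distr) measurable
    show "sets \<nu> = sets borel" unfolding \<nu> by simp
    fix F :: "pt \<Rightarrow> real" assume F: "continuous_on UNIV F" "\<And>z. 0 \<le> F z" "\<And>z. F z \<le> 1"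
    have [measurable]: "F \<in> borel_measurable borel" by (rule borel_measurable_continuous_onI[OF F(1)])
    have b: "\<bar>F (snd z)\<bar> \<le> 1 * (1 + (norm z)\<^sup>2)" for z :: "pt \<times> pt" using F(2,3)[of "snd z"] by (simp add: add_increasing2)
    have "(\<integral>y. F y \<partial>distr N borel snd) = (\<integral>z. F (snd z) \<partial>N)" by (subst integral_distr) simp_all
    also have "\<dots> = (\<integral>z. e * k z * F (snd z) \<partial>\<gamma>) + (\<integral>z. (1 - e * k z) * F (snd z) \<partial>\<gamma>)"
      using N_quad(2)[OF _ b] by simp
    also have "\<dots> = (\<integral>z. e * k z * F (snd z) + (1 - e * k z) * F (snd z) \<partial>\<gamma>)"
      using quad[OF _ b] by simp
    also have "\<dots> = (\<integral>z. F (snd z) \<partial>\<gamma>)" by (simp add: algebra_simps)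
    also have "\<dots> = (\<integral>y. F y \<partial>\<nu>)" by (rule Gamma_integral_snd[OF \<gamma>]) measurable
    finally show "(\<integral>y. F y \<partial>distr N borel snd) = (\<integral>y. F y \<partial>\<nu>)" .
  qed simp
  have bnd: "integrable \<gamma> g" if "g \<in> borel_measurable borel" "\<And>z. \<bar>g z\<bar> \<le> B" for g :: "pt \<times> pt \<Rightarrow> real" and B
    by (rule integrable_const_bound[of _ B]) (use that in \<open>auto simp: measurable_cong_sets[OF P2_sets[OF P2] refl]\<close>)
  \<comment> \<open>Balance for the mass left in place, for one coordinate. The weight k depends on
    z, but against a function of x it may be replaced by a0, after which the integrand vanishes
    pointwise by the choice of s.\<close>
  have rest: "(\<integral>z. h (fst z) * ((1 - e * k z) * (d z - s (fst z))) \<partial>\<gamma>) = 0"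
    if hm[measurable]: "h \<in> borel_measurable borel" and h: "\<And>x. \<bar>h x\<bar> \<le> C"
      and sm[measurable]: "s \<in> borel_measurable borel" and s: "\<And>x. \<bar>s x\<bar> \<le> \<Delta>" "\<And>x. s x * (1 - e * a0 x) = - (e * a x)"
      and am[measurable]: "a \<in> borel_measurable borel" and a: "\<And>x. \<bar>a x\<bar> \<le> A" 
      and dm[measurable]: "d \<in> borel_measurable borel" and kdb: "\<And>z. \<bar>k z * d z\<bar> \<le> D"
      and hd: "integrable \<gamma> (\<lambda>z. h (fst z) * d z)" "(\<integral>z. h (fst z) * d z \<partial>\<gamma>) = 0"
      and ai: "(\<integral>z. h (fst z) * (k z * d z) \<partial>\<gamma>) = (\<integral>z. h (fst z) * a (fst z) \<partial>\<gamma>)"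
    for h s a :: "pt \<Rightarrow> real" and d C A D
  proof -
    have C0: "0 \<le> C" using h[of 0] by linarith
    have b: "\<bar>h (fst z) * (k z * d z)\<bar> \<le> C * D" "\<bar>h (fst z) * s (fst z)\<bar> \<le> C * \<Delta>"
      "\<bar>h (fst z) * s (fst z) * k z\<bar> \<le> C * \<Delta> * K" "\<bar>h (fst z) * s (fst z) * a0 (fst z)\<bar> \<le> C * \<Delta> * K"
      "\<bar>h (fst z) * a (fst z)\<bar> \<le> C * A" for z
      unfolding abs_mult using h[of "fst z"] s(1)[of "fst z"] a[of "fst z"] kdb[of z] k[of z] a0(2,3)[of "fst z"] C0 \<Delta>0
      by (auto intro!: mult_mono simp: abs_mult)
    have i: "integrable \<gamma> (\<lambda>z. h (fst z) * (k z * d z))" "integrable \<gamma> (\<lambda>z. h (fst z) * s (fst z))"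
      "integrable \<gamma> (\<lambda>z. h (fst z) * s (fst z) * k z)" "integrable \<gamma> (\<lambda>z. h (fst z) * s (fst z) * a0 (fst z))"
      "integrable \<gamma> (\<lambda>z. h (fst z) * a (fst z))"
      by (rule bnd[OF _ b(1)] bnd[OF _ b(2)] bnd[OF _ b(3)] bnd[OF _ b(4)] bnd[OF _ b(5)]; measurable)+
    have "(\<integral>z. h (fst z) * ((1 - e * k z) * (d z - s (fst z))) \<partial>\<gamma>)
      = (\<integral>z. h (fst z) * d z - e * (h (fst z) * (k z * d z)) - h (fst z) * s (fst z) + e * (h (fst z) * s (fst z) * k z) \<partial>\<gamma>)"
      by (intro Bochner_Integration.integral_cong refl) (simp add: algebra_simps)
    also have "\<dots> = - e * (\<integral>z. h (fst z) * (k z * d z) \<partial>\<gamma>) - (\<integral>z. h (fst z) * s (fst z) \<partial>\<gamma>)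
        + e * (\<integral>z. h (fst z) * s (fst z) * k z \<partial>\<gamma>)"
      using i hd by simp
    also have "(\<integral>z. h (fst z) * s (fst z) * k z \<partial>\<gamma>) = (\<integral>z. h (fst z) * s (fst z) * a0 (fst z) \<partial>\<gamma>)"
    proof (rule a0_int[of "\<lambda>x. h x * s x"])
      show "\<bar>h x * s x\<bar> \<le> C * \<Delta>" for x using b(2)[of "(x, 0)"] by simp
    qed measurable
    also have "- e * (\<integral>z. h (fst z) * (k z * d z) \<partial>\<gamma>) - (\<integral>z. h (fst z) * s (fst z) \<partial>\<gamma>)
        + e * (\<integral>z. h (fst z) * s (fst z) * a0 (fst z) \<partial>\<gamma>)
      = (\<integral>z. - e * (h (fst z) * a (fst z)) - h (fst z) * s (fst z) + e * (h (fst z) * s (fst z) * a0 (fst z)) \<partial>\<gamma>)"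
      unfolding ai using i by simp
    also have "\<dots> = (\<integral>z. 0 \<partial>\<gamma>)"
    proof (intro Bochner_Integration.integral_cong refl)
      fix z
      have "- e * (h (fst z) * a (fst z)) - h (fst z) * s (fst z) + e * (h (fst z) * s (fst z) * a0 (fst z))
         = h (fst z) * (- (e * a (fst z)) - s (fst z) * (1 - e * a0 (fst z)))" by (simp add: algebra_simps)
      also have "\<dots> = 0" unfolding s(2) by simp
      finally show "- e * (h (fst z) * a (fst z)) - h (fst z) * s (fst z) + e * (h (fst z) * s (fst z) * a0 (fst z)) = 0" .
    qed
    finally show ?thesis by simp
  qed
  have aA: "\<bar>a1 x\<bar> \<le> 2 * K * R" "\<bar>a2 x\<bar> \<le> 2 * K * R" for x
    using a1(2,3)[of x] a2(2,3)[of x] by (simp_all add: abs_le_iff)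
  have ky: "integrable \<gamma> (\<lambda>z. k z * fst (snd z))" "integrable \<gamma> (\<lambda>z. k z * snd (snd z))" "integrable \<gamma> k"
  proof -
    have "\<bar>k z * t\<bar> \<le> K * R" if "\<bar>t\<bar> \<le> norm z" for z t
    proof (cases "k z = 0")
      case False
      then show ?thesis unfolding abs_mult using k[of z] R(2)[of z] that K0 by (intro mult_mono) auto
    qed (use K0 R in simp)
    note b = this
    have n: "\<bar>fst (snd z)\<bar> \<le> norm z" "\<bar>snd (snd z)\<bar> \<le> norm z" for z :: "pt \<times> pt"
      using abs_fst_le_norm[of "snd z"] abs_snd_le_norm[of "snd z"] norm_snd_le'[of z] by linarith+
    show "integrable \<gamma> (\<lambda>z. k z * fst (snd z))" by (rule bnd[OF _ b[OF n(1)]]) measurable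
    show "integrable \<gamma> (\<lambda>z. k z * snd (snd z))" by (rule bnd[OF _ b[OF n(2)]]) measurable
    show "integrable \<gamma> k" by (rule bnd[of _ K]) (use k in auto)
  qed
  have kw: "(\<integral>z. e * k z * (fst (snd z) - fst w) \<partial>\<gamma>) = 0" "(\<integral>z. e * k z * (snd (snd z) - snd w) \<partial>\<gamma>) = 0"
    using ky k1 by (simp_all add: w right_diff_distrib mult.assoc)
  have lin: "\<bar>t\<bar> \<le> B * (1 + (norm z)\<^sup>2)" if "\<bar>t\<bar> \<le> B * norm z" "0 \<le> B" for t B and z :: "pt \<times> pt"
  proof -
    have "norm z \<le> 1 + (norm z)\<^sup>2" using zero_le_power2[of "norm z - 1"] by (simp add: power2_eq_square algebra_simps) (smt (verit) norm_ge_zero)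
    then show ?thesis using that mult_left_mono[OF _ that(2)] by (meson order_trans)
  qed
  \<comment> \<open>A test set for the new first coordinate becomes the constant
    \<open>indicator A w\<close> on the collected mass and the function h of x on the rest. The two
    integrals vanish separately, so coinciding new positions do no harm.\<close>
  have ind: "(\<integral>z. indicator A (fst z) * (fst (snd z) - fst (fst z)) \<partial>N) = 0"
    "(\<integral>z. indicator A (fst z) * (snd (snd z) - snd (fst z)) \<partial>N) = 0" if A[measurable]: "A \<in> sets borel" for A
  proof -
    define h where "h x = (indicator A (x' x) :: real)" for x
    have hm[measurable]: "h \<in> borel_measurable borel" unfolding h_def by measurable
    have i0: "(\<lambda>z :: pt \<times> pt. indicat_real A (fst z)) \<in> borel_measurable borel"
      by (rule measurable_compose[OF measurable_proj(1) borel_measurable_indicator[OF A]])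
    have im: "(\<lambda>z :: pt \<times> pt. indicat_real A (fst z) * (fst (snd z) - fst (fst z))) \<in> borel_measurable borel"
      "(\<lambda>z :: pt \<times> pt. indicat_real A (fst z) * (snd (snd z) - snd (fst z))) \<in> borel_measurable borel"
      by (intro borel_measurable_times i0, measurable)+
    have h1: "\<bar>h x\<bar> \<le> 1" and h1': "\<bar>h x\<bar> \<le> 1 * (1 + norm x)" for x unfolding h_def by (auto simp: indicator_def)
    have b: "\<bar>indicator A (fst z) * (fst (snd z) - fst (fst z))\<bar> \<le> 2 * (1 + (norm z)\<^sup>2)"
       "\<bar>indicator A (fst z) * (snd (snd z) - snd (fst z))\<bar> \<le> 2 * (1 + (norm z)\<^sup>2)" for z
      by (rule lin; use dn[of z] in \<open>auto simp: indicator_def d1_def d2_def\<close>)+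
    have "(\<integral>z. indicator A (fst z) * (fst (snd z) - fst (fst z)) \<partial>N)
      = (\<integral>z. indicator A w * (e * k z * (fst (snd z) - fst w)) \<partial>\<gamma>)
        + (\<integral>z. h (fst z) * ((1 - e * k z) * (d1 z - \<delta>1 (fst z))) \<partial>\<gamma>)"
      unfolding N_quad(2)[OF im(1) b(1)]
      by (intro arg_cong2[where f = "(+)"] Bochner_Integration.integral_cong refl)
        (simp_all add: h_def d1_def x'_def algebra_simps)
    also have "\<dots> = 0"
      unfolding integral_mult_right_zero kw
      using rest[of h 1 \<delta>1 a1 "2 * K * R" d1 "2 * K * R"] h1 \<delta>1 aA kd a1_int[OF hm h1]
        martingale_orthogonal(1,5)[OF \<gamma> hm h1'] by (simp add: d1_def)
    finally show "(\<integral>z. indicator A (fst z) * (fst (snd z) - fst (fst z)) \<partial>N) = 0" .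
    have "(\<integral>z. indicator A (fst z) * (snd (snd z) - snd (fst z)) \<partial>N)
      = (\<integral>z. indicator A w * (e * k z * (snd (snd z) - snd w)) \<partial>\<gamma>)
        + (\<integral>z. h (fst z) * ((1 - e * k z) * (d2 z - \<delta>2 (fst z))) \<partial>\<gamma>)"
      unfolding N_quad(2)[OF im(2) b(2)]
      by (intro arg_cong2[where f = "(+)"] Bochner_Integration.integral_cong refl)
        (simp_all add: h_def d2_def x'_def algebra_simps)
    also have "\<dots> = 0"
      unfolding integral_mult_right_zero kw
      using rest[of h 1 \<delta>2 a2 "2 * K * R" d2 "2 * K * R"] h1 \<delta>2 aA kd a2_int[OF hm h1]
        martingale_orthogonal(2,6)[OF \<gamma> hm h1'] by (simp add: d2_def)
    finally show "(\<integral>z. indicator A (fst z) * (snd (snd z) - snd (fst z)) \<partial>N) = 0" .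
  qed
  have NG: "N \<in> Gamma \<nu>" unfolding Gamma_iff using NP2 Nsnd ind by blast
  show ?thesis
  proof (rule that[OF NG])
    let ?c = "\<lambda>z :: pt \<times> pt. c (fst z) (snd z)"
    have cb: "\<bar>c (fst z) (snd z)\<bar> \<le> 4 * (1 + (norm z)\<^sup>2)" for z :: "pt \<times> pt"
    proof -
      have "\<bar>?c z\<bar> \<le> (2 * norm z) * (2 * norm z)"
        using mult_mono[OF dn(1)[of z] dn(2)[of z]] by (simp add: c_def d1_def d2_def abs_mult abs_minus_commute)
      then show ?thesis by (simp add: power2_eq_square)
    qed
    have ic: "integrable \<gamma> ?c" by (rule P2_integrable_c[OF P2])
    have ikc: "integrable \<gamma> (\<lambda>z. k z * ?c z)" "integrable \<gamma> (\<lambda>z. k z * c w (snd z))"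
    proof -
      show "integrable \<gamma> (\<lambda>z. k z * ?c z)"
        by (rule Bochner_Integration.integrable_bound[OF integrable_mult_right[OF ic, of K]])
          (use k K0 in \<open>auto simp: abs_mult intro!: AE_I2 mult_right_mono\<close>)
      have "\<bar>k z * c w (snd z)\<bar> \<le> K * ((norm w + R) * (norm w + R))" for z
      proof (cases "k z = 0")
        case False
        then have "norm z \<le> R" by (rule R)
        then have "\<bar>fst w - fst (snd z)\<bar> \<le> norm w + R" "\<bar>snd w - snd (snd z)\<bar> \<le> norm w + R"
          using abs_fst_le_norm[of w] abs_snd_le_norm[of w] abs_fst_le_norm[of "snd z"] abs_snd_le_norm[of "snd z"] norm_snd_le'[of z]
          by linarith+
        then show ?thesis unfolding c_def abs_mult using k[of z] K0 R(1) by (intro mult_mono) auto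
      qed (use K0 R in simp)
      then show "integrable \<gamma> (\<lambda>z. k z * c w (snd z))" by (rule bnd[rotated]) measurable
    qed
    \<comment> \<open>The function \<rho> is the first-order change of the cost under the
      displacement; it is a sum of functions of x times increments and has mean zero. What remains,
      \<sigma>, is of order e^2: each of its two terms contributes 16 K^2 R^2, hence the constant
      32.\<close>
    define \<rho> where "\<rho> z = - (\<delta>1 (fst z) * d2 z) - \<delta>2 (fst z) * d1 z" for z
    define \<sigma> where "\<sigma> z = - e * (k z * \<rho> z) + (1 - e * k z) * (\<delta>1 (fst z) * \<delta>2 (fst z))" for z
    have [measurable]: "\<rho> \<in> borel_measurable borel" "\<sigma> \<in> borel_measurable borel" unfolding \<rho>_def \<sigma>_def by measurable
    have \<sigma>: "\<bar>\<sigma> z\<bar> \<le> e\<^sup>2 * (32 * K\<^sup>2 * R\<^sup>2)" for z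
    proof -
      have "\<bar>k z * \<rho> z\<bar> \<le> \<bar>\<delta>1 (fst z)\<bar> * \<bar>k z * d2 z\<bar> + \<bar>\<delta>2 (fst z)\<bar> * \<bar>k z * d1 z\<bar>"
        unfolding \<rho>_def by (rule order_trans[OF _ abs_triangle_ineq[THEN order_trans]])
          (auto simp: abs_mult[symmetric] algebra_simps)
      also have "\<dots> \<le> \<Delta> * (2 * K * R) + \<Delta> * (2 * K * R)"
        using \<delta>1(1) \<delta>2(1) kd \<Delta>0 by (intro add_mono mult_mono) auto
      finally have "e * \<bar>k z * \<rho> z\<bar> \<le> e * (\<Delta> * (2 * K * R) + \<Delta> * (2 * K * R))" using e(1) by (rule mult_left_mono)
      also have "\<dots> = e\<^sup>2 * (16 * K\<^sup>2 * R\<^sup>2)" unfolding \<Delta>_def by (simp add: power2_eq_square)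
      finally have 1: "\<bar>- e * (k z * \<rho> z)\<bar> \<le> e\<^sup>2 * (16 * K\<^sup>2 * R\<^sup>2)" using e(1) by (simp add: abs_mult)
      have "\<bar>(1 - e * k z) * (\<delta>1 (fst z) * \<delta>2 (fst z))\<bar> \<le> 1 * (\<Delta> * \<Delta>)"
        unfolding abs_mult using ek[of z] \<delta>1(1)[of "fst z"] \<delta>2(1)[of "fst z"] \<Delta>0 by (intro mult_mono) auto
      also have "\<dots> = e\<^sup>2 * (16 * K\<^sup>2 * R\<^sup>2)" unfolding \<Delta>_def by (simp add: power2_eq_square)
      finally show ?thesis using 1 unfolding \<sigma>_def by linarith
    qed
    have i\<sigma>: "integrable \<gamma> \<sigma>" by (rule bnd[OF _ \<sigma>]) measurable
    have \<delta>b: "\<bar>\<delta>1 x\<bar> \<le> \<Delta> * (1 + norm x)" "\<bar>\<delta>2 x\<bar> \<le> \<Delta> * (1 + norm x)" for x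
      using \<delta>1(1)[of x] \<delta>2(1)[of x] \<Delta>0 by (simp_all add: distrib_left add_increasing2)
    have \<rho>: "integrable \<gamma> \<rho>" "(\<integral>z. \<rho> z \<partial>\<gamma>) = 0"
      using martingale_orthogonal(2,6)[OF \<gamma> _ \<delta>b(1)] martingale_orthogonal(1,5)[OF \<gamma> _ \<delta>b(2)]
      by (simp_all add: \<rho>_def[abs_def] d1_def d2_def)
    have "primal N = (\<integral>z. e * k z * c w (snd z) \<partial>\<gamma>) + (\<integral>z. (1 - e * k z) * c (x' (fst z)) (snd z) \<partial>\<gamma>)"
      unfolding primal_def using N_quad(2)[OF _ cb] by simp
    also have "(\<integral>z. (1 - e * k z) * c (x' (fst z)) (snd z) \<partial>\<gamma>) = (\<integral>z. ?c z - e * (k z * ?c z) + \<rho> z + \<sigma> z \<partial>\<gamma>)"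
      by (intro Bochner_Integration.integral_cong refl)
        (simp add: c_def x'_def \<rho>_def \<sigma>_def d1_def d2_def algebra_simps)
    also have "\<dots> = primal \<gamma> - e * (\<integral>z. k z * ?c z \<partial>\<gamma>) + (\<integral>z. \<sigma> z \<partial>\<gamma>)"
      unfolding primal_def using ic ikc \<rho> i\<sigma> by simp
    also have "(\<integral>z. e * k z * c w (snd z) \<partial>\<gamma>) = e * (\<integral>z. k z * c w (snd z) \<partial>\<gamma>)"
      by (simp add: mult.assoc)
    finally have "primal N = primal \<gamma> + e * (\<integral>z. k z * (c w (snd z) - ?c z) \<partial>\<gamma>) + (\<integral>z. \<sigma> z \<partial>\<gamma>)"
      using ikc by (simp add: right_diff_distrib)
    moreover have "(\<integral>z. \<sigma> z \<partial>\<gamma>) \<le> (\<integral>z. e\<^sup>2 * (32 * K\<^sup>2 * R\<^sup>2) \<partial>\<gamma>)"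
      by (rule integral_mono) (use i\<sigma> \<sigma> in \<open>auto simp: abs_le_iff\<close>)
    ultimately show "primal N \<le> primal \<gamma> + e * (\<integral>z. k z * (c w (snd z) - ?c z) \<partial>\<gamma>) + e\<^sup>2 * (32 * K\<^sup>2 * R\<^sup>2)"
      by (simp add: prob_space)
  qed
qed

lemma minimizer_first_order:
  fixes k :: "pt \<times> pt \<Rightarrow> real"
  assumes min: "is_minimizer \<nu> \<gamma>" and km[measurable]: "k \<in> borel_measurable borel"
    and k: "\<And>z. 0 \<le> k z" "\<And>z. k z \<le> K" and R: "0 \<le> R" "\<And>z. k z \<noteq> 0 \<Longrightarrow> norm z \<le> R"
    and k1: "(\<integral>z. k z \<partial>\<gamma>) = 1"
    and w: "w = (\<integral>z. k z * fst (snd z) \<partial>\<gamma>, \<integral>z. k z * snd (snd z) \<partial>\<gamma>)"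
  shows "0 \<le> (\<integral>z. k z * (c w (snd z) - c (fst z) (snd z)) \<partial>\<gamma>)"
proof (rule ccontr)
  define J where "J = (\<integral>z. k z * (c w (snd z) - c (fst z) (snd z)) \<partial>\<gamma>)"
  define L where "L = 32 * K\<^sup>2 * R\<^sup>2"
  assume "\<not> ?thesis"
  then have J: "J < 0" unfolding J_def by simp
  have \<gamma>: "\<gamma> \<in> Gamma \<nu>" and opt: "\<And>\<gamma>'. \<gamma>' \<in> Gamma \<nu> \<Longrightarrow> primal \<gamma> \<le> primal \<gamma>'"
    using min unfolding is_minimizer_def by auto
  have K0: "0 \<le> K" using k[of 0] by linarith
  have L0: "0 \<le> L" unfolding L_def by simp
  \<comment> \<open>The first entry ensures e K \<le> 1/2, the second e L \<le> - J / 2, so that the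
    linear gain beats the quadratic error. The summands 1 guard against K = 0 and L = 0.\<close>
  define e where "e = min (1 / (2 * (K + 1))) (- J / (2 * (L + 1)))"
  have e0: "0 < e" unfolding e_def using K0 L0 J by (simp add: divide_neg_pos)
  have "e * K \<le> 1 / (2 * (K + 1)) * K" unfolding e_def using K0 by (intro mult_right_mono) auto
  also have "\<dots> \<le> 1 / 2" using K0 by (simp add: field_simps)
  finally have eK: "e * K \<le> 1 / 2" .
  have "e * L \<le> - J / (2 * (L + 1)) * L" unfolding e_def using L0 by (intro mult_right_mono) auto
  also have "\<dots> \<le> - J / 2" using L0 J by (simp add: field_simps)
  finally have "J + e * L < 0" using J by linarith
  then have "e * (J + e * L) < 0" using e0 by (simp add: mult_pos_neg)
  moreover obtain \<gamma>' where \<gamma>': "\<gamma>' \<in> Gamma \<nu>" "primal \<gamma>' \<le> primal \<gamma> + e * J + e\<^sup>2 * L"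
    using perturbed_coupling[OF \<gamma> km k R k1 w less_imp_le[OF e0] eK] unfolding J_def L_def by blast
  ultimately show False using opt[OF \<gamma>'(1)] by (simp add: power2_eq_square algebra_simps)
qed

lemma average_ge:
  fixes g :: "'a \<Rightarrow> real"
  assumes "measure M B > 0" "B \<in> sets M" "finite_measure M"
    and "integrable M (\<lambda>z. indicator B z * g z)" and ge: "\<And>z. z \<in> B \<Longrightarrow> a \<le> g z"
  shows "a \<le> (\<integral>z. indicator B z / measure M B * g z \<partial>M)"
proof -
  interpret finite_measure M by fact
  have "a * measure M B = (\<integral>z. indicator B z * a \<partial>M)"
    using assms(2) sets.sets_into_space[OF assms(2)] by (simp add: Int_absorb1 mult.commute)
  also have "\<dots> \<le> (\<integral>z. indicator B z * g z \<partial>M)"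
  proof (rule integral_mono)
    have "integrable M (indicat_real B)"
      using assms(2) by (intro integrable_real_indicator) (simp_all add: emeasure_eq_measure)
    then show "integrable M (\<lambda>z. indicator B z * a)" by (rule integrable_mult_left)
  qed (use assms(4) ge in \<open>auto simp: indicator_def\<close>)
  finally have "a \<le> (\<integral>z. indicator B z * g z \<partial>M) / measure M B"
    using assms(1) by (simp add: pos_le_divide_eq)
  then show ?thesis by simp
qed

text \<open>The density k spreads mass q over a small ball around z1 and 1 - q around z2. Its
  barycenter is close to w = q y + (1 - q) y', and the first-order condition passes to the limit by
  continuity of the cost.\<close>

lemma minimizer_pairwise:
  assumes min: "is_minimizer \<nu> \<gamma>" and z1: "z1 \<in> msupp \<gamma>" and z2: "z2 \<in> msupp \<gamma>" and q: "0 \<le> q" "q \<le> 1"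
  shows "q * c (fst z1) (snd z1) + (1 - q) * c (fst z2) (snd z2) \<le> q * (1 - q) * c (snd z1) (snd z2)"
proof -
  have \<gamma>: "\<gamma> \<in> Gamma \<nu>" using min unfolding is_minimizer_def by auto
  note P2 = GammaD(1)[OF \<gamma>]
  interpret prob_space \<gamma> by (rule P2_prob[OF P2])
  note [measurable_cong] = P2_sets[OF P2]
  define w where "w = q *\<^sub>R snd z1 + (1 - q) *\<^sub>R snd z2"
  define \<Psi> where "\<Psi> \<zeta> v = c v (snd \<zeta>) - c (fst \<zeta>) (snd \<zeta>)" for \<zeta> :: "pt \<times> pt" and v
  have "0 \<le> q * \<Psi> z1 w + (1 - q) * \<Psi> z2 w"
  proof (rule field_le_epsilon)
    fix \<eta> :: real assume \<eta>: "\<eta> > 0"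
    \<comment> \<open>The tolerance 2 r for v appears because each of the two coordinates of the
      barycenter is only known to within r.\<close>
    have "\<exists>r>0. \<forall>\<zeta> v. dist \<zeta> z < r \<longrightarrow> dist v w \<le> 2 * r \<longrightarrow> \<Psi> \<zeta> v < \<Psi> z w + \<eta>" for z
    proof -
      have "continuous_on UNIV (\<lambda>p. \<Psi> (fst p) (snd p))" unfolding \<Psi>_def by (intro continuous_intros)
      then obtain d where d: "d > 0" "\<And>p. dist p (z, w) < d \<Longrightarrow> dist (\<Psi> (fst p) (snd p)) (\<Psi> z w) < \<eta>"
        using \<eta> unfolding continuous_on_iff by (metis UNIV_I fst_conv snd_conv)
      show ?thesis
      proof (intro exI[of _ "d / 4"] conjI allI impI)
        fix \<zeta> v assume "dist \<zeta> z < d / 4" "dist v w \<le> 2 * (d / 4)"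
        then have "dist (\<zeta>, v) (z, w) < d"
          using sqrt_sum_squares_le_sum[of "dist \<zeta> z" "dist v w"] d(1) by (simp add: dist_Pair_Pair)
        from d(2)[OF this] show "\<Psi> \<zeta> v < \<Psi> z w + \<eta>" by (simp add: dist_real_def)
      qed (use d in simp)
    qed
    then obtain r1 r2 where r1: "r1 > 0" "\<And>\<zeta> v. dist \<zeta> z1 < r1 \<Longrightarrow> dist v w \<le> 2 * r1 \<Longrightarrow> \<Psi> \<zeta> v < \<Psi> z1 w + \<eta>"
      and r2: "r2 > 0" "\<And>\<zeta> v. dist \<zeta> z2 < r2 \<Longrightarrow> dist v w \<le> 2 * r2 \<Longrightarrow> \<Psi> \<zeta> v < \<Psi> z2 w + \<eta>" by meson
    define r where "r = min r1 r2"
    have r: "r > 0" unfolding r_def using r1 r2 by simp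
    have pos: "0 < measure \<gamma> (ball z r)" if "z \<in> msupp \<gamma>" for z
      using that r unfolding msupp_def by (auto simp: emeasure_eq_measure)
    define a where "a z \<zeta> = indicator (ball z r) \<zeta> / measure \<gamma> (ball z r)" for z \<zeta> :: "pt \<times> pt"
    have am[measurable]: "a z \<in> borel_measurable borel" for z
      unfolding a_def[abs_def]
      by (intro borel_measurable_divide borel_measurable_indicator borel_measurable_const) auto
    have a0: "0 \<le> a z \<zeta>" "a z \<zeta> \<le> 1 / measure \<gamma> (ball z r)" for z \<zeta> unfolding a_def by (auto simp: indicator_def)
    have ia: "integrable \<gamma> (\<lambda>\<zeta>. indicator (ball z r) \<zeta> * g \<zeta>)" "integrable \<gamma> (\<lambda>\<zeta>. a z \<zeta> * g \<zeta>)"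
      if "integrable \<gamma> g" for g z
    proof -
      show "integrable \<gamma> (\<lambda>\<zeta>. indicator (ball z r) \<zeta> * g \<zeta>)"
        using integrable_mult_indicator[of "ball z r" \<gamma> g] that P2_sets[OF P2] by simp
      then show "integrable \<gamma> (\<lambda>\<zeta>. a z \<zeta> * g \<zeta>)" unfolding a_def by simp
    qed
    have avg: "b \<le> (\<integral>\<zeta>. a z \<zeta> * g \<zeta> \<partial>\<gamma>)"
      if "z \<in> msupp \<gamma>" "integrable \<gamma> g" "\<And>\<zeta>. dist \<zeta> z < r \<Longrightarrow> b \<le> g \<zeta>" for b g z
      unfolding a_def
      by (rule average_ge) (use pos that ia finite_measure_axioms P2_sets[OF P2] in \<open>auto simp: dist_commute\<close>)
    have avg': "(\<integral>\<zeta>. a z \<zeta> * g \<zeta> \<partial>\<gamma>) \<le> b"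
      if "z \<in> msupp \<gamma>" "integrable \<gamma> g" "\<And>\<zeta>. dist \<zeta> z < r \<Longrightarrow> g \<zeta> \<le> b" for b g z
      using avg[of z "\<lambda>\<zeta>. - g \<zeta>" "- b"] that by simp
    have avg1: "(\<integral>\<zeta>. a z \<zeta> \<partial>\<gamma>) = 1" if "z \<in> msupp \<gamma>" for z
      using avg[OF that, of "\<lambda>_. 1" 1] avg'[OF that, of "\<lambda>_. 1" 1] by simp
    define k where "k \<zeta> = q * a z1 \<zeta> + (1 - q) * a z2 \<zeta>" for \<zeta>
    have k_int: "(\<integral>\<zeta>. k \<zeta> * g \<zeta> \<partial>\<gamma>) = q * (\<integral>\<zeta>. a z1 \<zeta> * g \<zeta> \<partial>\<gamma>) + (1 - q) * (\<integral>\<zeta>. a z2 \<zeta> * g \<zeta> \<partial>\<gamma>)"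
      if "integrable \<gamma> g" for g
    proof -
      have "(\<integral>\<zeta>. k \<zeta> * g \<zeta> \<partial>\<gamma>) = (\<integral>\<zeta>. q * (a z1 \<zeta> * g \<zeta>) + (1 - q) * (a z2 \<zeta> * g \<zeta>) \<partial>\<gamma>)"
        unfolding k_def by (simp add: distrib_right mult.assoc)
      then show ?thesis using ia(2)[OF that] by simp
    qed
    define v where "v = (\<integral>z. k z * fst (snd z) \<partial>\<gamma>, \<integral>z. k z * snd (snd z) \<partial>\<gamma>)"
    have close: "\<bar>(\<integral>\<zeta>. k \<zeta> * f (snd \<zeta>) \<partial>\<gamma>) - (q * f (snd z1) + (1 - q) * f (snd z2))\<bar> \<le> r"
      if int: "integrable \<gamma> (\<lambda>\<zeta>. f (snd \<zeta>))" and f: "\<And>x y. \<bar>f x - f y\<bar> \<le> dist x y" for f :: "pt \<Rightarrow> real"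
    proof -
      have n: "f (snd z) - r \<le> (\<integral>\<zeta>. a z \<zeta> * f (snd \<zeta>) \<partial>\<gamma>)" "(\<integral>\<zeta>. a z \<zeta> * f (snd \<zeta>) \<partial>\<gamma>) \<le> f (snd z) + r"
        if z: "z \<in> msupp \<gamma>" for z
      proof -
        have "\<bar>f (snd \<zeta>) - f (snd z)\<bar> \<le> r" if "dist \<zeta> z < r" for \<zeta>
          using f[of "snd \<zeta>" "snd z"] dist_snd_le[of \<zeta> z] that by linarith
        then show "f (snd z) - r \<le> (\<integral>\<zeta>. a z \<zeta> * f (snd \<zeta>) \<partial>\<gamma>)" "(\<integral>\<zeta>. a z \<zeta> * f (snd \<zeta>) \<partial>\<gamma>) \<le> f (snd z) + r"
          by (intro avg[OF z int] avg'[OF z int]; force simp: abs_le_iff)+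
      qed
      have "q * (f (snd z1) - r) + (1 - q) * (f (snd z2) - r) \<le> (\<integral>\<zeta>. k \<zeta> * f (snd \<zeta>) \<partial>\<gamma>)"
        unfolding k_int[OF int] using n(1)[OF z1] n(1)[OF z2] q by (intro add_mono mult_left_mono) auto
      moreover have "(\<integral>\<zeta>. k \<zeta> * f (snd \<zeta>) \<partial>\<gamma>) \<le> q * (f (snd z1) + r) + (1 - q) * (f (snd z2) + r)"
        unfolding k_int[OF int] using n(2)[OF z1] n(2)[OF z2] q by (intro add_mono mult_left_mono) auto
      ultimately show ?thesis by (simp add: abs_le_iff algebra_simps)
    qed
    have vw: "dist v w \<le> 2 * r"
    proof -
      have proj_le: "\<bar>fst x - fst y\<bar> \<le> dist x y" "\<bar>snd x - snd y\<bar> \<le> dist x y" for x y :: pt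
        using dist_fst_le[of x y] dist_snd_le[of x y] by (simp_all add: dist_real_def)
      have "dist v w \<le> \<bar>fst v - fst w\<bar> + \<bar>snd v - snd w\<bar>"
        using sqrt_sum_squares_le_sum_abs[of "fst v - fst w" "snd v - snd w"]
        by (simp add: dist_prod_def dist_real_def)
      moreover have "\<bar>fst v - fst w\<bar> \<le> r"
        using close[OF P2_integrable_coord(3)[OF P2] proj_le(1)] unfolding v_def w_def by simp
      moreover have "\<bar>snd v - snd w\<bar> \<le> r"
        using close[OF P2_integrable_coord(4)[OF P2] proj_le(2)] unfolding v_def w_def by simp
      ultimately show ?thesis by linarith
    qed
    have i\<Psi>: "integrable \<gamma> (\<lambda>\<zeta>. \<Psi> \<zeta> v)"
    proof -
      have "integrable \<gamma> (\<lambda>\<zeta>. c v (snd \<zeta>))"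
        unfolding c_def
      proof (rule P2_integrable_mult[OF P2])
        have "\<bar>t\<bar> \<le> norm v \<Longrightarrow> \<bar>s\<bar> \<le> norm z \<Longrightarrow> \<bar>t - s\<bar> \<le> (norm v + 1) * (1 + norm z)" for t s and z :: "pt \<times> pt"
          by (simp add: algebra_simps) (smt (verit) mult_nonneg_nonneg norm_ge_zero)
        note b = this
        show "\<bar>fst v - fst (snd z)\<bar> \<le> (norm v + 1) * (1 + norm z)" for z :: "pt \<times> pt"
          by (rule b[OF abs_fst_le_norm order_trans[OF abs_fst_le_norm norm_snd_le']])
        show "\<bar>snd v - snd (snd z)\<bar> \<le> (norm v + 1) * (1 + norm z)" for z :: "pt \<times> pt"
          by (rule b[OF abs_snd_le_norm order_trans[OF abs_snd_le_norm norm_snd_le']])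
      qed measurable
      then show ?thesis unfolding \<Psi>_def using P2_integrable_c[OF P2] by simp
    qed
    have "0 \<le> (\<integral>\<zeta>. k \<zeta> * (c v (snd \<zeta>) - c (fst \<zeta>) (snd \<zeta>)) \<partial>\<gamma>)"
    proof (rule minimizer_first_order[OF min, where K = "1 / measure \<gamma> (ball z1 r) + 1 / measure \<gamma> (ball z2 r)"
          and R = "norm z1 + norm z2 + r"])
      show "k \<in> borel_measurable borel" unfolding k_def by measurable
      show "0 \<le> k z" for z unfolding k_def using a0 q by simp
      show "k z \<le> 1 / measure \<gamma> (ball z1 r) + 1 / measure \<gamma> (ball z2 r)" for z
      proof -
        have "q * a z1 z \<le> 1 * (1 / measure \<gamma> (ball z1 r))" using a0 q by (intro mult_mono) auto
        moreover have "(1 - q) * a z2 z \<le> 1 * (1 / measure \<gamma> (ball z2 r))" using a0 q by (intro mult_mono) auto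
        ultimately show ?thesis unfolding k_def by linarith
      qed
      show "0 \<le> norm z1 + norm z2 + r" using r by simp
      show "norm z \<le> norm z1 + norm z2 + r" if "k z \<noteq> 0" for z
      proof -
        have "a z1 z \<noteq> 0 \<or> a z2 z \<noteq> 0" using that unfolding k_def by auto
        then have "dist z z1 < r \<or> dist z z2 < r" unfolding a_def by (auto simp: indicator_def dist_commute split: if_splits)
        then show ?thesis
        proof
          assume "dist z z1 < r"
          then show ?thesis using norm_triangle_ineq2[of z z1] norm_ge_zero[of z2] unfolding dist_norm by linarith
        next
          assume "dist z z2 < r"
          then show ?thesis using norm_triangle_ineq2[of z z2] norm_ge_zero[of z1] unfolding dist_norm by linarith
        qed
      qed
      show "(\<integral>z. k z \<partial>\<gamma>) = 1" using k_int[of "\<lambda>_. 1"] avg1[OF z1] avg1[OF z2] by simp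
    qed (rule v_def)
    also have "\<dots> = q * (\<integral>\<zeta>. a z1 \<zeta> * \<Psi> \<zeta> v \<partial>\<gamma>) + (1 - q) * (\<integral>\<zeta>. a z2 \<zeta> * \<Psi> \<zeta> v \<partial>\<gamma>)"
      using k_int[OF i\<Psi>] unfolding \<Psi>_def by simp
    also have "\<dots> \<le> q * (\<Psi> z1 w + \<eta>) + (1 - q) * (\<Psi> z2 w + \<eta>)"
    proof (intro add_mono mult_left_mono)
      show "(\<integral>\<zeta>. a z1 \<zeta> * \<Psi> \<zeta> v \<partial>\<gamma>) \<le> \<Psi> z1 w + \<eta>"
        by (rule avg'[OF z1 i\<Psi>], rule less_imp_le, rule r1(2)) (use vw in \<open>auto simp: r_def\<close>)
      show "(\<integral>\<zeta>. a z2 \<zeta> * \<Psi> \<zeta> v \<partial>\<gamma>) \<le> \<Psi> z2 w + \<eta>"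
        by (rule avg'[OF z2 i\<Psi>], rule less_imp_le, rule r2(2)) (use vw in \<open>auto simp: r_def\<close>)
    qed (use q in auto)
    finally show "0 \<le> q * \<Psi> z1 w + (1 - q) * \<Psi> z2 w + \<eta>" by (simp add: algebra_simps)
  qed
  \<comment> \<open>The cost is a quadratic form in the difference of its arguments, and w differs
    from y and y' by 1 - q and q times the difference y' - y, up to sign.\<close>
  moreover have "q * c w (snd z1) + (1 - q) * c w (snd z2) = q * (1 - q) * c (snd z1) (snd z2)"
    unfolding w_def c_def by (simp add: algebra_simps)
  ultimately show ?thesis unfolding \<Psi>_def by (simp add: right_diff_distrib)
qed

section \<open>Strong duality and uniqueness\<close>

text \<open>For positive a and b the choice q = b / (a + b) factors the right-hand side as a b / (a
  + b)^2 times the claimed expression. If a or b vanishes this factor degenerates, and the bound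
  comes from dividing by the small weight near an endpoint of [0, 1].\<close>

lemma quadratic_pair_bound:
  fixes a b D :: real
  assumes ab: "0 \<le> a" "0 \<le> b"
    and q: "\<And>q. 0 \<le> q \<Longrightarrow> q \<le> 1 \<Longrightarrow> 0 \<le> q * a\<^sup>2 + (1 - q) * b\<^sup>2 + q * (1 - q) * D"
  shows "0 \<le> (a + b)\<^sup>2 + D"
proof (rule ccontr)
  assume neg: "\<not> ?thesis"
  show False
  proof (cases "a = 0 \<or> b = 0")
    case True
    define e where "e = (a + b)\<^sup>2"
    \<comment> \<open>This weight gives e + (1 - p) D = (e + D) / 2, which is still
      negative.\<close>
    define p where "p = (e + D) / (2 * D)"
    have e0: "0 \<le> e" and eD: "e + D < 0" using neg unfolding e_def by simp_all
    have D: "D < 0" using e0 eD by linarith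
    have p: "0 < p" "p < 1" unfolding p_def using e0 eD D by (simp_all add: divide_neg_neg field_simps)
    have pD: "(1 - p) * D = (D - e) / 2" unfolding p_def using D by (simp add: field_simps)
    have half: "e + (1 - p) * D < 0" unfolding pD using eD by (simp add: field_simps)
    have "p * (e + (1 - p) * D) < 0" using half p by (simp add: mult_pos_neg)
    moreover have "0 \<le> p * (e + (1 - p) * D)"
    proof (cases "b = 0")
      case True
      then show ?thesis using q[of p] p unfolding e_def by (simp add: algebra_simps)
    next
      case False
      then show ?thesis using q[of "1 - p"] p \<open>a = 0 \<or> b = 0\<close> unfolding e_def by (simp add: algebra_simps)
    qed
    ultimately show False by simp
  next
    case False
    then have pos: "0 < a" "0 < b" using ab by auto
    have "0 \<le> b / (a + b) * a\<^sup>2 + (1 - b / (a + b)) * b\<^sup>2 + b / (a + b) * (1 - b / (a + b)) * D"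
      using pos by (intro q) (simp_all add: field_simps)
    also have "1 - b / (a + b) = a / (a + b)" using pos by (simp add: field_simps)
    also have "b / (a + b) * a\<^sup>2 + a / (a + b) * b\<^sup>2 + b / (a + b) * (a / (a + b)) * D
      = a * b / (a + b)\<^sup>2 * ((a + b)\<^sup>2 + D)"
    proof -
      have "a + b \<noteq> 0" using pos by simp
      then show ?thesis by (simp add: divide_simps power2_eq_square) (simp add: algebra_simps)
    qed
    finally have "0 \<le> a * b / (a + b)\<^sup>2 * ((a + b)\<^sup>2 + D)" .
    moreover have "a * b / (a + b)\<^sup>2 * ((a + b)\<^sup>2 + D) < 0"
      using neg pos by (intro mult_pos_neg) auto
    ultimately show False by linarith
  qed
qed

lemma contact_set_exists:
  fixes S :: "(pt \<times> pt) set"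
  assumes ne: "S \<noteq> {}"
    and pair: "\<And>z1 z2 q. z1 \<in> S \<Longrightarrow> z2 \<in> S \<Longrightarrow> 0 \<le> q \<Longrightarrow> q \<le> 1 \<Longrightarrow>
      q * c (fst z1) (snd z1) + (1 - q) * c (fst z2) (snd z2) \<le> q * (1 - q) * c (snd z1) (snd z2)"
  shows "\<exists>G\<in>MaxMono. \<forall>z\<in>S. \<forall>g\<in>G. c (fst z) (snd z) \<le> c g (snd z)"
proof -
  define a where "a z = sqrt (- 4 * c (fst z) (snd z))" for z :: "pt \<times> pt"
  have cneg: "c (fst z) (snd z) \<le> 0" if "z \<in> S" for z using pair[OF that that, of 1] by simp
  have a: "0 \<le> a z" "(a z)\<^sup>2 = - 4 * c (fst z) (snd z)" if "z \<in> S" for z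
    unfolding a_def using cneg[OF that] by simp_all
  \<comment> \<open>In these terms \<open>c g y \<ge> c x y\<close> says that \<open>pv g\<close> is
    within \<open>m z (pu g)\<close> of \<open>pv y\<close>.\<close>
  define m where "m z u = sqrt ((a z)\<^sup>2 + (u - pu (snd z))\<^sup>2)" for z u
  \<comment> \<open>The pair bound controls the difference in \<open>pv\<close> by the length of the
    vector (a z1 + a z2, pu y1 - pu y2). Splitting the second component at u and applying the
    triangle inequality in the plane gives the two half-widths at u.\<close>
  have key: "pv (snd z1) - m z1 u \<le> pv (snd z2) + m z2 u" if z: "z1 \<in> S" "z2 \<in> S" for z1 z2 u
  proof -
    define D where "D = (pu (snd z1) - pu (snd z2))\<^sup>2 - (pv (snd z1) - pv (snd z2))\<^sup>2"
    have "0 \<le> (a z1 + a z2)\<^sup>2 + D"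
    proof (rule quadratic_pair_bound)
      show "0 \<le> q * (a z1)\<^sup>2 + (1 - q) * (a z2)\<^sup>2 + q * (1 - q) * D" if "0 \<le> q" "q \<le> 1" for q
        using pair[OF z that] unfolding a(2)[OF z(1)] a(2)[OF z(2)] D_def c_eq_squares[of "snd z1" "snd z2"]
        by (simp add: algebra_simps)
    qed (use a z in auto)
    then have "(pv (snd z1) - pv (snd z2))\<^sup>2 \<le> (a z1 + a z2)\<^sup>2 + (pu (snd z1) - pu (snd z2))\<^sup>2"
      unfolding D_def by simp
    then have "\<bar>pv (snd z1) - pv (snd z2)\<bar> \<le> sqrt ((a z1 + a z2)\<^sup>2 + ((pu (snd z1) - u) + (u - pu (snd z2)))\<^sup>2)"
      by (intro real_le_rsqrt) simp
    also have "\<dots> \<le> sqrt ((a z1)\<^sup>2 + (pu (snd z1) - u)\<^sup>2) + m z2 u"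
      unfolding m_def by (rule real_sqrt_sum_squares_triangle_ineq)
    also have "sqrt ((a z1)\<^sup>2 + (pu (snd z1) - u)\<^sup>2) = m z1 u" unfolding m_def by (simp add: power2_commute)
    finally show ?thesis by linarith
  qed
  have m_lip: "m z s \<le> m z t + \<bar>s - t\<bar>" for z s t
  proof -
    have "m z s = sqrt ((a z + 0)\<^sup>2 + ((t - pu (snd z)) + (s - t))\<^sup>2)" unfolding m_def by simp
    also have "\<dots> \<le> sqrt ((a z)\<^sup>2 + (t - pu (snd z))\<^sup>2) + sqrt (0\<^sup>2 + (s - t)\<^sup>2)"
      by (rule real_sqrt_sum_squares_triangle_ineq)
    finally show ?thesis unfolding m_def by simp
  qed
  text \<open>By \<open>key\<close>, the strips \<open>|v - pv y| \<le> m z u\<close> meet on every vertical line \<open>u\<close> (in one dimension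
    pairwise intersection suffices); the graph of their greatest lower boundary is the required set.\<close>
  define f where "f u = (SUP z\<in>S. pv (snd z) - m z u)" for u
  have bdd: "bdd_above ((\<lambda>z. pv (snd z) - m z u) ` S)" for u
  proof -
    obtain z0 where "z0 \<in> S" using ne by blast
    then show ?thesis using key by (intro bdd_aboveI2[of _ _ "pv (snd z0) + m z0 u"]) blast
  qed
  have lo: "pv (snd z) - m z u \<le> f u" if "z \<in> S" for z u
    unfolding f_def by (rule cSUP_upper[OF that bdd])
  have up: "f u \<le> pv (snd z) + m z u" if "z \<in> S" for z u
    unfolding f_def using ne key that by (intro cSUP_least) auto
  have "f s \<le> f t + \<bar>s - t\<bar>" for s t
    unfolding f_def[of s]
  proof (rule cSUP_least[OF ne])
    fix z assume "z \<in> S"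
    then show "pv (snd z) - m z s \<le> f t + \<bar>s - t\<bar>" using lo[of z t] m_lip[of z t s] by (simp add: abs_minus_commute)
  qed
  then have lip: "\<bar>f s - f t\<bar> \<le> \<bar>s - t\<bar>" for s t by (smt (verit) abs_minus_commute)
  show ?thesis
  proof (intro bexI ballI)
    show "{x. pv x = f (pu x)} \<in> MaxMono" by (rule graph_MaxMono[OF lip])
    fix z g assume z: "z \<in> S" and g: "g \<in> {x. pv x = f (pu x)}"
    have "\<bar>pv g - pv (snd z)\<bar> \<le> m z (pu g)" using lo[OF z, of "pu g"] up[OF z, of "pu g"] g by simp
    then have "(pv g - pv (snd z))\<^sup>2 \<le> (m z (pu g))\<^sup>2" by (metis abs_ge_zero power2_abs power_mono)
    also have "\<dots> = (a z)\<^sup>2 + (pu g - pu (snd z))\<^sup>2" unfolding m_def by simp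
    also have "(a z)\<^sup>2 = - 4 * c (fst z) (snd z)" by (rule a(2)[OF z])
    finally show "c (fst z) (snd z) \<le> c g (snd z)" unfolding c_eq_squares[of g] by simp
  qed
qed

text \<open>The constructed G comes only with the inequality c \<le> \<open>phi G\<close> on the
  support; x need not yet be known to lie in G. Integration gives one inequality between the values
  and weak duality the other.\<close>

lemma strong_duality:
  assumes min: "is_minimizer \<nu> \<gamma>"
  shows "\<exists>G\<in>MaxMono. dual \<nu> G = ereal (primal \<gamma>)"
proof -
  have \<gamma>: "\<gamma> \<in> Gamma \<nu>" using min unfolding is_minimizer_def by auto
  note P2 = GammaD(1)[OF \<gamma>]
  interpret prob_space \<gamma> by (rule P2_prob[OF P2])
  note [measurable_cong] = P2_sets[OF P2]
  have ae: "AE z in \<gamma>. z \<in> msupp \<gamma>" by (rule AE_msupp[OF P2_sets[OF P2]])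
  then have "msupp \<gamma> \<noteq> {}" by auto
  from contact_set_exists[OF this minimizer_pairwise[OF min]]
  obtain G where G: "G \<in> MaxMono" "\<And>z g. z \<in> msupp \<gamma> \<Longrightarrow> g \<in> G \<Longrightarrow> c (fst z) (snd z) \<le> c g (snd z)"
    by auto
  have le: "ereal (c (fst z) (snd z)) \<le> phi G (snd z)" if "z \<in> msupp \<gamma>" for z
    unfolding phi_def using G(2)[OF that] by (intro INF_greatest) auto
  have ae': "AE z in \<gamma>. 0 \<le> - c (fst z) (snd z)" using ae
  proof eventually_elim
    case (elim z)
    from order_trans[OF le[OF this] phi_nonpos[OF G(1)]] show ?case by simp
  qed
  have "(\<integral>\<^sup>+ z. e2ennreal (- phi G (snd z)) \<partial>\<gamma>) \<le> (\<integral>\<^sup>+ z. ennreal (- c (fst z) (snd z)) \<partial>\<gamma>)"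
  proof (rule nn_integral_mono_AE)
    show "AE z in \<gamma>. e2ennreal (- phi G (snd z)) \<le> ennreal (- c (fst z) (snd z))" using ae
    proof eventually_elim
      case (elim z)
      have "- phi G (snd z) \<le> ereal (- c (fst z) (snd z))" using le[OF elim] by (simp flip: uminus_ereal.simps(1))
      from e2ennreal_mono[OF this] show ?case by simp
    qed
  qed
  also have "\<dots> = ennreal (\<integral>z. - c (fst z) (snd z) \<partial>\<gamma>)"
    by (intro nn_integral_eq_integral ae') (use P2_integrable_c[OF P2] in simp)
  also have "\<dots> = ennreal (- primal \<gamma>)" unfolding primal_def by simp
  finally have "enn2ereal (\<integral>\<^sup>+ z. e2ennreal (- phi G (snd z)) \<partial>\<gamma>) \<le> enn2ereal (ennreal (- primal \<gamma>))"
    by (simp add: less_eq_ennreal.rep_eq)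
  moreover have "0 \<le> (\<integral>z. - c (fst z) (snd z) \<partial>\<gamma>)" by (rule integral_nonneg_AE[OF ae'])
  ultimately have "enn2ereal (\<integral>\<^sup>+ z. e2ennreal (- phi G (snd z)) \<partial>\<gamma>) \<le> - ereal (primal \<gamma>)"
    by (simp add: primal_def)
  then have "ereal (primal \<gamma>) \<le> dual \<nu> G"
    unfolding dual_Gamma[OF \<gamma> G(1)] by (metis ereal_minus_le_minus ereal_uminus_uminus)
  with weak_duality[OF \<gamma> G(1)] G(1) show ?thesis by (meson antisym)
qed

section \<open>Agreement of the potentials of two maximizers\<close>

text \<open>Two maximizers share the contact points \<open>(x, y')\<close> of a minimizer. If their potentials differed at
  \<open>y\<close>, there would be contact points \<open>((s n, t n), (a n, b n))\<close> with \<open>(a n, b n)\<close> tending to \<open>y = (A, B)\<close>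
  for which the following holds. It is impossible: if \<open>t n\<close> tends to \<open>-\<infinity>\<close>, the cross inequalities force
  \<open>A \<le> a m\<close> for all \<open>m\<close>, so \<open>c (s n, t n) (a n, b n)\<close> is asymptotically at least
  \<open>c (s n, t n) y\<close>. The other ways of escaping to infinity reduce to this one by symmetry.\<close>

definition escaping_contacts ::
  "(nat \<Rightarrow> real) \<Rightarrow> (nat \<Rightarrow> real) \<Rightarrow> (nat \<Rightarrow> real) \<Rightarrow> (nat \<Rightarrow> real) \<Rightarrow> real \<Rightarrow> real \<Rightarrow> real \<Rightarrow> real \<Rightarrow> bool" where
  "escaping_contacts s t a b A B p q \<longleftrightarrow> a \<longlonglongrightarrow> A \<and> b \<longlonglongrightarrow> B \<and> p < q \<and> q \<le> 0 \<and>
     (\<forall>n. (s n - a n) * (t n - b n) < p) \<and> (\<forall>n. q \<le> (s n - A) * (t n - B)) \<and>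
     (\<forall>n m. (s m - a m) * (t m - b m) \<le> (s n - a m) * (t n - b m))"

lemma escaping_contacts_subseq:
  assumes e: "escaping_contacts s t a b A B p q" and r: "filterlim r at_top sequentially"
  shows "escaping_contacts (\<lambda>n. s (r n)) (\<lambda>n. t (r n)) (\<lambda>n. a (r n)) (\<lambda>n. b (r n)) A B p q"
proof -
  have "(\<lambda>n. a (r n)) \<longlonglongrightarrow> A" "(\<lambda>n. b (r n)) \<longlonglongrightarrow> B"
    using e filterlim_compose[OF _ r, of a "nhds A"] filterlim_compose[OF _ r, of b "nhds B"]
    unfolding escaping_contacts_def by auto
  then show ?thesis using e unfolding escaping_contacts_def by simp
qed

lemma escaping_contacts_swap:
  assumes "escaping_contacts s t a b A B p q"
  shows "escaping_contacts t s b a B A p q"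
proof -
  have "(x - y) * (v - w) = (v - w) * (x - y)" for x y v w :: real by (rule mult.commute)
  then show ?thesis using assms unfolding escaping_contacts_def by metis
qed

text \<open>Negating and exchanging the coordinates preserves the cost and the sign pattern a < s, t
  < b, but turns an upper bound for s into a lower bound for t.\<close>

lemma escaping_contacts_reflect:
  assumes "escaping_contacts s t a b A B p q"
  shows "escaping_contacts (\<lambda>n. - t n) (\<lambda>n. - s n) (\<lambda>n. - b n) (\<lambda>n. - a n) (- B) (- A) p q"
proof -
  have "(- x - - y) * (- v - - w) = (v - w) * (x - y)" for x y v w :: real by (simp add: algebra_simps)
  then show ?thesis using assms unfolding escaping_contacts_def by (auto intro: tendsto_minus)
qed

text \<open>For bounded contact points the costs to (a n, b n) and to (A, B) differ by a null
  sequence, whereas they stay separated by the gap from p to q.\<close>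

lemma not_escaping_bounded:
  assumes e: "escaping_contacts s t a b A B p q"
    and bs: "eventually (\<lambda>n. \<bar>s n\<bar> \<le> K) sequentially" and bt: "eventually (\<lambda>n. \<bar>t n\<bar> \<le> K) sequentially"
  shows False
proof -
  have a: "a \<longlonglongrightarrow> A" and b: "b \<longlonglongrightarrow> B" and pq: "p < q" using e unfolding escaping_contacts_def by auto
  have "(\<lambda>n. K * \<bar>B - b n\<bar> + K * \<bar>A - a n\<bar> + \<bar>a n * b n - A * B\<bar>) \<longlonglongrightarrow> K * \<bar>B - B\<bar> + K * \<bar>A - A\<bar> + \<bar>A * B - A * B\<bar>"
    by (intro tendsto_intros a b)
  then have "eventually (\<lambda>n. K * \<bar>B - b n\<bar> + K * \<bar>A - a n\<bar> + \<bar>a n * b n - A * B\<bar> < q - p) sequentially"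
    by (rule order_tendstoD(2)) (use pq in simp)
  from eventually_happens[OF eventually_conj[OF this eventually_conj[OF bs bt]]]
  obtain n where n: "K * \<bar>B - b n\<bar> + K * \<bar>A - a n\<bar> + \<bar>a n * b n - A * B\<bar> < q - p" "\<bar>s n\<bar> \<le> K" "\<bar>t n\<bar> \<le> K" by auto
  have "\<bar>s n * (B - b n)\<bar> \<le> K * \<bar>B - b n\<bar>" "\<bar>t n * (A - a n)\<bar> \<le> K * \<bar>A - a n\<bar>"
    unfolding abs_mult using n(2,3) by (intro mult_right_mono; simp)+
  moreover have "(s n - a n) * (t n - b n) - (s n - A) * (t n - B) = s n * (B - b n) + t n * (A - a n) + (a n * b n - A * B)"
    by (simp add: algebra_simps)
  moreover have "(s n - a n) * (t n - b n) < p" "q \<le> (s n - A) * (t n - B)" using e unfolding escaping_contacts_def by auto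
  ultimately show False using n(1) by linarith
qed

lemma not_escaping_at_bot:
  assumes e: "escaping_contacts s t a b A B p q"
    and sgn: "\<And>n. a n < s n \<and> t n < b n" and t: "filterlim t at_bot sequentially"
  shows False
proof -
  have a: "a \<longlonglongrightarrow> A" and b: "b \<longlonglongrightarrow> B" and pq: "p < q" "q \<le> 0"
    and p: "\<And>n. (s n - a n) * (t n - b n) < p" and q: "\<And>n. q \<le> (s n - A) * (t n - B)"
    and cross: "\<And>n m. (s m - a m) * (t m - b m) \<le> (s n - a m) * (t n - b m)"
    using e unfolding escaping_contacts_def by auto
  have tlt: "eventually (\<lambda>n. t n < y) sequentially" for y
    using t unfolding filterlim_at_bot_dense by blast
  \<comment> \<open>If a m were below A by d, then eventually s n - a m > d / 2 while t n tends to
    -\<infinity>. The threshold b m + 2 k / d is where the cross cost drops below k, the contact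
    cost at m.\<close>
  have A: "A \<le> a m" for m
  proof (rule ccontr)
    assume "\<not> A \<le> a m"
    define d where "d = A - a m"
    have d: "d > 0" using \<open>\<not> A \<le> a m\<close> unfolding d_def by simp
    define k where "k = (s m - a m) * (t m - b m)"
    have k0: "k < 0" using p[of m] pq unfolding k_def by linarith
    have "eventually (\<lambda>n. A - d / 2 < a n) sequentially" by (rule order_tendstoD(1)[OF a]) (use d in simp)
    from eventually_happens[OF eventually_conj[OF this tlt[of "b m + 2 * k / d"]]]
    obtain n where n: "A - d / 2 < a n" "t n < b m + 2 * k / d" by auto
    have "(s n - a m) * (t n - b m) < (d / 2) * (2 * k / d)"
    proof -
      have 1: "d / 2 < s n - a m" using n(1) sgn[of n] unfolding d_def by (simp add: field_simps)
      have 2: "t n - b m < 2 * k / d" "2 * k / d < 0" using n(2) k0 d by (simp_all add: divide_neg_pos)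
      have "(s n - a m) * (t n - b m) < (s n - a m) * (2 * k / d)"
        using 1 2 d by (intro mult_strict_left_mono) auto
      also have "\<dots> < (d / 2) * (2 * k / d)" using 1 2 by (intro mult_strict_right_mono_neg) auto
      finally show ?thesis .
    qed
    also have "\<dots> = k" using d by simp
    finally show False using cross[of m n] unfolding k_def by simp
  qed
  have "(\<lambda>n. (1 - q) * \<bar>B - b n\<bar>) \<longlonglongrightarrow> (1 - q) * \<bar>B - B\<bar>" by (intro tendsto_intros b)
  then have "eventually (\<lambda>n. (1 - q) * \<bar>B - b n\<bar> < q - p) sequentially"
    by (rule order_tendstoD(2)) (use pq in simp)
  from eventually_happens[OF eventually_conj[OF this tlt[of "B - 1"]]]
  obtain n where n: "(1 - q) * \<bar>B - b n\<bar> < q - p" "t n < B - 1" by auto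
  have s1: "s n - a n \<le> s n - A" "0 < s n - A" using A[of n] sgn[of n] by auto
  have "q \<le> (s n - A) * (t n - B)" by (rule q)
  also have "\<dots> \<le> (s n - A) * (- 1)" using s1 n(2) by (intro mult_left_mono) auto
  \<comment> \<open>The bound q together with t n < B - 1 keeps s n near A, so replacing b n by B in
    the second factor costs an arbitrarily small amount. Replacing a n by A has the favourable sign
    because A \<le> a n.\<close>
  finally have s2: "s n - A \<le> - q" by simp
  have "(s n - A) * (t n - b n) \<le> (s n - a n) * (t n - b n)"
    using s1 sgn[of n] by (intro mult_right_mono_neg) auto
  then have "(s n - A) * (t n - B) + (s n - A) * (B - b n) < p" using p[of n] by (simp add: algebra_simps)
  then have "q + (s n - A) * (B - b n) < p" using q[of n] by linarith
  moreover have "\<bar>(s n - A) * (B - b n)\<bar> \<le> (1 - q) * \<bar>B - b n\<bar>"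
    unfolding abs_mult using s1 s2 by (intro mult_right_mono) auto
  ultimately show False using n(1) by linarith
qed

lemma cofinal_choice:
  fixes P :: "nat \<Rightarrow> nat \<Rightarrow> bool"
  assumes "\<And>N. \<exists>n\<ge>N. P N n"
  obtains r where "filterlim r at_top sequentially" "\<And>N. P N (r N)"
proof -
  obtain r where r: "\<And>N. N \<le> r N" "\<And>N. P N (r N)" using assms by metis
  have "filterlim r at_top sequentially"
    by (rule filterlim_at_top_mono[OF filterlim_ident]) (simp add: r)
  with r(2) show ?thesis by (rule that[rotated])
qed

lemma escaping_contacts_bounded_below:
  assumes e: "escaping_contacts s t a b A B p q" and sgn: "\<And>n. a n < s n \<and> t n < b n"
  shows "\<exists>N. \<forall>n\<ge>N. - real N \<le> t n"
proof (rule ccontr)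
  assume "\<not> ?thesis"
  then have "\<exists>n\<ge>N. t n < - real N" for N by (meson not_less)
  then obtain r where r: "filterlim r at_top sequentially" "\<And>N. t (r N) < - real N"
    using cofinal_choice[of "\<lambda>N n. t n < - real N"] by blast
  have "filterlim (\<lambda>n. t (r n)) at_bot sequentially"
    by (rule filterlim_at_bot_mono[of "\<lambda>n. - real n"])
      (use r(2) in \<open>auto simp: filterlim_uminus_at_bot filterlim_real_sequentially
          intro!: always_eventually less_imp_le\<close>)
  from not_escaping_at_bot[OF escaping_contacts_subseq[OF e r(1)] _ this] sgn show False by blast
qed

text \<open>The sign pattern bounds s from below by a and t from above by b. The other two bounds
  come from excluding t tending to -\<infinity>, applied directly and after reflection.\<close>

lemma not_escaping_signed:
  assumes e: "escaping_contacts s t a b A B p q" and sgn: "\<And>n. a n < s n \<and> t n < b n"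
  shows False
proof -
  obtain N where N: "\<And>n. n \<ge> N \<Longrightarrow> - real N \<le> t n"
    using escaping_contacts_bounded_below[OF e sgn] by blast
  obtain N' where N': "\<And>n. n \<ge> N' \<Longrightarrow> - real N' \<le> - s n"
    using escaping_contacts_bounded_below[OF escaping_contacts_reflect[OF e]] sgn by (auto simp: neg_less_iff_less)
  have "convergent a" "convergent b" using e unfolding escaping_contacts_def convergent_def by auto
  then obtain K1 K2 where K: "\<And>n. \<bar>a n\<bar> \<le> K1" "\<And>n. \<bar>b n\<bar> \<le> K2"
    by (metis convergent_imp_Bseq Bseq_def real_norm_def)
  define K where "K = real N + real N' + \<bar>K1\<bar> + \<bar>K2\<bar>"
  have "\<bar>s n\<bar> \<le> K \<and> \<bar>t n\<bar> \<le> K" if "n \<ge> max N N'" for n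
    using N[of n] N'[of n] K[of n] sgn[of n] that unfolding K_def by (simp add: abs_le_iff)
  then have "eventually (\<lambda>n. \<bar>s n\<bar> \<le> K \<and> \<bar>t n\<bar> \<le> K) sequentially" unfolding eventually_sequentially by blast
  then show False using not_escaping_bounded[OF e] by (auto simp: eventually_conj_iff)
qed

lemma not_escaping_contacts: "\<not> escaping_contacts s t a b A B p q"
proof
  assume e: "escaping_contacts s t a b A B p q"
  have sgn: "a n < s n \<and> t n < b n \<or> b n < t n \<and> s n < a n" for n
  proof -
    have "(s n - a n) * (t n - b n) < 0" using e unfolding escaping_contacts_def by (smt (verit))
    then show ?thesis by (auto simp: mult_less_0_iff)
  qed
  show False
  proof (cases "\<forall>N. \<exists>n\<ge>N. a n < s n \<and> t n < b n")
    case True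
    then obtain r where r: "filterlim r at_top sequentially" "\<And>N. a (r N) < s (r N) \<and> t (r N) < b (r N)"
      using cofinal_choice[of "\<lambda>N n. a n < s n \<and> t n < b n"] by blast
    show False by (rule not_escaping_signed[OF escaping_contacts_subseq[OF e r(1)] r(2)])
  next
    case False
    then obtain N where N: "\<And>n. n \<ge> N \<Longrightarrow> b n < t n \<and> s n < a n" using sgn by blast
    have r: "filterlim (\<lambda>n. n + N) at_top sequentially" by (rule filterlim_add_const_nat_at_top)
    show False
      by (rule not_escaping_signed[OF escaping_contacts_swap[OF escaping_contacts_subseq[OF e r]]]) (use N in simp)
  qed
qed

text \<open>A gap \<open>phi G y < p < q < phi G' y\<close> is witnessed by some g in G with c(g, y)
  < p, and this inequality persists near y. Contact points with second coordinate near y then have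
  contact cost below p by comparison with g, while membership of their first coordinates in G' gives
  cost at least q to y and the cross inequalities.\<close>

lemma phi_le_of_common_contacts:
  assumes \<gamma>: "\<gamma> \<in> Gamma \<nu>" and G: "G \<in> MaxMono" and G': "G' \<in> MaxMono"
    and con: "\<And>z. z \<in> msupp \<gamma> \<Longrightarrow> ereal (c (fst z) (snd z)) = phi G (snd z)"
    and con': "\<And>z. z \<in> msupp \<gamma> \<Longrightarrow> fst z \<in> G' \<and> ereal (c (fst z) (snd z)) = phi G' (snd z)"
    and y: "y \<in> msupp \<nu>"
  shows "phi G' y \<le> phi G y"
proof (rule ccontr)
  note P2 = GammaD(1)[OF \<gamma>]
  note [measurable_cong] = P2_sets[OF P2]
  assume "\<not> phi G' y \<le> phi G y"
  then have "phi G y < phi G' y" by simp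
  from ereal_dense2[OF this] obtain p where p: "phi G y < ereal p" "ereal p < phi G' y" by auto
  from ereal_dense2[OF p(2)] obtain q where q: "ereal p < ereal q" "ereal q < phi G' y" by auto
  have q0: "q < 0" using less_le_trans[OF q(2) phi_nonpos[OF G']] by simp
  obtain g where g: "g \<in> G" "c g y < p" using p(1) unfolding phi_def by (auto simp: INF_less_iff)
  have op: "open {w. c g w < p}" by (intro open_Collect_less continuous_intros)
  have "\<exists>z\<in>msupp \<gamma>. c g (snd z) < p \<and> dist (snd z) y < 1 / real (Suc n)" for n
  proof -
    define U where "U = {w. c g w < p} \<inter> ball y (1 / real (Suc n))"
    have U: "open U" "y \<in> U" unfolding U_def using op g by auto
    then have "0 < emeasure \<nu> U" using y unfolding msupp_def by blast
    also have "emeasure \<nu> U = emeasure \<gamma> (snd -` U)"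
      unfolding GammaD(2)[OF \<gamma>, symmetric] using U(1) P2_space[OF P2] by (subst emeasure_distr) auto
    finally have pos: "0 < emeasure \<gamma> (snd -` U)" .
    have "\<exists>z\<in>msupp \<gamma>. snd z \<in> U"
    proof (rule ccontr)
      assume "\<not> (\<exists>z\<in>msupp \<gamma>. snd z \<in> U)"
      then have "AE z in \<gamma>. z \<notin> snd -` U" using AE_msupp[OF P2_sets[OF P2]] by (auto elim: eventually_mono)
      moreover have "snd -` U \<in> sets \<gamma>"
        unfolding P2_sets[OF P2] by (intro borel_open open_vimage_snd U(1))
      ultimately have "emeasure \<gamma> (snd -` U) = 0"
        using P2_space[OF P2] by (subst (asm) AE_iff_measurable[of "snd -` U"]) auto
      with pos show False by simp
    qed
    then show ?thesis unfolding U_def by (auto simp: dist_commute)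
  qed
  then obtain z where z: "\<And>n. z n \<in> msupp \<gamma>" "\<And>n. c g (snd (z n)) < p" "\<And>n. dist (snd (z n)) y < 1 / real (Suc n)"
    by metis
  have "(\<lambda>n. 1 / real (Suc n)) \<longlonglongrightarrow> 0" by (intro LIMSEQ_Suc lim_1_over_n)
  then have "(\<lambda>n. dist (snd (z n)) y) \<longlonglongrightarrow> 0"
    by (rule tendsto_sandwich[OF _ _ tendsto_const, rotated 2]) (use z(3) in \<open>auto intro!: always_eventually less_imp_le\<close>)
  then have lim: "(\<lambda>n. snd (z n)) \<longlonglongrightarrow> y" by (rule tendsto_dist_iff[THEN iffD2])
  have "escaping_contacts (\<lambda>n. fst (fst (z n))) (\<lambda>n. snd (fst (z n))) (\<lambda>n. fst (snd (z n))) (\<lambda>n. snd (snd (z n)))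
     (fst y) (snd y) p q"
    unfolding escaping_contacts_def c_def[symmetric]
  proof (intro conjI allI)
    show "(\<lambda>n. fst (snd (z n))) \<longlonglongrightarrow> fst y" "(\<lambda>n. snd (snd (z n))) \<longlonglongrightarrow> snd y"
      using tendsto_fst[OF lim] tendsto_snd[OF lim] by simp_all
    show "p < q" "q \<le> 0" using q q0 by simp_all
    show "c (fst (z n)) (snd (z n)) < p" for n
    proof -
      have "ereal (c (fst (z n)) (snd (z n))) \<le> ereal (c g (snd (z n)))"
        unfolding con[OF z(1)] by (rule phi_le[OF g(1)])
      then show ?thesis using z(2)[of n] by simp
    qed
    show "q \<le> c (fst (z n)) y" for n
    proof -
      have "ereal q < ereal (c (fst (z n)) y)"
        by (rule less_le_trans[OF q(2) phi_le]) (use con'[OF z(1)] in blast)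
      then show ?thesis by simp
    qed
    show "c (fst (z m)) (snd (z m)) \<le> c (fst (z n)) (snd (z m))" for n m
      using con'[OF z(1), of m] con'[OF z(1), of n] phi_le[of "fst (z n)" G' "snd (z m)"] by (metis ereal_less_eq(3))
  qed
  then show False using not_escaping_contacts by blast
qed

theorem theorem2:
  fixes \<nu> :: "pt measure"
  assumes "\<nu> \<in> P2"
  shows "(\<exists>\<gamma> G. is_minimizer \<nu> \<gamma> \<and> is_maximizer \<nu> G \<and> ereal (primal \<gamma>) = dual \<nu> G)
    \<and> (\<forall>\<gamma>\<in>Gamma \<nu>. \<forall>G\<in>MaxMono.
          (is_minimizer \<nu> \<gamma> \<and> is_maximizer \<nu> G) \<longleftrightarrow>
          (\<forall>z\<in>msupp \<gamma>. ereal (c (fst z) (snd z)) = phi G (snd z)))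
    \<and> (\<forall>\<gamma> G. is_minimizer \<nu> \<gamma> \<and> is_maximizer \<nu> G \<longrightarrow> msupp (distr \<gamma> borel fst) \<subseteq> G)
    \<and> (\<forall>G G'. is_maximizer \<nu> G \<and> is_maximizer \<nu> G' \<longrightarrow>
          (\<forall>y\<in>msupp \<nu>. phi G y = phi G' y) \<and> G \<inter> msupp \<nu> = G' \<inter> msupp \<nu>)
    \<and> (msupp \<nu> = UNIV \<longrightarrow> (\<forall>G G'. is_maximizer \<nu> G \<and> is_maximizer \<nu> G' \<longrightarrow>
          phi G = phi G' \<and> G = G'))"
proof -
  obtain \<gamma>0 where \<gamma>0: "is_minimizer \<nu> \<gamma>0" using minimizer_exists[OF assms] by blast
  obtain G0 where G0: "G0 \<in> MaxMono" "dual \<nu> G0 = ereal (primal \<gamma>0)" using strong_duality[OF \<gamma>0] by blast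
  have optimalI: "is_minimizer \<nu> \<gamma> \<and> is_maximizer \<nu> G"
    if "\<gamma> \<in> Gamma \<nu>" "G \<in> MaxMono" "dual \<nu> G = ereal (primal \<gamma>)" for \<gamma> G
    unfolding is_minimizer_def is_maximizer_def
    using that weak_duality[of _ \<nu> G] weak_duality[OF that(1)] by (auto simp flip: ereal_less_eq(3))
  have \<gamma>0_Gamma: "\<gamma>0 \<in> Gamma \<nu>" using \<gamma>0 unfolding is_minimizer_def by blast
  have G0_max: "is_maximizer \<nu> G0" using optimalI[OF \<gamma>0_Gamma G0] by blast
  \<comment> \<open>Optimal values do not depend on the chosen optimizers, so the equality for
    \<gamma>0 and G0 holds for every optimal pair.\<close>
  have no_gap: "dual \<nu> G = ereal (primal \<gamma>)" if "is_minimizer \<nu> \<gamma>" "is_maximizer \<nu> G" for \<gamma> G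
  proof -
    have "primal \<gamma> = primal \<gamma>0" using that(1) \<gamma>0 unfolding is_minimizer_def by (meson antisym)
    moreover have "dual \<nu> G = dual \<nu> G0" using that(2) G0_max unfolding is_maximizer_def by (meson antisym)
    ultimately show ?thesis using G0(2) by simp
  qed
  have contact: "AE z in \<gamma>. fst z \<in> G \<and> ereal (c (fst z) (snd z)) = phi G (snd z)"
    and contact_supp: "\<And>z. z \<in> msupp \<gamma> \<Longrightarrow> fst z \<in> G \<and> ereal (c (fst z) (snd z)) = phi G (snd z)"
    if opt: "is_minimizer \<nu> \<gamma>" "is_maximizer \<nu> G" for \<gamma> G
  proof -
    have \<gamma>: "\<gamma> \<in> Gamma \<nu>" and G: "G \<in> MaxMono" using opt unfolding is_minimizer_def is_maximizer_def by auto
    show ae: "AE z in \<gamma>. fst z \<in> G \<and> ereal (c (fst z) (snd z)) = phi G (snd z)"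
      by (rule dual_eq_primalD[OF \<gamma> G no_gap[OF opt]])
    show "fst z \<in> G \<and> ereal (c (fst z) (snd z)) = phi G (snd z)" if "z \<in> msupp \<gamma>" for z
      using msupp_contact[OF P2_sets[OF GammaD(1)[OF \<gamma>]] G ae that] by blast
  qed
  \<comment> \<open>Both maximizers are paired with the same minimizer \<gamma>0, which makes its
    contact points common to the two sets; the comparison is then used in both directions.\<close>
  have phi_eq: "phi G y = phi G' y" if "is_maximizer \<nu> G" "is_maximizer \<nu> G'" "y \<in> msupp \<nu>" for G G' y
  proof -
    have G: "G \<in> MaxMono" "G' \<in> MaxMono" using that unfolding is_maximizer_def by auto
    show ?thesis
      using phi_le_of_common_contacts[OF \<gamma>0_Gamma G(1) G(2)] phi_le_of_common_contacts[OF \<gamma>0_Gamma G(2) G(1)]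
        contact_supp[OF \<gamma>0 that(1)] contact_supp[OF \<gamma>0 that(2)] that(3)
      by (intro antisym) blast+
  qed
  have set_eq: "G \<inter> msupp \<nu> = G' \<inter> msupp \<nu>" if "is_maximizer \<nu> G" "is_maximizer \<nu> G'" for G G'
  proof -
    have "G \<in> MaxMono" "G' \<in> MaxMono" using that unfolding is_maximizer_def by auto
    then show ?thesis using phi_eq[OF that] phi_eq_0_iff by (metis (no_types, lifting) Int_iff subsetI subset_antisym)
  qed
  show ?thesis
  proof (intro conjI ballI allI impI)
    show "\<exists>\<gamma> G. is_minimizer \<nu> \<gamma> \<and> is_maximizer \<nu> G \<and> ereal (primal \<gamma>) = dual \<nu> G"
      using \<gamma>0 G0_max G0(2) by metis
  next
    fix \<gamma> G assume \<gamma>: "\<gamma> \<in> Gamma \<nu>" and G: "G \<in> MaxMono"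
    show "(is_minimizer \<nu> \<gamma> \<and> is_maximizer \<nu> G) \<longleftrightarrow> (\<forall>z\<in>msupp \<gamma>. ereal (c (fst z) (snd z)) = phi G (snd z))"
    proof
      assume "\<forall>z\<in>msupp \<gamma>. ereal (c (fst z) (snd z)) = phi G (snd z)"
      then have "AE z in \<gamma>. ereal (c (fst z) (snd z)) = phi G (snd z)"
        using AE_msupp[OF P2_sets[OF GammaD(1)[OF \<gamma>]]] by (auto elim: eventually_mono)
      then show "is_minimizer \<nu> \<gamma> \<and> is_maximizer \<nu> G"
        by (intro optimalI[OF \<gamma> G] dual_eq_primalI[OF \<gamma> G])
    qed (use contact_supp in blast)
  next
    fix \<gamma> G assume opt: "is_minimizer \<nu> \<gamma> \<and> is_maximizer \<nu> G"
    then have "\<gamma> \<in> Gamma \<nu>" "G \<in> MaxMono" unfolding is_minimizer_def is_maximizer_def by auto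
    then show "msupp (distr \<gamma> borel fst) \<subseteq> G"
      using contact[of \<gamma> G] opt by (intro msupp_distr_fst_subset) (auto elim: eventually_mono)
  next
    fix G G' assume "msupp \<nu> = UNIV" "is_maximizer \<nu> G \<and> is_maximizer \<nu> G'"
    then show "phi G = phi G'" "G = G'" using phi_eq[of G G'] set_eq[of G G'] by auto
  qed (use phi_eq set_eq in blast)+
qed

end
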